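(* Let $V \subset V'$ be an immediate extension of valuation rings, with fraction field extension $K \subset K'$. If $K'/K$ is algebraic, then $V'$ is a filtered union of its complete intersection $V$-subalgebras of finite type.
   Context: An inclusion $V \subset V'$ of valuation rings is an immediate extension if it is local as a map of local rings and induces isomorphisms between the value groups and between the residue fields of $V$ and $V'$. A complete intersection $V$-algebra of finite type is a $V$-algebra of the form $G/(P)$, where $G$ is a smooth $V$-algebra of finite type and $P$ is a (finite) regular sequence of elements of $G$; equivalently, a $V$-algebra of the form $T_h/(P)$, where $T$ is a polynomial $V$-algebra in finitely many variables, $0 \neq h \in T$, and $P$ is a regular sequence of elements. Such algebras are not assumed to be flat over $V$. A filtered union is a filtered direct limit (filtered colimit, i.e. a colimit indexed by a small filtered category) in which all objects are subobjects of the final colimit, so that all transition arrows are monomorphisms. *)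

theory Defs
  imports
    "HOL-Algebra.Algebraic_Closure_Type"
    "HOL-Library.Poly_Mapping"
    "HOL-Computational_Algebra.Fraction_Field"
begin

text \<open>
  All rings below are domains and are represented as subrings of an ambient field, given by a
  type of class \<^class>\<open>field\<close>; \<open>subalg S\<close> is the ring record with carrier \<open>S\<close>.
\<close>

abbreviation ambient :: "'a::field ring" where
  "ambient \<equiv> ring_of_type_algebra"

abbreviation subalg :: "'a::field set \<Rightarrow> 'a ring" where
  "subalg S \<equiv> ambient\<lparr>carrier := S\<rparr>"

section \<open>Valuation rings and immediate extensions\<close>

definition fraction_field :: "'a::field set \<Rightarrow> 'a set" where
  "fraction_field V = {a / b | a b. a \<in> V \<and> b \<in> V \<and> b \<noteq> 0}"

definition valuation_ring :: "'a::field set \<Rightarrow> bool" where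
  "valuation_ring V \<longleftrightarrow> subring V ambient \<and>
     (\<forall>x \<in> fraction_field V. x \<noteq> 0 \<longrightarrow> x \<in> V \<or> inverse x \<in> V)"

definition max_ideal :: "'a::field set \<Rightarrow> 'a set" where
  "max_ideal V = V - Units (subalg V)"

definition residue_field :: "'a::field set \<Rightarrow> 'a set ring" where
  "residue_field V = subalg V Quot max_ideal V"

text \<open>The value group is the quotient of the multiplicative group of the fraction field by the
  unit group of the valuation ring. Its order (the class of \<open>x\<close> is nonnegative iff \<open>x \<in> V\<close>)
  is not recorded: when \<open>V \<subseteq> V'\<close> is local, one has \<open>V = V' \<inter> fraction_field V\<close>, so that the
  induced map of value groups preserves and reflects the order.\<close>

definition value_group :: "'a::field set \<Rightarrow> 'a set monoid" where
  "value_group V = units_of (subalg (fraction_field V)) Mod Units (subalg V)"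

definition local_extension :: "'a::field set \<Rightarrow> 'a set \<Rightarrow> bool" where
  "local_extension V V' \<longleftrightarrow> V \<subseteq> V' \<and> max_ideal V \<subseteq> max_ideal V'"

definition induces_value_group_iso :: "'a::field set \<Rightarrow> 'a set \<Rightarrow> bool" where
  "induces_value_group_iso V V' \<longleftrightarrow>
     (\<exists>f \<in> iso (value_group V) (value_group V').
        \<forall>x \<in> fraction_field V - {0}.
          f (Units (subalg V) #>\<^bsub>ambient\<^esub> x) = Units (subalg V') #>\<^bsub>ambient\<^esub> x)"

definition induces_residue_field_iso :: "'a::field set \<Rightarrow> 'a set \<Rightarrow> bool" where
  "induces_residue_field_iso V V' \<longleftrightarrow>
     (\<exists>f \<in> ring_iso (residue_field V) (residue_field V').
        \<forall>x \<in> V. f (max_ideal V +>\<^bsub>ambient\<^esub> x) = max_ideal V' +>\<^bsub>ambient\<^esub> x)"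

definition immediate_extension :: "'a::field set \<Rightarrow> 'a set \<Rightarrow> bool" where
  "immediate_extension V V' \<longleftrightarrow>
     valuation_ring V \<and> valuation_ring V' \<and> local_extension V V' \<and>
     induces_value_group_iso V V' \<and> induces_residue_field_iso V V'"

definition algebraic_extension :: "'a::field set \<Rightarrow> 'a set \<Rightarrow> bool" where
  "algebraic_extension K K' \<longleftrightarrow> K \<subseteq> K' \<and> (\<forall>x \<in> K'. ring.algebraic ambient K x)"

section \<open>Complete intersection algebras of finite type\<close>

text \<open>Polynomials in the variables \<open>X\<^sub>0, X\<^sub>1, \<dots>\<close>; a monomial is the finitely supported
  function giving the exponent of each variable.\<close>

type_synonym 'a mpoly = "(nat \<Rightarrow>\<^sub>0 nat) \<Rightarrow>\<^sub>0 'a"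

text \<open>The polynomial ring \<open>V[X\<^sub>0, \<dots>, X\<^sub>n\<^sub>-\<^sub>1]\<close>, inside the polynomials over the ambient field.\<close>

definition poly_algebra :: "'a::field set \<Rightarrow> nat \<Rightarrow> 'a mpoly set" where
  "poly_algebra V n = {p. \<forall>m \<in> Poly_Mapping.keys p. Poly_Mapping.lookup p m \<in> V \<and> Poly_Mapping.keys m \<subseteq> {..<n}}"

text \<open>The localization \<open>T\<^sub>h\<close> of \<open>T = V[X\<^sub>0, \<dots>, X\<^sub>n\<^sub>-\<^sub>1]\<close> at the powers of \<open>h \<noteq> 0\<close>,
  inside the field of rational functions.\<close>

definition poly_localization :: "'a::field set \<Rightarrow> nat \<Rightarrow> 'a mpoly \<Rightarrow> 'a mpoly fract set" where
  "poly_localization V n h = {Fract p (h ^ k) | p k. p \<in> poly_algebra V n}"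

definition const_fract :: "'a::field \<Rightarrow> 'a mpoly fract" where
  "const_fract c = Fract (Poly_Mapping.single 0 c) 1"

definition regular_sequence :: "('a, 'b) ring_scheme \<Rightarrow> 'a list \<Rightarrow> bool" where
  "regular_sequence R ps \<longleftrightarrow> set ps \<subseteq> carrier R \<and>
     (\<forall>i < length ps. \<forall>x \<in> carrier R.
        ps ! i \<otimes>\<^bsub>R\<^esub> x \<in> Idl\<^bsub>R\<^esub> (set (take i ps)) \<longrightarrow> x \<in> Idl\<^bsub>R\<^esub> (set (take i ps))) \<and>
     Idl\<^bsub>R\<^esub> (set ps) \<noteq> carrier R"

text \<open>A subring \<open>A\<close> of the ambient field containing \<open>V\<close> is a complete intersection
  \<open>V\<close>-algebra of finite type iff it is isomorphic, as a \<open>V\<close>-algebra, to some \<open>T\<^sub>h/(P)\<close>.\<close>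

definition complete_intersection_subalgebra :: "'a::field set \<Rightarrow> 'a set \<Rightarrow> bool" where
  "complete_intersection_subalgebra V A \<longleftrightarrow> subring A ambient \<and> V \<subseteq> A \<and>
     (\<exists>n h ps. h \<in> poly_algebra V n \<and> h \<noteq> 0 \<and>
        (let G = subalg (poly_localization V n h); I = Idl\<^bsub>G\<^esub> (set ps) in
           regular_sequence G ps \<and>
           (\<exists>f \<in> ring_iso (G Quot I) (subalg A). \<forall>c \<in> V. f (I +>\<^bsub>G\<^esub> const_fract c) = c)))"

section \<open>Filtered unions\<close>

text \<open>In a filtered colimit whose objects are subobjects of the colimit \<open>S\<close>, the transition maps
  are the inclusions, so it amounts to a family of subsets directed by inclusion with union \<open>S\<close>.\<close>

definition filtered_union_of :: "'a set \<Rightarrow> 'a set set \<Rightarrow> bool" where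
  "filtered_union_of S \<F> \<longleftrightarrow> \<F> \<noteq> {} \<and>
     (\<forall>A \<in> \<F>. \<forall>B \<in> \<F>. \<exists>C \<in> \<F>. A \<subseteq> C \<and> B \<subseteq> C) \<and> \<Union>\<F> = S"

end

(* It suffices to place finitely many elements of V' in one complete intersection subalgebra. They
   lie in a finite extension F of K, reached by adjoining one element z at a time. By immediateness
   every value of V' is represented in K, which yields approximating polynomials T_0, T_1, ... in the
   style of MacLane and Kaplansky: each T_(i+1), scaled so that T_(i+1)(z) lies in V', satisfies
   e T_(i+1) = p_i(T_0, ..., T_i), where e is a non-unit of V and p_i is, modulo the maximal ideal,
   c X_i^l with c(z) a unit. The minimal polynomial of z gives the last relation. A local flatness
   criterion shows that relations with such leading terms form a regular sequence, locally at the
   point, with quotient torsion-free over V. Saturated ideals of a polynomial ring over a valuation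
   ring are finitely generated (Nagata), so all this already holds after inverting one h. *)

theory Submission
  imports Defs
begin

text \<open>Below the degree of the minimal polynomial, the values at z of monic polynomials of a
  given degree have no maximum: a value and a residue taken from V always allow one more
  improvement. A full MacLane chain would thus be infinite and involve limit polynomials. But only
  finitely many polynomials must have their values recognized at a time, so a finite chain is
  enough, with at most one new polynomial in each of finitely many degrees. The degrees used are
  those in which recognition really becomes harder; this is what makes the scaling factors e
  non-units and so keeps the leading terms intact modulo the maximal ideal.

  Relations among the T_i are first known only up to a denominator in V. Flatness removes it, which
  is why torsion-freeness is proved together with regularity. Directedness of the family is a
  separate point: complete intersection subalgebras are finitely generated over V, so a third one
  contains two given ones as soon as it contains their generators.\<close>

section \<open>Subrings given by sets, ideals and Noetherian rings\<close>

text \<open>Subrings are plain sets, so that all arithmetic is that of the type class; the records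
  of the statement enter through conversions such as \<open>subring_ambient_iff\<close> and
  \<open>genideal_subalg\<close>.\<close>

definition subring_set :: "'a::comm_ring_1 set \<Rightarrow> bool" where
  "subring_set R \<longleftrightarrow> 1 \<in> R \<and> (\<forall>x\<in>R. \<forall>y\<in>R. x - y \<in> R \<and> x * y \<in> R)"

lemma subring_set_one: "subring_set R \<Longrightarrow> 1 \<in> R"
  and subring_set_diff: "subring_set R \<Longrightarrow> x \<in> R \<Longrightarrow> y \<in> R \<Longrightarrow> x - y \<in> R"
  and subring_set_mult: "subring_set R \<Longrightarrow> x \<in> R \<Longrightarrow> y \<in> R \<Longrightarrow> x * y \<in> R"
  by (auto simp: subring_set_def)

lemma subring_set_zero: "subring_set R \<Longrightarrow> 0 \<in> R"
  using subring_set_diff[of R 1 1] by (simp add: subring_set_one)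

lemma subring_set_uminus: "subring_set R \<Longrightarrow> x \<in> R \<Longrightarrow> - x \<in> R"
  using subring_set_diff[of R 0 x] by (simp add: subring_set_zero)

lemma subring_set_add: "subring_set R \<Longrightarrow> x \<in> R \<Longrightarrow> y \<in> R \<Longrightarrow> x + y \<in> R"
  using subring_set_diff[of R x "- y"] by (simp add: subring_set_uminus)

lemma subring_set_sum: "subring_set R \<Longrightarrow> (\<And>i. i \<in> I \<Longrightarrow> f i \<in> R) \<Longrightarrow> sum f I \<in> R"
  by (induction I rule: infinite_finite_induct) (auto intro: subring_set_zero subring_set_add)

lemma subring_set_prod: "subring_set R \<Longrightarrow> (\<And>i. i \<in> I \<Longrightarrow> f i \<in> R) \<Longrightarrow> prod f I \<in> R"
  by (induction I rule: infinite_finite_induct) (auto intro: subring_set_one subring_set_mult)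

lemma subring_set_power: "subring_set R \<Longrightarrow> x \<in> R \<Longrightarrow> x ^ n \<in> R"
  by (induction n) (auto intro: subring_set_one subring_set_mult)

lemmas subring_set_intros = subring_set_one subring_set_zero subring_set_diff subring_set_uminus subring_set_add subring_set_mult
  subring_set_sum subring_set_prod subring_set_power

text \<open>Built by adding one multiple at a time, so that statements about generated ideals go by
  induction over linear combinations. The ring \<open>R\<close> is an argument because it varies:
  Noetherian subrings, \<open>V\<close>, polynomial rings, localizations.\<close>

inductive_set gen :: "'a::comm_ring_1 set \<Rightarrow> 'a set \<Rightarrow> 'a set" for R S where
  gen_zero: "0 \<in> gen R S"
| gen_step: "y \<in> gen R S \<Longrightarrow> r \<in> R \<Longrightarrow> x \<in> S \<Longrightarrow> r * x + y \<in> gen R S"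

lemma gen_add: "x \<in> gen R S \<Longrightarrow> y \<in> gen R S \<Longrightarrow> x + y \<in> gen R S"
  by (induction rule: gen.induct) (auto simp: add.assoc intro: gen_step)

lemma gen_mult:
  assumes "subring_set R" "r \<in> R" "x \<in> gen R S" shows "r * x \<in> gen R S"
  using assms(3)
proof induction
  case gen_zero
  then show ?case by (simp add: gen.gen_zero)
next
  case (gen_step y q x)
  then show ?case
    using gen.gen_step[of "r * y" R S "r * q" x] assms(1,2)
    by (simp add: distrib_left subring_set_mult mult.assoc)
qed

lemma gen_base: "subring_set R \<Longrightarrow> x \<in> S \<Longrightarrow> x \<in> gen R S"
  using gen_step[OF gen_zero, of 1 R x S] by (simp add: subring_set_one)

lemma gen_base_mult: "r \<in> R \<Longrightarrow> x \<in> S \<Longrightarrow> r * x \<in> gen R S"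
  using gen_step[OF gen_zero, of r R x S] by simp

lemma gen_uminus: "subring_set R \<Longrightarrow> x \<in> gen R S \<Longrightarrow> - x \<in> gen R S"
  using gen_mult[of R "-1" x S] by (simp add: subring_set_uminus subring_set_one)

lemma gen_diff: "subring_set R \<Longrightarrow> x \<in> gen R S \<Longrightarrow> y \<in> gen R S \<Longrightarrow> x - y \<in> gen R S"
  using gen_add[of x R S "- y"] by (simp add: gen_uminus)

lemma gen_sum: "(\<And>i. i \<in> I \<Longrightarrow> f i \<in> gen R S) \<Longrightarrow> sum f I \<in> gen R S"
  by (induction I rule: infinite_finite_induct) (auto intro: gen_zero gen_add)

lemma gen_subset: "subring_set R \<Longrightarrow> S \<subseteq> R \<Longrightarrow> gen R S \<subseteq> R"
proof
  fix x assume R: "subring_set R" "S \<subseteq> R" and "x \<in> gen R S"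
  from this(3) show "x \<in> R"
    by induction (use R in \<open>auto intro: subring_set_intros\<close>)
qed

definition is_ideal :: "'a::comm_ring_1 set \<Rightarrow> 'a set \<Rightarrow> bool" where
  "is_ideal R I \<longleftrightarrow> 0 \<in> I \<and> I \<subseteq> R \<and> (\<forall>x\<in>I. \<forall>y\<in>I. x + y \<in> I) \<and> (\<forall>r\<in>R. \<forall>x\<in>I. r * x \<in> I)"

lemma is_idealD:
  assumes "is_ideal R I"
  shows "0 \<in> I" "I \<subseteq> R" "x \<in> I \<Longrightarrow> y \<in> I \<Longrightarrow> x + y \<in> I" "r \<in> R \<Longrightarrow> x \<in> I \<Longrightarrow> r * x \<in> I"
  using assms by (auto simp: is_ideal_def)

lemma is_ideal_uminus: "subring_set R \<Longrightarrow> is_ideal R I \<Longrightarrow> x \<in> I \<Longrightarrow> - x \<in> I"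
  using is_idealD(4)[of R I "-1" x] by (simp add: subring_set_intros)

lemma is_ideal_diff: "subring_set R \<Longrightarrow> is_ideal R I \<Longrightarrow> x \<in> I \<Longrightarrow> y \<in> I \<Longrightarrow> x - y \<in> I"
  using is_idealD(3)[of R I x "- y"] is_ideal_uminus[of R I y] by simp

lemma is_ideal_sum: "is_ideal R I \<Longrightarrow> (\<And>i. i \<in> A \<Longrightarrow> f i \<in> I) \<Longrightarrow> sum f A \<in> I"
  by (induction A rule: infinite_finite_induct) (auto dest: is_idealD)

lemma gen_is_ideal: "subring_set R \<Longrightarrow> S \<subseteq> R \<Longrightarrow> is_ideal R (gen R S)"
  using gen_subset[of R S] by (auto simp: is_ideal_def gen_zero gen_add gen_mult)

lemma gen_least: "is_ideal R I \<Longrightarrow> S \<subseteq> I \<Longrightarrow> gen R S \<subseteq> I"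
proof
  fix x assume I: "is_ideal R I" "S \<subseteq> I" and "x \<in> gen R S"
  from this(3) show "x \<in> I"
    by induction (use I in \<open>auto dest: is_idealD\<close>)
qed

lemma gen_mono: "S \<subseteq> T \<Longrightarrow> gen R S \<subseteq> gen R T"
proof
  fix x assume S: "S \<subseteq> T" and "x \<in> gen R S"
  from this(2) show "x \<in> gen R T"
    by induction (use S in \<open>auto intro: gen.intros\<close>)
qed

lemma gen_mono_ring: "R \<subseteq> R' \<Longrightarrow> gen R S \<subseteq> gen R' S"
proof
  fix x assume S: "R \<subseteq> R'" and "x \<in> gen R S"
  from this(2) show "x \<in> gen R' S"
    by induction (use S in \<open>auto intro: gen.intros\<close>)
qed

lemma gen_finite_support: "x \<in> gen R S \<Longrightarrow> \<exists>T\<subseteq>S. finite T \<and> x \<in> gen R T"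
proof (induction rule: gen.induct)
  case gen_zero
  then show ?case by (intro exI[of _ "{}"]) (auto intro: gen.gen_zero)
next
  case (gen_step y r x)
  then obtain T where T: "T \<subseteq> S" "finite T" "y \<in> gen R T" by blast
  have "y \<in> gen R (insert x T)" using gen_mono[of T "insert x T" R] T(3) by blast
  then have "r * x + y \<in> gen R (insert x T)"
    by (rule gen.gen_step) (use gen_step in auto)
  then show ?case using T gen_step by (intro exI[of _ "insert x T"]) auto
qed

definition noetherian :: "'a::comm_ring_1 set \<Rightarrow> bool" where
  "noetherian R \<longleftrightarrow> subring_set R \<and> (\<forall>I. is_ideal R I \<longrightarrow> (\<exists>S\<subseteq>I. finite S \<and> I \<subseteq> gen R S))"

lemma noetherian_sring: "noetherian R \<Longrightarrow> subring_set R"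
  by (simp add: noetherian_def)

text \<open>The ascending chain condition for sequences: finitely many generators of the ideal of
  all \<open>x n\<close> involve finitely many terms, and the next term is a combination of
  those.\<close>

lemma noetherian_seq:
  assumes "noetherian R" "\<And>n::nat. x n \<in> R"
  obtains n where "x n \<in> gen R (x ` {..<n})"
proof -
  have R: "subring_set R" using assms(1) by (rule noetherian_sring)
  define I where "I = gen R (range x)"
  have "is_ideal R I" unfolding I_def using R assms(2) by (intro gen_is_ideal) auto
  then obtain S where S: "S \<subseteq> I" "finite S" "I \<subseteq> gen R S"
    using assms(1) unfolding noetherian_def by blast
  have ex: "\<exists>k. s \<in> gen R (x ` {..<k})" if sI: "s \<in> I" for s
  proof -
    obtain T where T: "T \<subseteq> range x" "finite T" "s \<in> gen R T"
      using gen_finite_support[of s R "range x"] sI unfolding I_def by auto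
    obtain A where A: "finite A" "T = x ` A" using T(1,2) 
      using finite_subset_image[of T x UNIV] by auto
    obtain k where "\<forall>a\<in>A. a < k" using A(1) finite_nat_set_iff_bounded by auto
    then have "T \<subseteq> x ` {..<k}" using A by auto
    then show ?thesis using subsetD[OF gen_mono T(3)] by (intro exI)
  qed
  then have "\<forall>s. \<exists>k. s \<in> I \<longrightarrow> s \<in> gen R (x ` {..<k})" by blast
  then obtain k where k: "\<And>s. s \<in> I \<Longrightarrow> s \<in> gen R (x ` {..<k s})" unfolding choice_iff by blast
  obtain n where n: "\<forall>s\<in>S. k s \<le> n" using S(2) finite_nat_set_iff_bounded_le[of "k ` S"] by auto
  have "S \<subseteq> gen R (x ` {..<n})"
  proof
    fix s assume s: "s \<in> S"
    then have "x ` {..<k s} \<subseteq> x ` {..<n}" using n by auto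
    then show "s \<in> gen R (x ` {..<n})" using gen_mono k[of s] s S(1) by blast
  qed
  then have "I \<subseteq> gen R (x ` {..<n})"
    using S(3) gen_least[OF gen_is_ideal[OF R, of "x ` {..<n}"]] assms(2) by blast
  moreover have "x n \<in> I" unfolding I_def by (rule gen_base[OF R]) auto
  ultimately show thesis using that by blast
qed

text \<open>Well-founded towards larger ideals, for the Noetherian induction on coefficient ideals
  in \<open>nzd_all\<close>. A strictly ascending chain would supply one new element per step,
  against \<open>noetherian_seq\<close>.\<close>

lemma noetherian_wf:
  assumes "noetherian R"
  shows "wf {(I, J). is_ideal R I \<and> is_ideal R J \<and> J \<subset> I}"
proof (rule ccontr)
  assume "\<not> ?thesis"
  then obtain f where f: "\<And>i. (f (Suc i), f i) \<in> {(I, J). is_ideal R I \<and> is_ideal R J \<and> J \<subset> I}"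
    unfolding wf_iff_no_infinite_down_chain by blast
  then have f: "\<And>i. is_ideal R (f i)" "\<And>i. f i \<subset> f (Suc i)" by auto
  have "\<And>i. \<exists>x. x \<in> f (Suc i) \<and> x \<notin> f i" using f(2) by blast
  then obtain x where x: "\<And>i. x i \<in> f (Suc i)" "\<And>i. x i \<notin> f i" by metis
  have mono: "f i \<subseteq> f j" if "i \<le> j" for i j
    using that lift_Suc_mono_le[of f] f(2) by blast
  obtain n where n: "x n \<in> gen R (x ` {..<n})"
    using noetherian_seq[OF assms, of x] x(1) is_idealD(2)[OF f(1)] by blast
  have "x ` {..<n} \<subseteq> f n"
  proof
    fix y assume "y \<in> x ` {..<n}"
    then obtain i where "i < n" "y = x i" by auto
    then show "y \<in> f n" using x(1)[of i] mono[of "Suc i" n] by auto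
  qed
  then show False using n gen_least[OF f(1)] x(2) by blast
qed

lemma noetherian_image:
  assumes R: "noetherian R"
    and hom: "h 1 = 1" "\<And>x y. x \<in> R \<Longrightarrow> y \<in> R \<Longrightarrow> h (x + y) = h x + h y"
      "\<And>x y. x \<in> R \<Longrightarrow> y \<in> R \<Longrightarrow> h (x * y) = h x * h y"
  shows "noetherian (h ` R)"
proof -
  have sR: "subring_set R" using R by (rule noetherian_sring)
  have h0: "h 0 = 0" using hom(2)[of 0 0] sR by (simp add: subring_set_zero)
  have hm: "h (- x) = - h x" if "x \<in> R" for x
    using hom(2)[of x "- x"] that sR h0 by (simp add: subring_set_uminus add_eq_0_iff)
  have sS: "subring_set (h ` R)"
    unfolding subring_set_def
  proof (intro conjI ballI)
    show "1 \<in> h ` R" using hom(1) sR subring_set_one by force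
    fix u v assume "u \<in> h ` R" "v \<in> h ` R"
    then obtain x y where xy: "x \<in> R" "y \<in> R" "u = h x" "v = h y" by auto
    have "h (x - y) = u - v" using hom(2)[of x "- y"] xy hm sR by (simp add: subring_set_uminus)
    then show "u - v \<in> h ` R" using xy sR by (metis image_eqI subring_set_diff)
    show "u * v \<in> h ` R" using xy sR hom(3) by (metis image_eqI subring_set_mult)
  qed
  moreover have "\<exists>S\<subseteq>I. finite S \<and> I \<subseteq> gen (h ` R) S" if I: "is_ideal (h ` R) I" for I
  proof -
    define I' where "I' = {x \<in> R. h x \<in> I}"
    have "is_ideal R I'"
      using I sR hom h0 by (auto simp: is_ideal_def I'_def subring_set_intros)
    then obtain S where S: "S \<subseteq> I'" "finite S" "I' \<subseteq> gen R S" using R unfolding noetherian_def by blast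
    have gen: "x \<in> R \<and> h x \<in> gen (h ` R) (h ` S)" if "x \<in> gen R S" for x
      using that
    proof induction
      case gen_zero
      then show ?case by (simp add: h0 gen.gen_zero sR subring_set_zero)
    next
      case (gen_step y r x)
      moreover have "x \<in> R" using gen_step S I'_def by auto
      ultimately show ?case using sR
        by (auto simp: hom subring_set_intros intro!: gen.gen_step)
    qed
    show ?thesis
    proof (intro exI[of _ "h ` S"] conjI)
      show "h ` S \<subseteq> I" using S(1) by (auto simp: I'_def)
      show "finite (h ` S)" using S by simp
      show "I \<subseteq> gen (h ` R) (h ` S)"
      proof
        fix u assume u: "u \<in> I"
        then obtain x where "x \<in> R" "u = h x" using is_idealD(2)[OF I] by blast
        then have "x \<in> gen R S" using S(3) u by (auto simp: I'_def)
        then show "u \<in> gen (h ` R) (h ` S)" using gen \<open>u = h x\<close> by blast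
      qed
    qed
  qed
  ultimately show ?thesis unfolding noetherian_def by blast
qed

lemma noetherian_int: "noetherian (range (of_int :: int \<Rightarrow> 'a::comm_ring_1))"
proof -
  have "noetherian (UNIV :: int set)"
    unfolding noetherian_def
  proof (intro conjI allI impI)
    show "subring_set (UNIV :: int set)" by (simp add: subring_set_def)
    fix I :: "int set" assume I: "is_ideal UNIV I"
    show "\<exists>S\<subseteq>I. finite S \<and> I \<subseteq> gen UNIV S"
    proof (cases "\<exists>x\<in>I. x \<noteq> 0")
      case False
      then show ?thesis by (intro exI[of _ "{}"]) (auto intro: gen_zero)
    next
      case True
      define P where "P = (\<lambda>n::nat. n > 0 \<and> int n \<in> I)"
      obtain x where x: "x \<in> I" "x \<noteq> 0" using True by blast
      have "P (nat \<bar>x\<bar>)" unfolding P_def using x is_idealD(4)[OF I, of "-1" x] by (auto simp: abs_if)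
      then have P: "P (LEAST n. P n)" by (rule LeastI)
      define d where "d = (LEAST n. P n)"
      have d: "d > 0" "int d \<in> I" using P unfolding d_def P_def by auto
      have "I \<subseteq> gen UNIV {int d}"
      proof
        fix y assume y: "y \<in> I"
        have "y mod int d = y + (- (y div int d)) * int d" by (simp add: minus_div_mult_eq_mod [symmetric])
        have "(- (y div int d)) * int d \<in> I" by (rule is_idealD(4)[OF I]) (use d in auto)
        then have ym: "y mod int d \<in> I" unfolding \<open>y mod int d = _\<close> by (rule is_idealD(3)[OF I y])
        have "y mod int d = 0"
        proof (rule ccontr)
          assume "y mod int d \<noteq> 0"
          then have "y mod int d > 0" using pos_mod_sign[of "int d" y] d(1) by linarith
          then have "P (nat (y mod int d))" using ym unfolding P_def by simp
          then have "d \<le> nat (y mod int d)" unfolding d_def by (rule Least_le)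
          then show False using d pos_mod_bound[of "int d" y] by linarith
        qed
        then have "y = (y div int d) * int d" by auto
        then show "y \<in> gen UNIV {int d}" using gen_base_mult[of "y div int d" UNIV "int d" "{int d}"] by simp
      qed
      then show ?thesis using d by (intro exI[of _ "{int d}"]) auto
    qed
  qed
  from noetherian_image[OF this, of of_int] show ?thesis by simp
qed

text \<open>The coordinates are made monotone one after another by passing to subsequences. A
  decreasing sequence of naturals attains its minimum and is constant from there on, so its tail is
  increasing too.\<close>

lemma dickson:
  fixes a :: "nat \<Rightarrow> nat \<Rightarrow> nat"
  shows "\<exists>f :: nat \<Rightarrow> nat. strict_mono f \<and> (\<forall>i<n. mono (\<lambda>k. a (f k) i))"
proof (induction n)
  case 0
  then show ?case by (intro exI[of _ "\<lambda>n::nat. n"]) (auto simp: strict_mono_def)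
next
  case (Suc n)
  then obtain f :: "nat \<Rightarrow> nat" where f: "strict_mono f" "\<forall>i<n. mono (\<lambda>k. a (f k) i)" by blast
  obtain g where g: "strict_mono g" "monoseq (\<lambda>k. a (f (g k)) n)"
    using seq_monosub[of "\<lambda>k. a (f k) n"] by blast
  let ?b = "\<lambda>k. a (f (g k)) n"
  obtain h :: "nat \<Rightarrow> nat" where h: "strict_mono h" "mono (\<lambda>k. ?b (h k))"
  proof (cases "incseq ?b")
    case True
    then show thesis using that[of "\<lambda>k. k"] by (simp add: strict_mono_def)
  next
    case False
    then have dec: "decseq ?b" using g(2) unfolding monoseq_iff by blast
    define c where "c = (LEAST v. v \<in> range ?b)"
    have "c \<in> range ?b" unfolding c_def by (rule LeastI[of _ "?b 0"]) simp
    then obtain k0 where k0: "c = ?b k0" by blast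
    have "?b (k + k0) = c" for k
    proof (rule antisym)
      show "?b (k + k0) \<le> c" unfolding k0 using dec by (simp add: decseq_def)
      show "c \<le> ?b (k + k0)" unfolding c_def by (rule Least_le) simp
    qed
    then show thesis using that[of "\<lambda>k. k + k0"] by (simp add: strict_mono_def mono_def)
  qed
  show ?case
  proof (intro exI[of _ "f \<circ> g \<circ> h"] conjI allI impI)
    show "strict_mono (f \<circ> g \<circ> h)" using f g h by (simp add: strict_mono_o)
    fix i assume "i < Suc n"
    show "mono (\<lambda>k. a ((f \<circ> g \<circ> h) k) i)"
    proof (cases "i = n")
      case True then show ?thesis using h by simp
    next
      case False
      then have m: "mono (\<lambda>k. a (f k) i)" using f(2) \<open>i < Suc n\<close> by simp
      have "mono (g \<circ> h)" using g h strict_mono_mono strict_mono_o by blast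
      then show ?thesis using m by (auto simp: mono_def)
    qed
  qed
qed

section \<open>Polynomials in several variables\<close>

abbreviation lk where "lk \<equiv> Poly_Mapping.lookup"
abbreviation ks where "ks \<equiv> Poly_Mapping.keys"
abbreviation sg where "sg \<equiv> Poly_Mapping.single"

definition linear_ext :: "('k \<Rightarrow> 'b \<Rightarrow> 'c) \<Rightarrow> ('k \<Rightarrow>\<^sub>0 'b::comm_monoid_add) \<Rightarrow> 'c::comm_monoid_add" where
  "linear_ext \<phi> x = (\<Sum>m\<in>ks x. \<phi> m (lk x m))"

lemma linear_ext_superset:
  assumes "finite S" "ks x \<subseteq> S" "\<And>m. \<phi> m 0 = 0"
  shows "linear_ext \<phi> x = (\<Sum>m\<in>S. \<phi> m (lk x m))"
  unfolding linear_ext_def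
  by (rule sum.mono_neutral_left) (use assms in \<open>auto simp: in_keys_iff\<close>)

lemma linear_ext_add:
  assumes "\<And>m. \<phi> m 0 = 0" "\<And>m a b. \<phi> m (a + b) = \<phi> m a + \<phi> m b"
  shows "linear_ext \<phi> (x + y) = linear_ext \<phi> x + linear_ext \<phi> y"
proof -
  have fin: "finite (ks x \<union> ks y)" by simp
  have "ks (x + y) \<subseteq> ks x \<union> ks y" by (rule keys_add)
  then show ?thesis
    using linear_ext_superset[OF fin, where \<phi> = \<phi>] assms by (simp add: lookup_add sum.distrib)
qed

lemma linear_ext_single: "(\<And>m. \<phi> m 0 = 0) \<Longrightarrow> linear_ext \<phi> (sg m a) = \<phi> m a"
  by (cases "a = 0") (auto simp: linear_ext_def)

lemma mpoly_eq_sum: "(x :: 'k \<Rightarrow>\<^sub>0 'b::comm_monoid_add) = (\<Sum>m\<in>ks x. sg m (lk x m))"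
  by (rule poly_mapping_eqI)
    (auto simp: lookup_sum lookup_single when_def in_keys_iff)

lemma mpoly_induct [case_names single add]:
  fixes x :: "'k \<Rightarrow>\<^sub>0 'b::comm_monoid_add"
  assumes s: "\<And>m a. P (sg m a)" and a: "\<And>x y. P x \<Longrightarrow> P y \<Longrightarrow> P (x + y)"
  shows "P x"
proof -
  have "P (\<Sum>m\<in>S. sg m (lk x m))" if "finite S" for S
    using that
  proof induction
    case empty
    then show ?case using s[of undefined 0] by simp
  qed (auto intro: s a)
  from this[of "ks x"] show ?thesis by (simp flip: mpoly_eq_sum)
qed

lemma poly_algebra_iff:
  "x \<in> poly_algebra R n \<longleftrightarrow> (\<forall>m\<in>ks x. lk x m \<in> R \<and> ks m \<subseteq> {..<n})"
  by (simp add: poly_algebra_def)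

lemma poly_algebra_lookup: "x \<in> poly_algebra R n \<Longrightarrow> 0 \<in> R \<Longrightarrow> lk x m \<in> R"
  by (cases "m \<in> ks x") (auto simp: poly_algebra_iff in_keys_iff)

lemma poly_algebra_single: "a \<in> R \<Longrightarrow> ks m \<subseteq> {..<n} \<Longrightarrow> sg m a \<in> poly_algebra R n"
  by (auto simp: poly_algebra_iff split: if_splits)

lemma poly_algebra_mono: "R \<subseteq> R' \<Longrightarrow> n \<le> n' \<Longrightarrow> poly_algebra R n \<subseteq> poly_algebra R' n'"
  by (force simp: poly_algebra_iff)

lemma poly_algebra_add:
  assumes "subring_set R" "x \<in> poly_algebra R n" "y \<in> poly_algebra R n"
  shows "x + y \<in> poly_algebra R n"
  using assms keys_add[of x y] poly_algebra_lookup[of x R n] poly_algebra_lookup[of y R n]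
  by (fastforce simp: poly_algebra_iff lookup_add subring_set_zero intro: subring_set_add)

lemma poly_algebra_induct [consumes 2, case_names single add]:
  assumes x: "x \<in> poly_algebra R n" and "subring_set R"
    and s: "\<And>m a. a \<in> R \<Longrightarrow> ks m \<subseteq> {..<n} \<Longrightarrow> P (sg m a)"
    and a: "\<And>x y. x \<in> poly_algebra R n \<Longrightarrow> y \<in> poly_algebra R n \<Longrightarrow> P x \<Longrightarrow> P y \<Longrightarrow> P (x + y)"
  shows "P x"
proof -
  have "P (\<Sum>m\<in>S. sg m (lk x m)) \<and> (\<Sum>m\<in>S. sg m (lk x m)) \<in> poly_algebra R n"
    if "finite S" "S \<subseteq> ks x" for S
    using that
  proof induction
    case empty
    then show ?case using s[of 0 0] \<open>subring_set R\<close> by (simp add: subring_set_zero poly_algebra_iff)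
  next
    case (insert m S)
    then have "lk x m \<in> R" "ks m \<subseteq> {..<n}" using x by (auto simp: poly_algebra_iff)
    then show ?case using insert assms(2)
      by (auto intro!: s a poly_algebra_add poly_algebra_single)
  qed
  from this[of "ks x"] show ?thesis by (simp flip: mpoly_eq_sum)
qed

lemma poly_algebra_uminus: "subring_set R \<Longrightarrow> x \<in> poly_algebra R n \<Longrightarrow> - x \<in> poly_algebra R n"
  by (auto simp: poly_algebra_iff subring_set_uminus)

lemma poly_algebra_mult:
  assumes R: "subring_set R" and x: "x \<in> poly_algebra R n" and y: "y \<in> poly_algebra R n"
  shows "x * y \<in> poly_algebra R n"
  using x R
proof (induction rule: poly_algebra_induct)
  case (single m a)
  note ma = this
  show ?case using y R
  proof (induction rule: poly_algebra_induct)
    case (single m' b)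
    then show ?case using ma R keys_add[of m m']
      by (auto simp: mult_single intro!: poly_algebra_single subring_set_mult)
  qed (auto simp: distrib_left intro: poly_algebra_add[OF R])
qed (auto simp: distrib_right intro: poly_algebra_add[OF R])

lemma poly_algebra_subring_set: "subring_set R \<Longrightarrow> subring_set (poly_algebra R n)"
  unfolding subring_set_def[of "poly_algebra R n"]
proof (intro conjI ballI)
  assume R: "subring_set R"
  show "1 \<in> poly_algebra R n" using poly_algebra_single[of 1 R 0 n] R by (simp add: subring_set_one)
  fix x y assume "x \<in> poly_algebra R n" "y \<in> poly_algebra R n"
  then show "x - y \<in> poly_algebra R n" "x * y \<in> poly_algebra R n"
    using poly_algebra_add[OF R, of x n "- y"] poly_algebra_uminus[OF R] poly_algebra_mult[OF R] by auto
qed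

definition Const :: "'a::zero \<Rightarrow> (nat \<Rightarrow>\<^sub>0 nat) \<Rightarrow>\<^sub>0 'a" where "Const a = sg 0 a"
definition Var :: "nat \<Rightarrow> (nat \<Rightarrow>\<^sub>0 nat) \<Rightarrow>\<^sub>0 'a::zero_neq_one" where "Var i = sg (sg i 1) 1"

lemma Var_power: "(Var i :: 'a::comm_ring_1 mpoly) ^ l = sg (sg i l) 1"
proof (induction l)
  case (Suc l)
  have "sg i (Suc 0) + sg i l = sg i (Suc l)" by (simp flip: single_add)
  then show ?case using Suc by (simp add: Var_def mult_single)
qed simp

lemma Const_hom: "Const (a + b) = Const a + (Const b :: 'a::comm_ring_1 mpoly)"
  "Const (a * b) = Const a * (Const b :: 'a mpoly)" "Const 1 = (1 :: 'a mpoly)" "Const 0 = (0 :: 'a mpoly)"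
  "Const (a - b) = Const a - (Const b :: 'a mpoly)" "Const (- a) = - (Const a :: 'a mpoly)"
  by (simp_all add: Const_def single_add mult_single single_diff single_uminus)

lemma lookup_Const_mult: "lk (Const a * (x :: 'a::comm_ring_1 mpoly)) m = a * lk x m"
  unfolding Const_def mult_map_scale_conv_mult[symmetric]
  by (simp add: map.rep_eq when_def)

lemma Const_in: "a \<in> R \<Longrightarrow> Const a \<in> poly_algebra R n"
  unfolding Const_def by (rule poly_algebra_single) auto

lemma Var_in: "subring_set R \<Longrightarrow> i < n \<Longrightarrow> Var i \<in> poly_algebra R n"
  unfolding Var_def by (rule poly_algebra_single) (auto simp: subring_set_one)

definition mon :: "(nat \<Rightarrow> 'b::comm_ring_1) \<Rightarrow> (nat \<Rightarrow>\<^sub>0 nat) \<Rightarrow> 'b" where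
  "mon T m = (\<Prod>i\<in>ks m. T i ^ lk m i)"

lemma mon_superset: "finite S \<Longrightarrow> ks m \<subseteq> S \<Longrightarrow> mon T m = (\<Prod>i\<in>S. T i ^ lk m i)"
  unfolding mon_def by (rule prod.mono_neutral_left) (auto simp: in_keys_iff)

lemma mon_add: "mon T (m + m') = mon T m * mon T m'"
proof -
  have "finite (ks m \<union> ks m')" by simp
  note sup = mon_superset[OF this, where T = T]
  have "mon T (m + m') = (\<Prod>i\<in>ks m \<union> ks m'. T i ^ lk (m + m') i)" by (rule sup[OF keys_add])
  moreover have "mon T m = (\<Prod>i\<in>ks m \<union> ks m'. T i ^ lk m i)" by (rule sup) simp
  moreover have "mon T m' = (\<Prod>i\<in>ks m \<union> ks m'. T i ^ lk m' i)" by (rule sup) simp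
  ultimately show ?thesis by (simp add: lookup_add power_add prod.distrib)
qed

lemma mon_0 [simp]: "mon T 0 = 1" by (simp add: mon_def)

lemma mon_single: "mon T (sg i l) = T i ^ l"
  by (cases "l = 0") (auto simp: mon_def)

definition is_ring_hom :: "('a::comm_ring_1 \<Rightarrow> 'b::comm_ring_1) \<Rightarrow> bool" where
  "is_ring_hom c \<longleftrightarrow> c 1 = 1 \<and> (\<forall>x y. c (x + y) = c x + c y \<and> c (x * y) = c x * c y)"

lemma is_ring_hom_id: "is_ring_hom (\<lambda>x. x)" by (simp add: is_ring_hom_def)

lemma is_ring_hom_pconst: "is_ring_hom (\<lambda>x. [:x:])"
  by (simp add: is_ring_hom_def pCons_one)

lemma is_ring_hom_0: "is_ring_hom c \<Longrightarrow> c 0 = 0"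
  unfolding is_ring_hom_def by (metis add_cancel_right_left)

text \<open>The coefficient map is a parameter because two evaluations are needed: at elements of
  the ambient field, and at univariate polynomials, where coefficients become constants.\<close>

definition eval_mpoly :: "('a::comm_ring_1 \<Rightarrow> 'b::comm_ring_1) \<Rightarrow> (nat \<Rightarrow> 'b) \<Rightarrow> 'a mpoly \<Rightarrow> 'b" where
  "eval_mpoly c T x = linear_ext (\<lambda>m a. c a * mon T m) x"

lemma eval_mpoly_single: "is_ring_hom c \<Longrightarrow> eval_mpoly c T (sg m a) = c a * mon T m"
  unfolding eval_mpoly_def by (rule linear_ext_single) (simp add: is_ring_hom_0)

lemma eval_mpoly_add: "is_ring_hom c \<Longrightarrow> eval_mpoly c T (x + y) = eval_mpoly c T x + eval_mpoly c T y"
  unfolding eval_mpoly_def by (rule linear_ext_add) (simp_all add: is_ring_hom_0, simp add: is_ring_hom_def distrib_right)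

lemma eval_mpoly_mult: 
  assumes "is_ring_hom c" shows "eval_mpoly c T (x * y) = eval_mpoly c T x * eval_mpoly c T y"
proof (induction x rule: mpoly_induct)
  case (single m a)
  show ?case
  proof (induction y rule: mpoly_induct)
    case (single m' b)
    then show ?case using assms by (simp add: mult_single eval_mpoly_single mon_add) (simp add: is_ring_hom_def)
  qed (simp add: distrib_left eval_mpoly_add assms)
qed (simp add: distrib_right eval_mpoly_add assms)

lemma eval_mpoly_Const: "is_ring_hom c \<Longrightarrow> eval_mpoly c T (Const a) = c a"
  by (simp add: Const_def eval_mpoly_single)

lemma eval_mpoly_Var: "is_ring_hom c \<Longrightarrow> eval_mpoly c T (Var i) = T i"
  by (simp add: Var_def eval_mpoly_single mon_single) (simp add: is_ring_hom_def)

lemma eval_mpoly_1: "is_ring_hom c \<Longrightarrow> eval_mpoly c T 1 = 1"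
  using eval_mpoly_Const[of c T 1] by (simp add: Const_hom is_ring_hom_def)

lemma eval_mpoly_0: "eval_mpoly c T 0 = 0"
  by (simp add: eval_mpoly_def linear_ext_def)

lemma eval_mpoly_uminus: "is_ring_hom c \<Longrightarrow> eval_mpoly c T (- x) = - eval_mpoly c T x"
  using eval_mpoly_add[of c T x "- x"] by (simp add: eval_mpoly_0 add_eq_0_iff)

lemma eval_mpoly_diff: "is_ring_hom c \<Longrightarrow> eval_mpoly c T (x - y) = eval_mpoly c T x - eval_mpoly c T y"
  using eval_mpoly_add[of c T x "- y"] by (simp add: eval_mpoly_uminus)

lemma eval_mpoly_power: "is_ring_hom c \<Longrightarrow> eval_mpoly c T (x ^ k) = eval_mpoly c T x ^ k"
  by (induction k) (auto simp: eval_mpoly_1 eval_mpoly_mult)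

lemma eval_mpoly_sum: "is_ring_hom c \<Longrightarrow> eval_mpoly c T (sum f I) = (\<Sum>i\<in>I. eval_mpoly c T (f i))"
  by (induction I rule: infinite_finite_induct) (auto simp: eval_mpoly_0 eval_mpoly_add)

lemmas eval_mpoly_hom = eval_mpoly_add eval_mpoly_mult eval_mpoly_Const eval_mpoly_Var eval_mpoly_1 eval_mpoly_0 eval_mpoly_uminus eval_mpoly_diff eval_mpoly_power eval_mpoly_sum

lemma eval_mpoly_in:
  assumes "is_ring_hom c" "x \<in> poly_algebra R n" "subring_set R" "subring_set S" "\<And>a. a \<in> R \<Longrightarrow> c a \<in> S"
    "\<And>i. i < n \<Longrightarrow> T i \<in> S"
  shows "eval_mpoly c T x \<in> S"
  using assms(2,3)
proof (induction rule: poly_algebra_induct)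
  case (single m a)
  then show ?case using assms
    by (auto simp: eval_mpoly_single mon_def intro!: subring_set_mult subring_set_prod subring_set_power)
qed (use assms in \<open>auto simp: eval_mpoly_add intro: subring_set_add\<close>)

lemma eval_mpoly_cong:
  assumes "x \<in> poly_algebra R n" "\<And>i. i < n \<Longrightarrow> T i = T' i"
  shows "eval_mpoly c T x = eval_mpoly c T' x"
  unfolding eval_mpoly_def linear_ext_def
proof (intro sum.cong refl arg_cong2[where f = "(*)"])
  fix m assume "m \<in> ks x"
  then have "ks m \<subseteq> {..<n}" using assms(1) by (auto simp: poly_algebra_iff)
  then show "mon T m = mon T' m" unfolding mon_def using assms(2) by (intro prod.cong) auto
qed

lemma eval_mpoly_comp:
  assumes "is_ring_hom c" "is_ring_hom d" shows "d (eval_mpoly c T x) = eval_mpoly (\<lambda>a. d (c a)) (\<lambda>i. d (T i)) x"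
proof -
  have dc: "is_ring_hom (\<lambda>a. d (c a))" using assms by (simp add: is_ring_hom_def)
  have dsum: "d (u + v) = d u + d v" and dmul: "d (u * v) = d u * d v" and d1: "d 1 = 1" for u v
    using assms(2) by (auto simp: is_ring_hom_def)
  have dpow: "d (u ^ k) = d u ^ k" for u k by (induction k) (auto simp: dmul d1)
  have dprod: "d (prod f I) = (\<Prod>i\<in>I. d (f i))" for f :: "nat \<Rightarrow> _" and I
    by (induction I rule: infinite_finite_induct) (auto simp: dmul d1)
  show ?thesis
  proof (induction x rule: mpoly_induct)
    case (single m a)
    then show ?case using assms dc by (simp add: eval_mpoly_single dmul mon_def dprod dpow)
  qed (simp add: eval_mpoly_add assms dc dsum)
qed

lemma monomial_split:
  assumes "l \<le> lk m i" 
  shows "m = (m - sg i l) + sg i (l::nat)"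
  by (rule poly_mapping_eqI) (use assms in \<open>auto simp: lookup_add lookup_minus lookup_single when_def\<close>)

lemma poly_algebra_Suc:
  assumes "x \<in> poly_algebra R (Suc n)" "subring_set R"
  obtains D f where "\<And>j. f j \<in> poly_algebra R n" "x = (\<Sum>j\<le>D. f j * Var n ^ j)"
proof -
  \<comment> \<open>The vanishing of \<open>f j\<close> beyond \<open>D\<close> is carried along so
    that expansions of different length can be padded and added.\<close>
  have "\<exists>D f. (\<forall>j. f j \<in> poly_algebra R n) \<and> (\<forall>j>D. f j = 0) \<and> x = (\<Sum>j\<le>(D::nat). f j * Var n ^ j)"
    using assms
  proof (induction rule: poly_algebra_induct)
    case (single m a)
    let ?l = "lk m n"
    let ?m = "m - sg n ?l"
    have km: "ks ?m \<subseteq> {..<n}"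
      using single(2) by (auto simp: in_keys_iff lookup_minus lookup_single when_def less_Suc_eq subset_iff split: if_splits)
    let ?f = "\<lambda>j. if j = ?l then sg ?m a else 0"
    have "(\<Sum>j\<le>?l. ?f j * Var n ^ j) = sg ?m a * Var n ^ ?l"
      by (simp add: if_distrib[of "\<lambda>a. a * _"] cong: if_cong)
    also have "\<dots> = sg m a" unfolding Var_power mult_single
      using monomial_split[of ?l m n] by simp
    finally show ?case using km single assms(2)
      by (intro exI[of _ ?l] exI[of _ ?f]) (auto simp: poly_algebra_single subring_set_zero poly_algebra_subring_set)
  next
    case (add x y)
    then obtain D f D' f' where f: "\<forall>j. f j \<in> poly_algebra R n" "\<forall>j>D. f j = 0" "x = (\<Sum>j\<le>(D::nat). f j * Var n ^ j)"
      and f': "\<forall>j. f' j \<in> poly_algebra R n" "\<forall>j>D'. f' j = 0" "y = (\<Sum>j\<le>(D'::nat). f' j * Var n ^ j)"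
      by blast
    have 1: "x = (\<Sum>j\<le>max D D'. f j * Var n ^ j)" unfolding f(3)
      by (rule sum.mono_neutral_left) (use f(2) in auto)
    have 2: "y = (\<Sum>j\<le>max D D'. f' j * Var n ^ j)" unfolding f'(3)
      by (rule sum.mono_neutral_left) (use f'(2) in auto)
    show ?case
      by (rule exI[of _ "max D D'"], rule exI[of _ "\<lambda>j. f j + f' j"])
        (use f f' assms(2) in \<open>auto simp: distrib_right sum.distrib 1[symmetric] 2[symmetric] intro: poly_algebra_add\<close>)
  qed
  then show thesis using that by blast
qed

text \<open>Division by the \<open>l\<close>-th power of variable \<open>i\<close>, dropping the
  monomials that it does not divide. It is linear over polynomials free of that variable
  (\<open>shift_down_mult\<close>) and undoes multiplication by the power
  (\<open>shift_down_Var\<close>); this is how the power is cancelled in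
  \<open>nzd_direct\<close>.\<close>

definition shift_down :: "nat \<Rightarrow> nat \<Rightarrow> 'a::comm_ring_1 mpoly \<Rightarrow> 'a mpoly" where
  "shift_down i l = Poly_Mapping.map_key (\<lambda>m. m + sg i l)"

lemma lookup_shft: "lk (shift_down i l x) m = lk x (m + sg i l)"
  unfolding shift_down_def by (subst map_key.rep_eq) (auto simp: inj_def)

lemma shift_down_add: "shift_down i l (x + y) = shift_down i l x + shift_down i l y"
  by (rule poly_mapping_eqI) (simp add: lookup_shft lookup_add)

lemma shift_down_in: "x \<in> poly_algebra R n \<Longrightarrow> shift_down i l x \<in> poly_algebra R n"
  unfolding poly_algebra_iff
proof
  fix m assume x: "\<forall>m\<in>ks x. lk x m \<in> R \<and> ks m \<subseteq> {..<n}" and "m \<in> ks (shift_down i l x)"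
  then have "m + sg i l \<in> ks x" by (simp add: in_keys_iff lookup_shft)
  then have "lk x (m + sg i l) \<in> R \<and> ks (m + sg i l) \<subseteq> {..<n}" using x by blast
  moreover have "ks m \<subseteq> ks (m + sg i l)" by (auto simp: in_keys_iff lookup_add)
  ultimately show "lk (shift_down i l x) m \<in> R \<and> ks m \<subseteq> {..<n}" by (auto simp: lookup_shft)
qed

lemma shift_down_single:
  "shift_down i l (sg m a) = (if l \<le> lk m i then sg (m - sg i l) a else 0)"
proof (rule poly_mapping_eqI)
  fix k
  have "m = k + sg i l \<longleftrightarrow> l \<le> lk m i \<and> m - sg i l = k"
    using monomial_split[of l m i] by (auto simp: lookup_add)
  then show "lk (shift_down i l (sg m a)) k = lk (if l \<le> lk m i then sg (m - sg i l) a else 0) k"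
    by (auto simp: lookup_shft lookup_single when_def)
qed

lemma shift_down_mult:
  assumes "\<And>m. m \<in> ks x \<Longrightarrow> i \<notin> ks m"
  shows "shift_down i l (x * y) = x * shift_down i l y"
proof -
  have "shift_down i l ((\<Sum>m\<in>S. sg m (lk x m)) * y) = (\<Sum>m\<in>S. sg m (lk x m)) * shift_down i l y"
    if "finite S" "S \<subseteq> ks x" for S
    using that
  proof induction
    case empty
    then show ?case by (auto intro!: poly_mapping_eqI simp: lookup_shft)
  next
    case (insert m S)
    then have m: "lk m i = 0" using assms by (auto simp: in_keys_iff)
    have "shift_down i l (sg m (lk x m) * y) = sg m (lk x m) * shift_down i l y"
    proof (induction y rule: mpoly_induct)
      case (single m' b)
      have "m + m' - sg i l = m + (m' - sg i l)" if "l \<le> lk m' i"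
        using monomial_split[OF that] by (metis add.assoc add_diff_cancel_right')
      then show ?case using m by (simp add: mult_single shift_down_single lookup_add)
    qed (simp add: distrib_left shift_down_add)
    then show ?case using insert by (simp add: distrib_right shift_down_add)
  qed
  from this[of "ks x"] show ?thesis by (simp flip: mpoly_eq_sum)
qed

lemma shift_down_Var: "shift_down i l (Var i ^ l * x) = x"
proof (induction x rule: mpoly_induct)
  case (single m a)
  have "sg i l + m - sg i l = m" by (metis add_diff_cancel_left')
  then show ?case by (simp add: Var_power mult_single shift_down_single lookup_add)
qed (simp add: distrib_left shift_down_add)

section \<open>The lexicographic order of monomials\<close>

lemma monomial_nonneg: "(0 :: nat \<Rightarrow>\<^sub>0 nat) \<le> m"
proof (cases "m = 0")
  case False
  then have "ks m \<noteq> {}" by simp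
  then have ex: "\<exists>k. k \<in> ks m" by blast
  define k where "k = (LEAST k. k \<in> ks m)"
  have "k \<in> ks m" unfolding k_def using ex by (rule LeastI_ex)
  moreover have "\<And>k'. k' < k \<Longrightarrow> k' \<notin> ks m" unfolding k_def by (rule not_less_Least)
  ultimately have "less_fun (lk 0) (lk m)"
    unfolding less_fun_def by (auto simp: in_keys_iff intro!: exI[of _ k])
  then show ?thesis by (simp add: less_eq_poly_mapping.rep_eq)
qed simp

lemma monomial_le:
  assumes "\<And>i. lk m i \<le> lk m' i" shows "m \<le> (m' :: nat \<Rightarrow>\<^sub>0 nat)"
proof -
  have "m' = m + (m' - m)"
    by (rule poly_mapping_eqI) (use assms in \<open>auto simp: lookup_add lookup_minus\<close>)
  then show ?thesis using add_left_mono[OF monomial_nonneg, of m "m' - m"] by simp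
qed

lemma monomial_dickson:
  fixes a :: "nat \<Rightarrow> (nat \<Rightarrow>\<^sub>0 nat)"
  assumes "\<And>k. ks (a k) \<subseteq> {..<n}"
  obtains f :: "nat \<Rightarrow> nat" where "strict_mono f" "\<And>j k i. j \<le> k \<Longrightarrow> lk (a (f j)) i \<le> lk (a (f k)) i"
proof -
  obtain f :: "nat \<Rightarrow> nat" where f: "strict_mono f" "\<forall>i<n. mono (\<lambda>k. lk (a (f k)) i)"
    using dickson[of n "\<lambda>k. lk (a k)"] by blast
  have "lk (a (f j)) i \<le> lk (a (f k)) i" if "j \<le> k" for j k i
  proof (cases "i < n")
    case True
    then show ?thesis using f(2) that by (auto simp: mono_def)
  next
    case False
    then have "lk (a (f j)) i = 0" using assms[of "f j"] by (auto simp: in_keys_iff)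
    then show ?thesis by simp
  qed
  then show thesis using that f(1) by blast
qed

text \<open>In a strictly descending sequence Dickson's lemma would find a later term that is
  coordinatewise above an earlier one, hence above it in the order as well.\<close>

lemma monomial_min:
  fixes A :: "(nat \<Rightarrow>\<^sub>0 nat) set"
  assumes "A \<noteq> {}" "\<And>m. m \<in> A \<Longrightarrow> ks m \<subseteq> {..<n}"
  obtains m where "m \<in> A" "\<And>m'. m' \<in> A \<Longrightarrow> m \<le> m'"
proof (rule ccontr)
  assume c: "\<not> thesis"
  have "\<forall>m\<in>A. \<exists>m'\<in>A. m' < m" using c that by (meson not_le)
  then obtain g where g: "\<And>m. m \<in> A \<Longrightarrow> g m \<in> A \<and> g m < m" by metis
  obtain m0 where m0: "m0 \<in> A" using assms(1) by blast
  define a where "a k = (g ^^ k) m0" for k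
  have aA: "a k \<in> A" for k by (induction k) (auto simp: a_def m0 g)
  have dec: "a (Suc k) < a k" for k using g[OF aA[of k]] by (simp add: a_def)
  have decs: "a (j + Suc k) < a j" for j k
    by (induction k) (use dec in \<open>auto intro: less_trans\<close>)
  have "a (f 1) < a (f 0)" if "strict_mono f" for f :: "nat \<Rightarrow> nat"
  proof -
    have "f 0 < f 1" using that by (simp add: strict_mono_def)
    then obtain k where "f 1 = f 0 + Suc k" using less_imp_Suc_add by auto
    then show ?thesis using decs[of "f 0" k] by (simp only:)
  qed
  moreover obtain f :: "nat \<Rightarrow> nat" where f: "strict_mono f" "\<And>j k i. j \<le> k \<Longrightarrow> lk (a (f j)) i \<le> lk (a (f k)) i"
    using monomial_dickson[of a n] assms(2) aA by blast
  ultimately show False using monomial_le[of "a (f 0)" "a (f 1)"] by (meson not_le zero_le)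
qed

section \<open>Hilbert's basis theorem and a local criterion for flatness\<close>

lemma gen_imageE:
  assumes "x \<in> gen R (f ` A)" "finite A" "subring_set R"
  obtains r where "\<And>i. i \<in> A \<Longrightarrow> r i \<in> R" "x = (\<Sum>i\<in>A. r i * f i)"
proof -
  have "\<exists>r. (\<forall>i\<in>A. r i \<in> R) \<and> x = (\<Sum>i\<in>A. r i * f i)"
    using assms(1)
  proof induction
    case gen_zero
    then show ?case using assms(3) by (intro exI[of _ "\<lambda>_. 0"]) (auto intro: subring_set_zero)
  next
    case (gen_step y q x)
    then obtain r j where r: "\<forall>i\<in>A. r i \<in> R" "y = (\<Sum>i\<in>A. r i * f i)" and j: "j \<in> A" "x = f j" by blast
    have "q * x + y = (\<Sum>i\<in>A. ((if i = j then q else 0) + r i) * f i)"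
      using j assms(2) by (simp add: r(2) distrib_right sum.distrib if_distrib[of "\<lambda>a. a * _"] cong: if_cong)
    then show ?case using r gen_step assms(3)
      by (intro exI[of _ "\<lambda>i. (if i = j then q else 0) + r i"]) (auto intro: subring_set_intros)
  qed
  then show thesis using that by blast
qed

lemma lookup_single_mult: "lk (sg \<gamma> r * (x :: 'a::comm_ring_1 mpoly)) (\<gamma> + \<beta>) = r * lk x \<beta>"
  by (induction x rule: mpoly_induct)
    (auto simp: mult_single lookup_single when_def distrib_left lookup_add)

lemma keys_single_mult: "ks (sg \<gamma> r * (x :: 'a::comm_ring_1 mpoly)) \<subseteq> (+) \<gamma> ` ks x"
  using keys_mult[of "sg \<gamma> r" x] by (auto split: if_splits)

text \<open>Hilbert's theorem for all variables at once. In an ideal without finite basis one keeps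
  choosing an element of least leading monomial outside the ideal generated so far. Along a
  subsequence the leading monomials divide each other, and a dependence among the leading
  coefficients lowers a leading monomial that was least.\<close>

lemma noetherian_poly_algebra:
  fixes R :: "'a::field set"
  assumes R: "noetherian R"
  shows "noetherian (poly_algebra R n)"
proof (rule ccontr)
  assume nn: "\<not> ?thesis"
  define P where "P = poly_algebra R n"
  have sR: "subring_set R" using R by (rule noetherian_sring)
  have sP: "subring_set P" unfolding P_def using sR by (rule poly_algebra_subring_set)
  obtain I where I: "is_ideal P I" and nfg: "\<And>S. S \<subseteq> I \<Longrightarrow> finite S \<Longrightarrow> \<not> I \<subseteq> gen P S"
    using nn sP unfolding noetherian_def P_def by blast
  have IP: "I \<subseteq> P" using is_idealD(2)[OF I] .
  \<comment> \<open>At 0 this is a default value; it is applied only to elements outside a generated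
    ideal, which are nonzero.\<close>
  define lm where "lm x = Max (ks x)" for x :: "'a mpoly"
  have lmk: "lm x \<in> ks x" if "x \<noteq> 0" for x using that unfolding lm_def by (intro Max_in) auto
  have "\<exists>f. f \<in> I \<and> f \<notin> gen P S \<and> (\<forall>f'\<in>I - gen P S. lm f \<le> lm f')"
    if S: "S \<subseteq> I" "finite S" for S
  proof -
    have ne: "lm ` (I - gen P S) \<noteq> {}" using nfg[OF S] by blast
    have "ks m \<subseteq> {..<n}" if "m \<in> lm ` (I - gen P S)" for m
    proof -
      obtain f where f: "f \<in> I" "f \<notin> gen P S" "m = lm f" using \<open>m \<in> _\<close> by blast
      then have "f \<noteq> 0" using gen_zero by metis
      moreover have "f \<in> poly_algebra R n" using f IP unfolding P_def by blast
      ultimately show ?thesis using lmk[of f] f unfolding poly_algebra_iff by blast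
    qed
    from monomial_min[OF ne this] obtain m
      where m: "m \<in> lm ` (I - gen P S)" "\<And>m'. m' \<in> lm ` (I - gen P S) \<Longrightarrow> m \<le> m'" by blast
    from m(1) obtain f where f: "f \<in> I" "f \<notin> gen P S" "m = lm f" by blast
    show ?thesis
    proof (intro exI[of _ f] conjI ballI)
      fix f' assume "f' \<in> I - gen P S"
      then show "lm f \<le> lm f'" using m(2)[of "lm f'"] f(3) by blast
    qed (use f in auto)
  qed
  then obtain g where g: "\<And>S. S \<subseteq> I \<Longrightarrow> finite S \<Longrightarrow>
      g S \<in> I \<and> g S \<notin> gen P S \<and> (\<forall>f'\<in>I - gen P S. lm (g S) \<le> lm f')" by metis
  define S where "S k = rec_nat {} (\<lambda>_ S. insert (g S) S) k" for k :: nat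
  have S0: "S 0 = {}" and SS: "S (Suc k) = insert (g (S k)) (S k)" for k by (simp_all add: S_def)
  have SI: "S k \<subseteq> I \<and> finite (S k)" for k by (induction k) (use g in \<open>auto simp: S0 SS\<close>)
  define f where "f k = g (S k)" for k
  have f: "f k \<in> I" "f k \<notin> gen P (S k)" "\<And>f'. f' \<in> I \<Longrightarrow> f' \<notin> gen P (S k) \<Longrightarrow> lm (f k) \<le> lm f'" for k
    using g SI[of k] unfolding f_def by auto
  have fS: "f j \<in> S k" if "j < k" for j k
    using that by (induction k) (auto simp: SS f_def less_Suc_eq)
  have f0: "f k \<noteq> 0" for k using f(2)[of k] gen_zero[of P "S k"] by auto
  have lmn: "ks (lm (f k)) \<subseteq> {..<n}" for k
  proof -
    have "f k \<in> poly_algebra R n" using f(1)[of k] IP unfolding P_def by auto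
    then show ?thesis using lmk[OF f0[of k]] by (simp add: poly_algebra_iff)
  qed
  obtain \<phi> :: "nat \<Rightarrow> nat" where \<phi>: "strict_mono \<phi>"
    "\<And>j k i. j \<le> k \<Longrightarrow> lk (lm (f (\<phi> j))) i \<le> lk (lm (f (\<phi> k))) i"
    by (rule monomial_dickson[of "\<lambda>k. lm (f k)" n]) (use lmn in auto)
  define \<alpha> where "\<alpha> k = lm (f (\<phi> k))" for k
  define c where "c k = lk (f (\<phi> k)) (\<alpha> k)" for k
  have "c k \<in> R" for k unfolding c_def
    using f(1)[of "\<phi> k"] IP unfolding P_def by (auto intro: poly_algebra_lookup subring_set_zero[OF sR])
  then obtain k where k: "c k \<in> gen R (c ` {..<k})" using noetherian_seq[OF R] by blast
  obtain r where r: "\<And>i. i \<in> {..<k} \<Longrightarrow> r i \<in> R" "c k = (\<Sum>i<k. r i * c i)"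
    using gen_imageE[OF k _ sR] by auto
  have \<alpha>: "\<alpha> k = (\<alpha> k - \<alpha> j) + \<alpha> j" if "j < k" for j
    by (rule poly_mapping_eqI) (use \<phi>(2)[of j k] that in \<open>auto simp: \<alpha>_def lookup_add lookup_minus\<close>)
  \<comment> \<open>The coefficients at \<open>\<alpha> k\<close> cancel, while \<open>h\<close>
    stays outside the ideal generated by the elements chosen before
    \<open>f (\<phi> k)\<close>.\<close>
  define h where "h = f (\<phi> k) - (\<Sum>j<k. sg (\<alpha> k - \<alpha> j) (r j) * f (\<phi> j))"
  have sgP: "sg (\<alpha> k - \<alpha> j) (r j) \<in> P" if "j < k" for j
    unfolding P_def
  proof (rule poly_algebra_single)
    show "r j \<in> R" using r(1) that by simp
    show "ks (\<alpha> k - \<alpha> j) \<subseteq> {..<n}" 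
    proof -
      have "ks (\<alpha> k - \<alpha> j) \<subseteq> ks (lm (f (\<phi> k)))" by (auto simp: \<alpha>_def in_keys_iff lookup_minus)
      then show ?thesis using lmn[of "\<phi> k"] by auto
    qed
  qed
  have "h \<in> I" unfolding h_def
  proof (rule is_ideal_diff[OF sP I f(1) is_ideal_sum[OF I]])
    fix j assume "j \<in> {..<k}"
    then show "sg (\<alpha> k - \<alpha> j) (r j) * f (\<phi> j) \<in> I" using is_idealD(4)[OF I sgP f(1)] by simp
  qed
  have "(\<Sum>j<k. sg (\<alpha> k - \<alpha> j) (r j) * f (\<phi> j)) \<in> gen P (S (\<phi> k))"
    by (rule gen_sum, rule gen_base_mult) (use sgP fS \<phi>(1) in \<open>auto simp: strict_mono_def\<close>)
  then have unit_multiple_at: "h \<notin> gen P (S (\<phi> k))"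
    using f(2)[of "\<phi> k"] gen_add[of h P "S (\<phi> k)"] unfolding h_def by force
  then have h0: "h \<noteq> 0" using gen_zero[of P "S (\<phi> k)"] by auto
  have "lk h (\<alpha> k) = c k - (\<Sum>j<k. r j * c j)"
  proof -
    have "lk (sg (\<alpha> k - \<alpha> j) (r j) * f (\<phi> j)) (\<alpha> k) = r j * c j" if "j < k" for j
      using lookup_single_mult[of "\<alpha> k - \<alpha> j" "r j" "f (\<phi> j)" "\<alpha> j"] \<alpha>[OF that] by (simp add: c_def)
    then show ?thesis unfolding h_def by (simp add: lookup_minus lookup_sum c_def)
  qed
  then have lk0: "lk h (\<alpha> k) = 0" using r(2) by simp
  have le: "\<beta> \<le> \<alpha> k" if "\<beta> \<in> ks h" for \<beta>
  proof -
    have "lk (f (\<phi> k)) \<beta> \<noteq> 0 \<or> (\<exists>j<k. lk (sg (\<alpha> k - \<alpha> j) (r j) * f (\<phi> j)) \<beta> \<noteq> 0)"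
    proof (rule ccontr)
      assume "\<not> ?thesis"
      then have "lk h \<beta> = 0" unfolding h_def lookup_minus lookup_sum by simp
      then show False using that by (simp add: in_keys_iff)
    qed
    then show ?thesis
    proof (elim disjE exE conjE)
      assume "lk (f (\<phi> k)) \<beta> \<noteq> 0"
      then show ?thesis unfolding \<alpha>_def lm_def by (intro Max_ge) (auto simp: in_keys_iff)
    next
      fix j assume j: "j < k" "lk (sg (\<alpha> k - \<alpha> j) (r j) * f (\<phi> j)) \<beta> \<noteq> 0"
      then have "\<beta> \<in> (+) (\<alpha> k - \<alpha> j) ` ks (f (\<phi> j))" 
        using subsetD[OF keys_single_mult[of "\<alpha> k - \<alpha> j" "r j" "f (\<phi> j)"]] by (simp add: in_keys_iff)
      then obtain \<delta> where \<delta>: "\<delta> \<in> ks (f (\<phi> j))" "\<beta> = (\<alpha> k - \<alpha> j) + \<delta>" by blast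
      then have "\<delta> \<le> \<alpha> j" unfolding \<alpha>_def lm_def by (intro Max_ge) auto
      then show ?thesis using \<alpha>[OF j(1)] \<delta>(2) add_left_mono[of \<delta> "\<alpha> j" "\<alpha> k - \<alpha> j"] by simp
    qed
  qed
  have "lm h \<le> \<alpha> k" using le lmk[OF h0] by blast
  moreover have "lm h \<noteq> \<alpha> k" using lk0 lmk[OF h0] by (auto simp: in_keys_iff)
  ultimately show False using f(3)[OF \<open>h \<in> I\<close> unit_multiple_at] unfolding \<alpha>_def by simp
qed

text \<open>Congruent generators give the same ideal modulo \<open>A\<close>; this exchanges each
  relation with its leading term.\<close>

lemma gen_perturb:
  assumes "subring_set P" "is_ideal P A" "\<And>j. j \<in> B \<Longrightarrow> f j - g j \<in> A" "w \<in> gen P (f ` B)"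
  shows "\<exists>w'\<in>gen P (g ` B). w - w' \<in> A"
  using assms(4)
proof induction
  case gen_zero
  then show ?case using assms(2) by (intro bexI[of _ 0]) (auto intro: gen.gen_zero dest: is_idealD)
next
  case (gen_step y r x)
  then obtain w' j where w': "w' \<in> gen P (g ` B)" "y - w' \<in> A" and j: "j \<in> B" "x = f j" by blast
  have "r * (f j - g j) + (y - w') \<in> A"
    using gen_step(2) w'(2) assms(2,3) j(1) by (intro is_idealD(3) is_idealD(4)) auto
  moreover have "r * (f j - g j) + (y - w') = (r * x + y) - (r * g j + w')"
    by (simp add: j algebra_simps)
  ultimately have "(r * x + y) - (r * g j + w') \<in> A" by (simp only:)
  then show ?case using gen.gen_step[OF w'(1) gen_step(2), of "g j"] j(1) by blast
qed

lemma poly_algebra_ideal: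
  assumes "subring_set R" "is_ideal R A"
  shows "is_ideal (poly_algebra R n) (poly_algebra A n)"
  unfolding is_ideal_def
proof (intro conjI ballI)
  show "0 \<in> poly_algebra A n" by (simp add: poly_algebra_iff)
  show "poly_algebra A n \<subseteq> poly_algebra R n" using is_idealD(2)[OF assms(2)] poly_algebra_mono by blast
  show add: "x + y \<in> poly_algebra A n" if "x \<in> poly_algebra A n" "y \<in> poly_algebra A n" for x y
    using that keys_add[of x y] poly_algebra_lookup[of x A n] poly_algebra_lookup[of y A n] is_idealD[OF assms(2)]
    by (fastforce simp: poly_algebra_iff lookup_add)
  fix r x assume r: "r \<in> poly_algebra R n" and x: "x \<in> poly_algebra A n"
  show "r * x \<in> poly_algebra A n"
    using r assms(1)
  proof (induction rule: poly_algebra_induct)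
    case (single m a)
    show ?case unfolding poly_algebra_iff
    proof
      fix m' assume m': "m' \<in> ks (sg m a * x)"
      then obtain k where k: "k \<in> ks x" "m' = m + k" using keys_single_mult[of m a x] by blast
      have "lk (sg m a * x) m' = a * lk x k" unfolding k(2) by (rule lookup_single_mult)
      moreover have "lk x k \<in> A" "ks k \<subseteq> {..<n}" using x k by (auto simp: poly_algebra_iff)
      ultimately show "lk (sg m a * x) m' \<in> A \<and> ks m' \<subseteq> {..<n}"
        using single is_idealD(4)[OF assms(2)] keys_add[of m k] unfolding k(2) by auto
    qed
  qed (simp add: distrib_right add)
qed

text \<open>The localization at a point is represented by its multiplicative set
  \<open>good\<close>. By \<open>good_diff\<close> the elements of \<open>n0\<close> lie in the
  Jacobson radical of that localization, which is what a Nakayama argument needs. Modulo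
  \<open>n0\<close> the relations are triangular, since \<open>c i\<close> involves only the
  variables before \<open>i\<close>.\<close>

locale local_criterion =
  fixes R n0 :: "'a::field set" and N N' :: nat and good :: "'a mpoly \<Rightarrow> bool"
    and \<rho> c :: "nat \<Rightarrow> 'a mpoly" and l :: "nat \<Rightarrow> nat"
  assumes R: "noetherian R" and n0: "is_ideal R n0" and N': "N' \<le> N"
    and good_1: "good 1"
    and good_mult: "\<And>s t. s \<in> poly_algebra R N \<Longrightarrow> t \<in> poly_algebra R N \<Longrightarrow> good s \<Longrightarrow> good t \<Longrightarrow> good (s * t)"
    and good_diff: "\<And>s r a. s \<in> poly_algebra R N \<Longrightarrow> r \<in> poly_algebra R N \<Longrightarrow> good s \<Longrightarrow> a \<in> n0 \<Longrightarrow>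
        good (s - Const a * r)"
    and \<rho>_in: "\<And>i. i < N' \<Longrightarrow> \<rho> i \<in> poly_algebra R N"
    and c_in: "\<And>i. i < N' \<Longrightarrow> c i \<in> poly_algebra R i"
    and c_good: "\<And>i. i < N' \<Longrightarrow> good (c i)"
    and \<rho>_c: "\<And>i. i < N' \<Longrightarrow> \<rho> i - c i * Var i ^ l i \<in> poly_algebra n0 N"
begin

abbreviation "P \<equiv> poly_algebra R N"

lemma sR: "subring_set R" using R by (rule noetherian_sring)
lemma sP: "subring_set P" using sR by (rule poly_algebra_subring_set)

text \<open>The contraction to \<open>P\<close> of the ideal generated by \<open>A\<close> and the
  first \<open>i\<close> relations in the localization at \<open>good\<close>.\<close>

definition J :: "nat \<Rightarrow> 'a set \<Rightarrow> 'a mpoly set" where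
  "J i A = {x \<in> P. \<exists>s\<in>P. good s \<and> (\<exists>w\<in>gen P (\<rho> ` {..<i}). s * x - w \<in> poly_algebra A N)}"

lemma J_I: "x \<in> P \<Longrightarrow> s \<in> P \<Longrightarrow> good s \<Longrightarrow> w \<in> gen P (\<rho> ` {..<i}) \<Longrightarrow> s * x - w \<in> poly_algebra A N \<Longrightarrow> x \<in> J i A"
  unfolding J_def by blast

lemma rho_subset: "i \<le> N' \<Longrightarrow> \<rho> ` {..<i} \<subseteq> P"
  using \<rho>_in by auto

lemma J_ideal:
  assumes i: "i \<le> N'" and A: "is_ideal R A"
  shows "is_ideal P (J i A)"
  unfolding is_ideal_def
proof (intro conjI ballI)
  note PA = poly_algebra_ideal[OF sR A, of N]
  note PAD = is_idealD[OF PA]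
  show "0 \<in> J i A" using J_I[of 0 1 0 i A] sP good_1 PAD(1) by (simp add: gen_zero subring_set_zero subring_set_one)
  show "J i A \<subseteq> P" by (auto simp: J_def)
  note gm = gen_mult[OF sP]
  fix x y assume x: "x \<in> J i A"
  then obtain s w where s: "x \<in> P" "s \<in> P" "good s" "w \<in> gen P (\<rho> ` {..<i})" "s * x - w \<in> poly_algebra A N"
    unfolding J_def by blast
  show "x + y \<in> J i A" if yy: "y \<in> J i A"
  proof -
    obtain t v where t: "y \<in> P" "t \<in> P" "good t" "v \<in> gen P (\<rho> ` {..<i})" "t * y - v \<in> poly_algebra A N"
      using yy unfolding J_def by blast
    have "t * (s * x - w) + s * (t * y - v) \<in> poly_algebra A N"
      using PAD(3,4) s t by blast
    moreover have "t * (s * x - w) + s * (t * y - v) = (s * t) * (x + y) - (t * w + s * v)"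
      by (simp add: algebra_simps)
    ultimately have "(s * t) * (x + y) - (t * w + s * v) \<in> poly_algebra A N" by (simp only:)
    moreover have "t * w + s * v \<in> gen P (\<rho> ` {..<i})" using gm s t by (intro gen_add) auto
    ultimately show ?thesis using s t good_mult sP J_I[of "x + y" "s * t" "t * w + s * v" i A]
      by (simp add: subring_set_add subring_set_mult)
  qed
next
  note PA = poly_algebra_ideal[OF sR A, of N]
  fix r x assume r: "r \<in> P" and x: "x \<in> J i A"
  then obtain s w where s: "x \<in> P" "s \<in> P" "good s" "w \<in> gen P (\<rho> ` {..<i})" "s * x - w \<in> poly_algebra A N"
    unfolding J_def by blast
  have "r * (s * x - w) \<in> poly_algebra A N" using is_idealD(4)[OF PA] r s by blast
  then have "s * (r * x) - r * w \<in> poly_algebra A N" by (simp add: algebra_simps)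
  then show "r * x \<in> J i A" using s r sP gen_mult[OF sP r s(4)] J_I[of "r * x" s "r * w" i A]
    by (simp add: subring_set_mult)
qed

lemma J_saturated: "x \<in> P \<Longrightarrow> s \<in> P \<Longrightarrow> good s \<Longrightarrow> s * x \<in> J i A \<Longrightarrow> x \<in> J i A"
proof -
  assume x: "x \<in> P" "s \<in> P" "good s" "s * x \<in> J i A"
  then obtain t w where t: "t \<in> P" "good t" "w \<in> gen P (\<rho> ` {..<i})" "t * (s * x) - w \<in> poly_algebra A N"
    unfolding J_def by blast
  then show "x \<in> J i A" using x sP good_mult[of t s] J_I[of x "t * s" w i A]
    by (simp add: subring_set_mult mult.assoc)
qed

lemma J_mono: "A \<subseteq> B \<Longrightarrow> J i A \<subseteq> J i B"
  unfolding J_def using poly_algebra_mono[of A B N N] by blast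

lemma J_gen: "i \<le> N' \<Longrightarrow> is_ideal R A \<Longrightarrow> w \<in> gen P (\<rho> ` {..<i}) \<Longrightarrow> w \<in> J i A"
  using J_I[of w 1 w i A] sP good_1 gen_subset[OF sP rho_subset[of i]] is_idealD(1)[OF poly_algebra_ideal[OF sR]]
  by (auto simp: subring_set_one)

lemma J_coeff: "is_ideal R A \<Longrightarrow> x \<in> poly_algebra A N \<Longrightarrow> x \<in> J i A"
  using J_I[of x 1 0 i A] sP good_1 is_idealD(2)[OF poly_algebra_ideal[OF sR]]
  by (auto simp: subring_set_one gen_zero)

definition colon :: "'a set \<Rightarrow> 'a \<Rightarrow> 'a set" where
  "colon A a = {r \<in> R. a * r \<in> A}"

lemma colon_ideal: "is_ideal R A \<Longrightarrow> a \<in> R \<Longrightarrow> is_ideal R (colon A a)"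
  unfolding colon_def is_ideal_def
  using sR by (auto simp: subring_set_intros distrib_left mult.left_commute)

lemma colon_superset: "is_ideal R A \<Longrightarrow> a \<in> R \<Longrightarrow> A \<subseteq> colon A a"
  unfolding colon_def is_ideal_def by blast

lemma poly_algebra_colon:
  assumes "is_ideal R A" "x \<in> P"
  shows "Const a * x \<in> poly_algebra A N \<longleftrightarrow> x \<in> poly_algebra (colon A a) N"
proof -
  have 0: "0 \<in> A" using is_idealD(1)[OF assms(1)] .
  have x: "\<And>m. m \<in> ks x \<Longrightarrow> lk x m \<in> R \<and> ks m \<subseteq> {..<N}" using assms(2) by (auto simp: poly_algebra_iff)
  have k: "ks (Const a * x) \<subseteq> ks x" by (auto simp: in_keys_iff lookup_Const_mult)
  show ?thesis
  proof
    assume L: "Const a * x \<in> poly_algebra A N"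
    have "a * lk x m \<in> A" for m using poly_algebra_lookup[OF L 0, of m] by (simp add: lookup_Const_mult)
    then show "x \<in> poly_algebra (colon A a) N" using x by (auto simp: poly_algebra_iff colon_def)
  next
    assume "x \<in> poly_algebra (colon A a) N"
    then show "Const a * x \<in> poly_algebra A N"
      using k x by (auto simp: poly_algebra_iff colon_def lookup_Const_mult)
  qed
qed

text \<open>Flatness over \<open>R\<close> of the localized quotient \<open>M\<close> by the first
  \<open>i\<close> relations, in the form \<open>(A M : a) = (A : a) M\<close> for ideals
  \<open>A\<close>; stated is the nontrivial inclusion.\<close>

definition flat :: "nat \<Rightarrow> bool" where
  "flat i \<longleftrightarrow> (\<forall>A a x. is_ideal R A \<longrightarrow> a \<in> R \<longrightarrow> x \<in> P \<longrightarrow> Const a * x \<in> J i A \<longrightarrow> x \<in> J i (colon A a))"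

definition nzd :: "nat \<Rightarrow> 'a set \<Rightarrow> bool" where
  "nzd i A \<longleftrightarrow> (\<forall>x\<in>P. \<rho> i * x \<in> J i A \<longrightarrow> x \<in> J i A)"

lemma flat_0: "flat 0"
  unfolding flat_def
proof (intro allI impI)
  fix A a x assume A: "is_ideal R A" "a \<in> R" "x \<in> P" "Const a * x \<in> J 0 A"
  then obtain s w where s: "s \<in> P" "good s" "w \<in> gen P {}" "s * (Const a * x) - w \<in> poly_algebra A N"
    unfolding J_def by auto
  have "w = 0" using s(3) by (cases rule: gen.cases) auto
  then have "Const a * (s * x) \<in> poly_algebra A N" using s by (simp add: mult.left_commute)
  then have "s * x \<in> poly_algebra (colon A a) N" using poly_algebra_colon A s(1) sP subring_set_mult by blast
  then show "x \<in> J 0 (colon A a)" using s A J_I[of x s 0 0 "colon A a"]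
    by (simp add: gen_zero)
qed

lemma gen_Suc:
  assumes "w \<in> gen P (\<rho> ` {..<Suc i})"
  shows "\<exists>u\<in>P. \<exists>w'\<in>gen P (\<rho> ` {..<i}). w = \<rho> i * u + w'"
  using assms
proof induction
  case gen_zero
  then show ?case using sP by (auto intro!: bexI[of _ 0] gen.gen_zero subring_set_zero)
next
  case (gen_step y r x)
  then obtain u w' j where u: "u \<in> P" "w' \<in> gen P (\<rho> ` {..<i})" "y = \<rho> i * u + w'" and j: "j < Suc i" "x = \<rho> j"
    by blast
  show ?case
  proof (cases "j = i")
    case True
    then have "r * x + y = \<rho> i * (r + u) + w'" by (simp add: j u algebra_simps)
    then show ?thesis using u gen_step(2) sP subring_set_add by blast
  next
    case False
    then have "r * x + w' \<in> gen P (\<rho> ` {..<i})" using j gen_step(2) u by (intro gen.gen_step) auto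
    moreover have "r * x + y = \<rho> i * u + (r * x + w')" by (simp add: u algebra_simps)
    ultimately show ?thesis using u(1) by blast
  qed
qed

lemma J_Suc:
  assumes i: "i < N'" and A: "is_ideal R A"
  shows "x \<in> J (Suc i) A \<longleftrightarrow> x \<in> P \<and> (\<exists>s\<in>P. good s \<and> (\<exists>u\<in>P. s * x - \<rho> i * u \<in> J i A))"
proof
  assume "x \<in> J (Suc i) A"
  then obtain s w where s: "x \<in> P" "s \<in> P" "good s" "w \<in> gen P (\<rho> ` {..<Suc i})" "s * x - w \<in> poly_algebra A N"
    unfolding J_def by blast
  obtain u w' where u: "u \<in> P" "w' \<in> gen P (\<rho> ` {..<i})" "w = \<rho> i * u + w'" using gen_Suc[OF s(4)] by blast
  have "(s * x - w) + w' \<in> J i A"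
    using J_coeff[OF A s(5), of i] J_gen[of i, OF _ A u(2)] is_idealD(3)[OF J_ideal[OF _ A, of i]] i by simp
  then have "s * x - \<rho> i * u \<in> J i A" by (simp add: u(3) algebra_simps)
  then show "x \<in> P \<and> (\<exists>s\<in>P. good s \<and> (\<exists>u\<in>P. s * x - \<rho> i * u \<in> J i A))" using s u by blast
next
  assume "x \<in> P \<and> (\<exists>s\<in>P. good s \<and> (\<exists>u\<in>P. s * x - \<rho> i * u \<in> J i A))"
  then obtain s u where s: "x \<in> P" "s \<in> P" "good s" "u \<in> P" "s * x - \<rho> i * u \<in> J i A" by blast
  have "s * x - \<rho> i * u \<in> J (Suc i) A"
    using s(5) gen_mono[of "\<rho> ` {..<i}" "\<rho> ` {..<Suc i}" P] unfolding J_def by fastforce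
  moreover have "\<rho> i * u \<in> J (Suc i) A"
    using J_gen[of "Suc i" A "u * \<rho> i"] i A s(4) gen_base_mult[of u P "\<rho> i" "\<rho> ` {..<Suc i}"]
    by (simp add: mult.commute)
  ultimately have "s * x - \<rho> i * u + \<rho> i * u \<in> J (Suc i) A"
    using is_idealD(3)[OF J_ideal[OF _ A, of "Suc i"]] i by (simp only: Suc_leI)
  then show "x \<in> J (Suc i) A" using J_saturated[of x s "Suc i" A] s by simp
qed

definition sum_ideal :: "'a set \<Rightarrow> 'a \<Rightarrow> 'a set" where
  "sum_ideal A a = {\<alpha> + a * r | \<alpha> r. \<alpha> \<in> A \<and> r \<in> R}"

lemma sum_ideal_ideal: 
  assumes A: "is_ideal R A" and a: "a \<in> R" shows "is_ideal R (sum_ideal A a)"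
  unfolding is_ideal_def
proof (intro conjI ballI)
  note AD = is_idealD[OF A]
  show "0 \<in> sum_ideal A a" unfolding sum_ideal_def using AD(1) subring_set_zero[OF sR] by force
  show "sum_ideal A a \<subseteq> R" unfolding sum_ideal_def using AD(2) a sR by (auto intro!: subring_set_intros)
  fix x assume "x \<in> sum_ideal A a"
  then obtain \<alpha> r where x: "\<alpha> \<in> A" "r \<in> R" "x = \<alpha> + a * r" unfolding sum_ideal_def by blast
  show "x + y \<in> sum_ideal A a" if yy: "y \<in> sum_ideal A a" for y
  proof -
    obtain \<beta> q where y: "\<beta> \<in> A" "q \<in> R" "y = \<beta> + a * q" using yy unfolding sum_ideal_def by blast
    have "x + y = (\<alpha> + \<beta>) + a * (r + q)" by (simp add: x y algebra_simps)
    then show ?thesis unfolding sum_ideal_def using x y AD(3) subring_set_add[OF sR] by blast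
  qed
  show "q * x \<in> sum_ideal A a" if "q \<in> R" for q
  proof -
    have "q * x = q * \<alpha> + a * (q * r)" by (simp add: x algebra_simps)
    then show ?thesis unfolding sum_ideal_def using x that AD(4) subring_set_mult[OF sR] by blast
  qed
qed

lemma sum_ideal_superset: "is_ideal R A \<Longrightarrow> A \<subseteq> sum_ideal A a"
  unfolding sum_ideal_def using subring_set_zero[OF sR] by force

lemma sum_ideal_elem: "is_ideal R A \<Longrightarrow> a \<in> sum_ideal A a"
  unfolding sum_ideal_def using subring_set_one[OF sR] is_idealD(1)[of R A] by force

lemma poly_sum_ideal:
  assumes A: "is_ideal R A" and "a \<in> R" "x \<in> poly_algebra (sum_ideal A a) N"
  shows "\<exists>y\<in>P. x - Const a * y \<in> poly_algebra A N"
proof -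
  have "\<forall>m\<in>ks x. \<exists>r. r \<in> R \<and> lk x m - a * r \<in> A"
    using assms(3) by (fastforce simp: poly_algebra_iff sum_ideal_def)
  then obtain r where r: "\<And>m. m \<in> ks x \<Longrightarrow> r m \<in> R \<and> lk x m - a * r m \<in> A" by metis
  have km: "ks m \<subseteq> {..<N}" if "m \<in> ks x" for m using assms(3) that by (auto simp: poly_algebra_iff)
  define y where "y = (\<Sum>m\<in>ks x. sg m (r m))"
  have "y \<in> P" unfolding y_def using r km by (intro subring_set_sum[OF sP] poly_algebra_single) auto
  moreover have "x - Const a * y = (\<Sum>m\<in>ks x. sg m (lk x m - a * r m))"
    by (subst mpoly_eq_sum[of x])
      (simp add: y_def sum_distrib_left sum_subtractf single_diff Const_def mult_single)
  moreover have "\<dots> \<in> poly_algebra A N"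
    using r km by (intro is_ideal_sum[OF poly_algebra_ideal[OF sR A]] poly_algebra_single) auto
  ultimately show ?thesis by (intro bexI[of _ y]) simp_all
qed

text \<open>If \<open>a x\<close> equals \<open>\<rho> i * u\<close> modulo \<open>J i A\<close>,
  then regularity over \<open>A + a R\<close> puts \<open>u\<close> in \<open>J i (A + a R)\<close>,
  so \<open>u\<close> equals some \<open>a y\<close> modulo \<open>J i A\<close>. Hence
  \<open>a (x - \<rho> i * y)\<close> is in \<open>J i A\<close>, and flatness at stage
  \<open>i\<close> applies. All this is up to good factors.\<close>

lemma flat_Suc:
  assumes i: "i < N'" and F: "flat i" and Z: "\<And>A. is_ideal R A \<Longrightarrow> nzd i A"
  shows "flat (Suc i)"
  unfolding flat_def
proof (intro allI impI)
  fix A a x assume A: "is_ideal R A" and a: "a \<in> R" and x: "x \<in> P" and "Const a * x \<in> J (Suc i) A"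
  then obtain s u where s: "s \<in> P" "good s" "u \<in> P" "s * (Const a * x) - \<rho> i * u \<in> J i A"
    unfolding J_Suc[OF i A] by blast
  let ?B = "sum_ideal A a"
  have B: "is_ideal R ?B" using sum_ideal_ideal[OF A a] .
  have ca: "Const a \<in> P" using Const_in a by blast
  have i': "i \<le> N'" using i by simp
  note JA = J_ideal[OF i' A] and JB = J_ideal[OF i' B]
  have "Const a \<in> J i ?B" by (rule J_coeff[OF B]) (use Const_in sum_ideal_elem[OF A] in blast)
  then have "(s * x) * Const a \<in> J i ?B" using is_idealD(4)[OF JB] s x sP subring_set_mult by blast
  moreover have "s * (Const a * x) - \<rho> i * u \<in> J i ?B" using s(4) J_mono sum_ideal_superset[OF A] by blast
  ultimately have "(s * x) * Const a - (s * (Const a * x) - \<rho> i * u) \<in> J i ?B"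
    by (rule is_ideal_diff[OF sP JB])
  then have "\<rho> i * u \<in> J i ?B" by (simp add: algebra_simps)
  then have "u \<in> J i ?B" using Z[OF B] s(3) unfolding nzd_def by blast
  then obtain t w where t: "t \<in> P" "good t" "w \<in> gen P (\<rho> ` {..<i})" "t * u - w \<in> poly_algebra ?B N"
    unfolding J_def by blast
  obtain y where y: "y \<in> P" "t * u - w - Const a * y \<in> poly_algebra A N"
    using poly_sum_ideal[OF A a t(4)] by blast
  have "(t * u - w - Const a * y) + w \<in> J i A"
    using is_idealD(3)[OF JA J_coeff[OF A y(2)] J_gen[OF i' A t(3)]] .
  then have "t * u - Const a * y \<in> J i A" by (simp add: algebra_simps)
  then have "\<rho> i * (t * u - Const a * y) \<in> J i A" using is_idealD(4)[OF JA] \<rho>_in[OF i] by blast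
  moreover have "t * (s * (Const a * x) - \<rho> i * u) \<in> J i A" using is_idealD(4)[OF JA] t s by blast
  ultimately have "\<rho> i * (t * u - Const a * y) + t * (s * (Const a * x) - \<rho> i * u) \<in> J i A"
    using is_idealD(3)[OF JA] by blast
  moreover have "\<rho> i * (t * u - Const a * y) + t * (s * (Const a * x) - \<rho> i * u) = Const a * (t * s * x - \<rho> i * y)"
    by (simp add: algebra_simps)
  ultimately have "Const a * (t * s * x - \<rho> i * y) \<in> J i A" by (simp only:)
  moreover have "t * s * x - \<rho> i * y \<in> P" using t s x y \<rho>_in[OF i] sP by (intro subring_set_diff subring_set_mult)
  ultimately have "t * s * x - \<rho> i * y \<in> J i (colon A a)" using F A a unfolding flat_def by blast
  then show "x \<in> J (Suc i) (colon A a)" unfolding J_Suc[OF i colon_ideal[OF A a]]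
    using x y t s sP good_mult subring_set_mult by blast
qed

text \<open>Over such an \<open>A\<close> every relation may be replaced by its leading term. The
  leading terms before \<open>i\<close> do not involve variable \<open>i\<close>, so its power can
  be divided out by \<open>shift_down\<close>; the remaining factor \<open>c i\<close> is
  good.\<close>

lemma nzd_direct:
  assumes i: "i < N'" and A: "is_ideal R A" and nA: "n0 \<subseteq> A"
  shows "nzd i A"
  unfolding nzd_def
proof (intro ballI impI)
  fix x assume x: "x \<in> P" and "\<rho> i * x \<in> J i A"
  then obtain s w where s: "s \<in> P" "good s" "w \<in> gen P (\<rho> ` {..<i})" "s * (\<rho> i * x) - w \<in> poly_algebra A N"
    unfolding J_def by blast
  note PA = poly_algebra_ideal[OF sR A, of N]
  define \<rho>' where "\<rho>' j = c j * Var j ^ l j" for j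
  have d: "\<rho> j - \<rho>' j \<in> poly_algebra A N" if "j < N'" for j
    using \<rho>_c[OF that] poly_algebra_mono[OF nA, of N N] unfolding \<rho>'_def by auto
  have d': "\<rho>' j - \<rho> j \<in> poly_algebra A N" if "j < N'" for j
    using is_ideal_uminus[OF sP PA d[OF that]] by simp
  have ci: "c i \<in> P" using c_in[OF i] poly_algebra_mono[of R R i N] i N' by auto
  obtain w' where w': "w' \<in> gen P (\<rho>' ` {..<i})" "w - w' \<in> poly_algebra A N"
    using gen_perturb[OF sP PA, of "{..<i}" \<rho> \<rho>' w] d s(3) i by auto
  have "(s * (\<rho> i * x) - w) + (w - w') - (s * x) * (\<rho> i - \<rho>' i) \<in> poly_algebra A N"
    using is_idealD(3)[OF PA s(4) w'(2)] is_idealD(4)[OF PA subring_set_mult[OF sP s(1) x] d[OF i]]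
    by (rule is_ideal_diff[OF sP PA])
  moreover have "(s * (\<rho> i * x) - w) + (w - w') - (s * x) * (\<rho> i - \<rho>' i) = Var i ^ l i * (s * c i * x) - w'"
    by (simp add: \<rho>'_def algebra_simps)
  ultimately have *: "Var i ^ l i * (s * c i * x) - w' \<in> poly_algebra A N" by (simp only:)
  have "shift_down i (l i) v \<in> gen P (\<rho>' ` {..<i})" if "v \<in> gen P (\<rho>' ` {..<i})" for v
    using that
  proof induction
    case gen_zero
    have "shift_down i (l i) 0 = (0 :: 'a mpoly)" by (rule poly_mapping_eqI) (simp add: lookup_shft)
    then show ?case by (simp add: gen.gen_zero)
  next
    case (gen_step y r x)
    then obtain j where j: "j < i" "x = \<rho>' j" by blast
    have "c j \<in> poly_algebra R (Suc j)" using c_in[of j] poly_algebra_mono[of R R j "Suc j"] j(1) i by auto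
    then have "\<rho>' j \<in> poly_algebra R (Suc j)" unfolding \<rho>'_def
      using poly_algebra_subring_set[OF sR] Var_in[OF sR, of j "Suc j"] by (intro subring_set_mult subring_set_power) auto
    then have "i \<notin> ks m" if "m \<in> ks (\<rho>' j)" for m using that j(1) by (force simp: poly_algebra_iff)
    then have "shift_down i (l i) (\<rho>' j * r) = \<rho>' j * shift_down i (l i) r" by (rule shift_down_mult)
    then have "shift_down i (l i) (r * x + y) = shift_down i (l i) r * x + shift_down i (l i) y"
      by (simp add: j shift_down_add mult.commute)
    then show ?case using gen.gen_step[OF gen_step.IH shift_down_in[OF gen_step(2)], of x] gen_step(3) by simp
  qed
  then have w'': "shift_down i (l i) w' \<in> gen P (\<rho>' ` {..<i})" using w'(1) by blast
  have sm: "shift_down i (l i) (u - v) = shift_down i (l i) u - shift_down i (l i) v" for u v :: "'a mpoly"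
    by (rule poly_mapping_eqI) (simp add: lookup_shft lookup_minus)
  have 1: "s * c i * x - shift_down i (l i) w' \<in> poly_algebra A N"
    using shift_down_in[OF *, of i "l i"] by (simp add: sm shift_down_Var)
  obtain v where v: "v \<in> gen P (\<rho> ` {..<i})" "shift_down i (l i) w' - v \<in> poly_algebra A N"
    using gen_perturb[OF sP PA, of "{..<i}" \<rho>' \<rho>, OF _ w''] d' i by auto
  have "(s * c i * x - shift_down i (l i) w') + (shift_down i (l i) w' - v) \<in> poly_algebra A N"
    using is_idealD(3)[OF PA 1 v(2)] .
  then have "s * c i * x - v \<in> poly_algebra A N" by simp
  then show "x \<in> J i A" using J_I[of x "s * c i" v i A] x s ci sP good_mult c_good[OF i] v(1)
    by (simp add: subring_set_mult)
qed

text \<open>Noetherian induction on the coefficient ideal \<open>A\<close>. When \<open>A\<close> is its own colon ideal by \<open>a\<close>, an element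
  killed modulo \<open>A\<close> is, up to good factors, infinitely divisible by \<open>a\<close>; the ascending chain condition
  on the quotients takes the place of Krull's intersection theorem.\<close>

lemma nzd_all:
  assumes i: "i < N'" and F: "flat i"
  shows "is_ideal R A \<Longrightarrow> nzd i A"
proof (induction A rule: wf_induct_rule[OF noetherian_wf[OF R]])
  case (1 A)
  have A: "is_ideal R A" by (rule 1(2))
  have IH: "nzd i B" if "is_ideal R B" "A \<subset> B" for B using 1 that by blast
  show ?case
  proof (cases "n0 \<subseteq> A")
    case True
    then show ?thesis using nzd_direct i A by blast
  next
    case False
    then obtain a where a: "a \<in> n0" "a \<notin> A" by blast
    have aR: "a \<in> R" using a n0 is_idealD(2) by blast
    have cP: "Const a \<in> P" using aR Const_in by blast
    have i': "i \<le> N'" using i by simp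
    note JA = J_ideal[OF i' A]
    let ?B = "sum_ideal A a" and ?C = "colon A a"
    have B: "is_ideal R ?B" and C: "is_ideal R ?C" using sum_ideal_ideal[OF A aR] colon_ideal[OF A aR] .
    have ZB: "nzd i ?B" using IH[OF B] sum_ideal_superset[OF A, of a] sum_ideal_elem[OF A, of a] a by blast
    \<comment> \<open>The induction hypothesis for \<open>A + a R\<close> makes \<open>x\<close>
      equal to \<open>a x'\<close> up to a good factor; flatness then moves the assumption on
      \<open>x\<close> to \<open>x'\<close> and the colon ideal.\<close>
    have step: "\<exists>s x'. s \<in> P \<and> good s \<and> x' \<in> P \<and> s * x - Const a * x' \<in> J i A \<and> \<rho> i * x' \<in> J i ?C"
      if x: "x \<in> P" "\<rho> i * x \<in> J i A" for x
    proof -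
      have "\<rho> i * x \<in> J i ?B" using x J_mono[OF sum_ideal_superset[OF A]] by blast
      then have "x \<in> J i ?B" using ZB x unfolding nzd_def by blast
      then obtain s w where s: "s \<in> P" "good s" "w \<in> gen P (\<rho> ` {..<i})" "s * x - w \<in> poly_algebra ?B N"
        unfolding J_def by blast
      obtain y where y: "y \<in> P" "s * x - w - Const a * y \<in> poly_algebra A N"
        using poly_sum_ideal[OF A aR s(4)] by blast
      have "(s * x - w - Const a * y) + w \<in> J i A"
        using is_idealD(3)[OF JA J_coeff[OF A y(2)] J_gen[OF i' A s(3)]] .
      then have *: "s * x - Const a * y \<in> J i A" by (simp add: algebra_simps)
      have "s * (\<rho> i * x) - \<rho> i * (s * x - Const a * y) \<in> J i A"
        using is_idealD(4)[OF JA s(1) x(2)] is_idealD(4)[OF JA \<rho>_in[OF i] *]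
        by (rule is_ideal_diff[OF sP JA])
      then have "Const a * (\<rho> i * y) \<in> J i A" by (simp add: algebra_simps)
      then have "\<rho> i * y \<in> J i ?C" using F A aR subring_set_mult[OF sP \<rho>_in[OF i] y(1)] unfolding flat_def by blast
      then show ?thesis using s y * by blast
    qed
    show ?thesis
    proof (cases "?C = A")
      case False
      \<comment> \<open>The colon ideal is strictly larger here, so the induction hypothesis puts
        \<open>x'\<close> in its \<open>J\<close>; multiplication by \<open>a\<close> leads back to
        \<open>J i A\<close>.\<close>
      then have ZC: "nzd i ?C" using IH[OF C] colon_superset[OF A aR] by blast
      show ?thesis unfolding nzd_def
      proof (intro ballI impI)
        fix x assume x: "x \<in> P" "\<rho> i * x \<in> J i A"
        obtain s y where y: "s \<in> P" "good s" "y \<in> P" "s * x - Const a * y \<in> J i A" "\<rho> i * y \<in> J i ?C"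
          using step[OF x] by blast
        have "y \<in> J i ?C" using ZC y unfolding nzd_def by blast
        then obtain t w where t: "t \<in> P" "good t" "w \<in> gen P (\<rho> ` {..<i})" "t * y - w \<in> poly_algebra ?C N"
          unfolding J_def by blast
        have "t * y - w \<in> P" using is_idealD(2)[OF poly_algebra_ideal[OF sR C]] t(4) by blast
        then have "Const a * (t * y - w) \<in> poly_algebra A N" using poly_algebra_colon[OF A] t(4) by blast
        then have "Const a * (t * y - w) + Const a * w \<in> J i A"
          using is_idealD(3)[OF JA J_coeff[OF A] J_gen[OF i' A gen_mult[OF sP cP t(3)]]] by blast
        then have "t * (Const a * y) \<in> J i A" by (simp add: algebra_simps)
        then have "Const a * y \<in> J i A" using J_saturated t y cP sP subring_set_mult by blast
        then have "(s * x - Const a * y) + Const a * y \<in> J i A" using is_idealD(3)[OF JA y(4)] by blast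
        then show "x \<in> J i A" using J_saturated[of x s i A] x y by simp
      qed
    next
      case True
      show ?thesis unfolding nzd_def
      proof (intro ballI impI)
        fix x assume x: "x \<in> P" "\<rho> i * x \<in> J i A"
        obtain S nx where SNX: "\<And>z. z \<in> P \<Longrightarrow> \<rho> i * z \<in> J i A \<Longrightarrow>
          S z \<in> P \<and> good (S z) \<and> nx z \<in> P \<and> S z * z - Const a * nx z \<in> J i A \<and> \<rho> i * nx z \<in> J i A"
          using step True by metis
        \<comment> \<open>Iterating \<open>step\<close>: modulo \<open>J i A\<close> and up to good
          factors, each \<open>sx k\<close> is \<open>a\<close> times
          \<open>sx (Suc k)\<close>.\<close>
        define sx where "sx k = (nx ^^ k) x" for k
        have XP: "sx k \<in> P \<and> \<rho> i * sx k \<in> J i A" for k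
          by (induction k) (use x SNX in \<open>auto simp: sx_def\<close>)
        have XS: "S (sx k) \<in> P" "good (S (sx k))" "S (sx k) * sx k - Const a * sx (Suc k) \<in> J i A" for k
          using SNX XP[of k] by (auto simp: sx_def)
        obtain n where n: "sx n \<in> gen P (sx ` {..<n})"
          using noetherian_seq[OF noetherian_poly_algebra[OF R], of sx N] XP by blast
        have rel: "\<exists>\<sigma> \<omega>. \<sigma> \<in> P \<and> good \<sigma> \<and> \<omega> \<in> P \<and> \<sigma> * sx k - Const a * \<omega> * sx n \<in> J i A"
          if "n = k + Suc d" for k d
          using that
        proof (induction d arbitrary: k)
          case 0
          then show ?case using XS[of k] subring_set_one[OF sP]
            by (intro exI[of _ "S (sx k)"] exI[of _ 1]) auto
        next
          case (Suc d)
          then obtain \<sigma> \<omega> where \<sigma>: "\<sigma> \<in> P" "good \<sigma>" "\<omega> \<in> P" "\<sigma> * sx (Suc k) - Const a * \<omega> * sx n \<in> J i A"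
            using Suc.IH[of "Suc k"] by auto
          have "\<sigma> * (S (sx k) * sx k - Const a * sx (Suc k)) + Const a * (\<sigma> * sx (Suc k) - Const a * \<omega> * sx n) \<in> J i A"
            by (intro is_idealD(3)[OF JA] is_idealD(4)[OF JA]) (use \<sigma> XS cP in auto)
          then have "\<sigma> * S (sx k) * sx k - Const a * (Const a * \<omega>) * sx n \<in> J i A" by (simp add: algebra_simps)
          then show ?case using \<sigma> XS[of k] cP sP subring_set_mult good_mult
            by (intro exI[of _ "\<sigma> * S (sx k)"] exI[of _ "Const a * \<omega>"]) auto
        qed
        have relg: "\<exists>\<sigma> \<omega>. \<sigma> \<in> P \<and> good \<sigma> \<and> \<omega> \<in> P \<and> \<sigma> * z - Const a * \<omega> * sx n \<in> J i A"
          if "z \<in> gen P (sx ` {..<n})" for z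
          using that
        proof induction
          case gen_zero
          then show ?case using subring_set_one[OF sP] subring_set_zero[OF sP] good_1 is_idealD(1)[OF JA]
            by (intro exI[of _ 1] exI[of _ 0]) auto
        next
          case (gen_step y r z)
          then obtain k where k: "k < n" "z = sx k" by blast
          then obtain d where "n = k + Suc d" using less_imp_Suc_add by auto
          from rel[OF this] obtain \<sigma> \<omega> where \<sigma>: "\<sigma> \<in> P" "good \<sigma>" "\<omega> \<in> P" "\<sigma> * z - Const a * \<omega> * sx n \<in> J i A"
            unfolding k by blast
          from gen_step.IH obtain \<tau> \<nu> where \<tau>: "\<tau> \<in> P" "good \<tau>" "\<nu> \<in> P" "\<tau> * y - Const a * \<nu> * sx n \<in> J i A" by blast
          have "(\<tau> * r) * (\<sigma> * z - Const a * \<omega> * sx n) + \<sigma> * (\<tau> * y - Const a * \<nu> * sx n) \<in> J i A"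
            by (intro is_idealD(3)[OF JA] is_idealD(4)[OF JA] subring_set_mult[OF sP]) (use \<sigma> \<tau> gen_step(2) in auto)
          then have *: "(\<sigma> * \<tau>) * (r * z + y) - Const a * (\<tau> * r * \<omega> + \<sigma> * \<nu>) * sx n \<in> J i A"
            by (simp add: algebra_simps)
          show ?case
            by (rule exI[of _ "\<sigma> * \<tau>"], rule exI[of _ "\<tau> * r * \<omega> + \<sigma> * \<nu>"])
              (use * \<sigma> \<tau> gen_step(2) sP good_mult in \<open>auto intro!: subring_set_mult subring_set_add\<close>)
        qed
        \<comment> \<open>\<open>sx n\<close> is a combination of its predecessors, and each of
          these is, up to good factors, a multiple of \<open>a * sx n\<close>. So
          \<open>sx n\<close> is killed by \<open>\<sigma> - a \<omega>\<close>, which is good by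
          \<open>good_diff\<close>.\<close>
        from relg[OF n] obtain \<sigma> \<omega> where \<sigma>: "\<sigma> \<in> P" "good \<sigma>" "\<omega> \<in> P" "(\<sigma> - Const a * \<omega>) * sx n \<in> J i A"
          by (auto simp: left_diff_distrib)
        have sxnJ: "sx n \<in> J i A"
          by (rule J_saturated[of _ "\<sigma> - Const a * \<omega>"]) (use \<sigma> XP cP sP good_diff a in \<open>auto intro!: subring_set_diff subring_set_mult\<close>)
        show "x \<in> J i A"
        proof (cases n)
          case 0
          then show ?thesis using sxnJ by (simp add: sx_def)
        next
          case (Suc d)
          from rel[of 0 d] Suc obtain \<sigma> \<omega> where \<sigma>: "\<sigma> \<in> P" "good \<sigma>" "\<omega> \<in> P" "\<sigma> * sx 0 - Const a * \<omega> * sx n \<in> J i A"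
            by auto
          have "(Const a * \<omega>) * sx n \<in> J i A" using is_idealD(4)[OF JA] sxnJ \<sigma> cP sP subring_set_mult by blast
          then have "(\<sigma> * sx 0 - Const a * \<omega> * sx n) + (Const a * \<omega>) * sx n \<in> J i A"
            using is_idealD(3)[OF JA \<sigma>(4)] by blast
          then have "\<sigma> * x \<in> J i A" by (simp add: sx_def)
          then show ?thesis using J_saturated \<sigma> x by blast
        qed
      qed
    qed
  qed
qed

text \<open>Regularity of \<open>\<rho> i\<close> rests on flatness at stage \<open>i\<close>, and
  flatness at the next stage rests on regularity of \<open>\<rho> i\<close>, so the two are proved
  alternately.\<close>

theorem flat_all: "i \<le> N' \<Longrightarrow> flat i"
proof (induction i)
  case 0
  then show ?case by (simp add: flat_0)
next
  case (Suc i)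
  then show ?case using flat_Suc[of i] nzd_all[of i] by simp
qed

end

section \<open>Saturated ideals over a valuation ring\<close>

definition unit_in :: "'a::field set \<Rightarrow> 'a \<Rightarrow> bool" where
  "unit_in W x \<longleftrightarrow> x \<in> W \<and> x \<noteq> 0 \<and> inverse x \<in> W"

definition nonunits :: "'a::field set \<Rightarrow> 'a set" where
  "nonunits W = {x \<in> W. \<not> unit_in W x}"

locale valring =
  fixes V :: "'a::field set"
  assumes V: "subring_set V"
    and val: "\<And>a b. a \<in> V \<Longrightarrow> b \<in> V \<Longrightarrow> a \<noteq> 0 \<Longrightarrow> b \<noteq> 0 \<Longrightarrow> a / b \<in> V \<or> b / a \<in> V"
begin

lemma unit_in_mult: "unit_in V x \<Longrightarrow> unit_in V y \<Longrightarrow> unit_in V (x * y)"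
  using V by (auto simp: unit_in_def intro: subring_set_mult)

lemma unit_in_1: "unit_in V 1" using V by (auto simp: unit_in_def subring_set_one)

lemma unit_in_power: "unit_in V x \<Longrightarrow> unit_in V (x ^ k)"
  by (induction k) (auto simp: unit_in_1 unit_in_mult)

lemma unit_in_inverse: "unit_in V x \<Longrightarrow> unit_in V (inverse x)"
  by (auto simp: unit_in_def)

lemma unit_in_divide: "unit_in V x \<Longrightarrow> unit_in V y \<Longrightarrow> unit_in V (x / y)"
  by (simp add: divide_inverse unit_in_mult unit_in_inverse)

lemma unit_in_in: "unit_in V x \<Longrightarrow> x \<in> V" by (simp add: unit_in_def)
lemma unit_in_nonzero: "unit_in V x \<Longrightarrow> x \<noteq> 0" by (simp add: unit_in_def)

lemma unit_in_multD: "unit_in V (x * y) \<Longrightarrow> x \<in> V \<Longrightarrow> y \<in> V \<Longrightarrow> unit_in V x"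
proof -
  assume *: "unit_in V (x * y)" "x \<in> V" "y \<in> V"
  then have "y * inverse (x * y) \<in> V" using V by (auto simp: unit_in_def intro: subring_set_mult)
  moreover have "y * inverse (x * y) = inverse x" using * by (auto simp: unit_in_def)
  ultimately show ?thesis using * by (simp only: unit_in_def) auto
qed

lemma nonunits_in: "x \<in> nonunits V \<Longrightarrow> x \<in> V" by (simp add: nonunits_def)

lemma nonunits_ideal: "is_ideal V (nonunits V)"
  unfolding is_ideal_def
proof (intro conjI ballI)
  show "0 \<in> nonunits V" using V by (simp add: nonunits_def unit_in_def subring_set_zero)
  show "nonunits V \<subseteq> V" by (auto simp: nonunits_def)
  show "r * x \<in> nonunits V" if "r \<in> V" "x \<in> nonunits V" for r x
    using that V unit_in_multD[of x r] by (auto simp: nonunits_def mult.commute intro: subring_set_mult)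
  have add: "x + y \<in> nonunits V" if "x \<in> nonunits V" "y \<in> nonunits V" "x \<noteq> 0" "y \<noteq> 0" "x / y \<in> V" for x y
  proof -
    have xy: "x \<in> V" "y \<in> V" using that nonunits_in by auto
    have "1 + x / y \<in> V" using that V by (auto intro: subring_set_intros)
    moreover have "y * (1 + x / y) = x + y" using that by (simp add: field_simps)
    ultimately show ?thesis using that xy V unit_in_multD[of y "1 + x / y"]
      by (auto simp: nonunits_def intro: subring_set_add)
  qed
  fix x y assume "x \<in> nonunits V" "y \<in> nonunits V"
  then show "x + y \<in> nonunits V"
    using add[of x y] add[of y x] val[of x y]
    by (cases "x = 0"; cases "y = 0") (auto simp: add.commute nonunits_def)
qed

lemmas nonunD = is_idealD[OF nonunits_ideal]

lemma unit_in_add_nonun: "unit_in V x \<Longrightarrow> y \<in> nonunits V \<Longrightarrow> unit_in V (x + y)"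
proof (rule ccontr)
  assume *: "unit_in V x" "y \<in> nonunits V" "\<not> unit_in V (x + y)"
  then have "x + y \<in> nonunits V" using V by (auto simp: nonunits_def unit_in_def intro: subring_set_add)
  then have "x + y - y \<in> nonunits V" using is_ideal_diff[OF V nonunits_ideal] * by blast
  then show False using * by (simp add: nonunits_def)
qed

lemma unit_in_diff_nonun: "unit_in V x \<Longrightarrow> y \<in> nonunits V \<Longrightarrow> unit_in V (x - y)"
  using unit_in_add_nonun[of x "- y"] is_ideal_uminus[OF V nonunits_ideal] by simp

lemma nonunits_or_un: "x \<in> V \<Longrightarrow> x \<notin> nonunits V \<Longrightarrow> unit_in V x"
  by (simp add: nonunits_def)

lemma common_divisor:
  assumes "finite A" "A \<subseteq> V" "\<exists>a\<in>A. a \<noteq> 0"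
  shows "\<exists>c\<in>A. c \<noteq> 0 \<and> (\<forall>a\<in>A. a / c \<in> V)"
  using assms
proof (induction A rule: finite_induct)
  case (insert x A)
  show ?case
  proof (cases "\<exists>a\<in>A. a \<noteq> 0")
    case False
    then show ?thesis using insert V by (auto simp: subring_set_one subring_set_zero intro!: bexI[of _ x])
  next
    case True
    then obtain c where c: "c \<in> A" "c \<noteq> 0" "\<forall>a\<in>A. a / c \<in> V" using insert by blast
    show ?thesis
    proof (cases "x / c \<in> V")
      case True
      then show ?thesis using c by blast
    next
      case False
      then have x0: "x \<noteq> 0" using V by (auto simp: subring_set_zero)
      have cx: "c / x \<in> V" using val[of x c] insert c x0 False by auto
      have "a / x \<in> V" if "a \<in> A" for a
      proof -
        have "(a / c) * (c / x) \<in> V" using c that cx V subring_set_mult by blast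
        then show ?thesis using c by simp
      qed
      then show ?thesis using x0 V by (auto simp: subring_set_one intro!: bexI[of _ x])
    qed
  qed
qed auto

text \<open>Over a valuation ring a coefficient of least value serves as the content; dividing by it
  leaves a coefficient equal to 1.\<close>

lemma primitive_part:
  assumes x: "x \<in> poly_algebra V n" "x \<noteq> 0"
  obtains c x' where "c \<in> V" "c \<noteq> 0" "x' \<in> poly_algebra V n" "x = Const c * x'"
    "\<exists>m. unit_in V (lk x' m)"
proof -
  have ne: "ks x \<noteq> {}" using x by simp
  have "\<exists>c\<in>lk x ` ks x. c \<noteq> 0 \<and> (\<forall>a\<in>lk x ` ks x. a / c \<in> V)"
  proof (rule common_divisor)
    obtain k where "k \<in> ks x" using ne by blast
    then show "\<exists>a\<in>lk x ` ks x. a \<noteq> 0" by (intro bexI[of _ "lk x k"]) (auto simp: in_keys_iff)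
  qed (use x in \<open>auto simp: poly_algebra_iff\<close>)
  then obtain k where k: "k \<in> ks x" "\<And>m. m \<in> ks x \<Longrightarrow> lk x m / lk x k \<in> V" by auto
  let ?c = "lk x k"
  have c0: "?c \<noteq> 0" using k(1) by (simp add: in_keys_iff)
  have cV: "?c \<in> V" using k(1) x by (auto simp: poly_algebra_iff)
  let ?x = "Const (inverse ?c) * x"
  have "?x \<in> poly_algebra V n" unfolding poly_algebra_iff
  proof
    fix m assume "m \<in> ks ?x"
    then have m: "m \<in> ks x" by (auto simp: in_keys_iff lookup_Const_mult)
    have "lk ?x m = lk x m / lk x k" by (simp add: lookup_Const_mult divide_inverse mult.commute[of _ "inverse (lk x k)"] del: mult_zero_left)
    then show "lk ?x m \<in> V \<and> ks m \<subseteq> {..<n}" using k(2)[OF m] x m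
      by (auto simp: poly_algebra_iff)
  qed
  moreover have "x = Const ?c * ?x" using c0
    by (simp add: mult.assoc[symmetric] Const_hom(2)[symmetric] Const_hom(3))
  moreover have "unit_in V (lk ?x k)" using c0 by (simp add: lookup_Const_mult unit_in_1)
  ultimately show thesis using that c0 cV by blast
qed

end

lemma gen_gen: "subring_set R \<Longrightarrow> T \<subseteq> gen R S \<Longrightarrow> gen R T \<subseteq> gen R S"
proof
  fix x assume R: "subring_set R" "T \<subseteq> gen R S" and "x \<in> gen R T"
  from this(3) show "x \<in> gen R S"
    by induction (use R in \<open>auto intro: gen_zero gen_add gen_mult\<close>)
qed

text \<open>Dickson's lemma again: without a finite basis one could choose a sequence in which no
  term divides a later one.\<close>

lemma monomial_finite_basis:
  fixes A :: "(nat \<Rightarrow>\<^sub>0 nat) set"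
  assumes A: "\<And>m. m \<in> A \<Longrightarrow> ks m \<subseteq> {..<n}"
  obtains T where "finite T" "T \<subseteq> A" "\<And>b. b \<in> A \<Longrightarrow> \<exists>a\<in>T. \<forall>i. lk a i \<le> lk b i"
proof (rule ccontr)
  assume c: "\<not> thesis"
  note witness = that
  have "\<exists>b\<in>A. \<forall>a\<in>T. \<not> (\<forall>i. lk a i \<le> lk b i)" if "finite T" "T \<subseteq> A" for T
  proof (rule ccontr)
    assume "\<not> ?thesis"
    then show False using c witness[of T] \<open>finite T\<close> \<open>T \<subseteq> A\<close> by blast
  qed
  then obtain g where g: "\<And>T. finite T \<Longrightarrow> T \<subseteq> A \<Longrightarrow> g T \<in> A \<and> (\<forall>a\<in>T. \<not> (\<forall>i. lk a i \<le> lk (g T) i))"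
    by metis
  define S where "S k = rec_nat {} (\<lambda>_ S. insert (g S) S) k" for k :: nat
  have S0: "S 0 = {}" and SS: "S (Suc k) = insert (g (S k)) (S k)" for k by (simp_all add: S_def)
  have SI: "finite (S k) \<and> S k \<subseteq> A" for k by (induction k) (use g in \<open>auto simp: S0 SS\<close>)
  define f where "f k = g (S k)" for k
  have f: "f k \<in> A" "\<And>a. a \<in> S k \<Longrightarrow> \<not> (\<forall>i. lk a i \<le> lk (f k) i)" for k
    using g SI[of k] unfolding f_def by auto
  have fS: "f j \<in> S k" if "j < k" for j k
    using that by (induction k) (auto simp: SS f_def less_Suc_eq)
  obtain \<phi> :: "nat \<Rightarrow> nat" where \<phi>: "strict_mono \<phi>" "\<And>j k i. j \<le> k \<Longrightarrow> lk (f (\<phi> j)) i \<le> lk (f (\<phi> k)) i"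
    by (rule monomial_dickson[of f n]) (use A f(1) in auto)
  have "f (\<phi> 0) \<in> S (\<phi> 1)" using fS \<phi>(1) by (simp add: strict_mono_def)
  then show False using f(2) \<phi>(2)[of 0 1] by auto
qed

context valring
begin

abbreviation "PV \<equiv> poly_algebra V"
abbreviation "CV \<equiv> Const ` V"

lemma sPV: "subring_set (PV n)" using poly_algebra_subring_set V by blast

lemma CV: "subring_set CV"
  unfolding subring_set_def
proof (intro conjI ballI)
  show "1 \<in> CV" using V subring_set_one Const_hom(3) by (metis image_eqI)
  fix x y assume "x \<in> CV" "y \<in> CV"
  then obtain a b where "a \<in> V" "b \<in> V" "x = Const a" "y = Const b" by blast
  then have "x - y = Const (a - b)" "x * y = Const (a * b)" "a - b \<in> V" "a * b \<in> V"
    using V by (auto simp: Const_hom subring_set_intros)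
  then show "x - y \<in> CV" "x * y \<in> CV" by blast+
qed

text \<open>Modulo the maximal ideal the matrix of the coefficients of \<open>u b\<close> at
  \<open>b'\<close> is triangular with unit diagonal, hence invertible. Elimination starts at the
  largest monomial: clearing it from another \<open>u b\<close> subtracts a non-unit multiple of
  \<open>u b0\<close>, which preserves the unit diagonal and the non-units beyond it.\<close>

lemma elimination:
  assumes "finite B" "\<And>b m. b \<in> B \<Longrightarrow> lk (u b) m \<in> V" "\<And>m. lk x m \<in> V"
    and "\<And>b. b \<in> B \<Longrightarrow> unit_in V (lk (u b) b)"
    and "\<And>b b'. b \<in> B \<Longrightarrow> b' \<in> B \<Longrightarrow> b < b' \<Longrightarrow> lk (u b) b' \<in> nonunits V"
  shows "\<exists>w\<in>gen CV (u ` B). \<forall>b\<in>B. lk (x - w) b = 0"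
  using assms
proof (induction "card B" arbitrary: B u x)
  case 0
  then show ?case by (auto intro: gen_zero)
next
  case (Suc n)
  then have "B \<noteq> {}" by auto
  define b0 where "b0 = Max B"
  have b0: "b0 \<in> B" "\<And>b. b \<in> B \<Longrightarrow> b \<le> b0" unfolding b0_def using Suc(3) \<open>B \<noteq> {}\<close> by auto
  define B' where "B' = B - {b0}"
  have B': "finite B'" "card B' = n" "B = insert b0 B'" "B' \<subseteq> B" "\<And>b. b \<in> B' \<Longrightarrow> b < b0"
    using Suc(2,3) b0 unfolding B'_def by (auto simp: order_less_le)
  define qt where "qt v = lk v b0 / lk (u b0) b0" for v
  have u0: "unit_in V (lk (u b0) b0)" using Suc(6) b0 by blast
  define r where "r v = v - Const (qt v) * u b0" for v
  have r0: "lk (r v) b0 = 0" for v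
    using u0 by (simp add: r_def lookup_minus lookup_Const_mult qt_def unit_in_def)
  have lV: "qt v \<in> V" if "\<And>m. lk v m \<in> V" for v
    using that u0 V unfolding qt_def divide_inverse by (auto simp: unit_in_def intro: subring_set_mult)
  have rV: "lk (r v) m \<in> V" if "\<And>m. lk v m \<in> V" for v m
    using that[of m] lV[OF that] Suc(4)[OF b0(1), of m] subring_set_diff[OF V] subring_set_mult[OF V]
    by (simp add: r_def lookup_minus lookup_Const_mult)
  have ln: "qt (u b) \<in> nonunits V" if "b \<in> B'" for b
  proof -
    have "lk (u b) b0 \<in> nonunits V" using Suc(7) that B' b0 by blast
    then show ?thesis using nonunD(4)[of "inverse (lk (u b0) b0)"] u0
      unfolding qt_def divide_inverse by (simp add: unit_in_def mult.commute)
  qed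
  have ln': "qt (u b) * lk (u b0) m \<in> nonunits V" if "b \<in> B'" for b m
    using nonunD(4)[OF Suc(4)[OF b0(1), of m] ln[OF that]] by (simp add: mult.commute)
  have IH: "\<exists>w\<in>gen CV ((\<lambda>b. r (u b)) ` B'). \<forall>b\<in>B'. lk (r x - w) b = 0"
  proof (rule Suc(1))
    show "n = card B'" "finite B'" using B' by auto
    show "lk (r (u b)) m \<in> V" if "b \<in> B'" for b m using rV Suc(4) that B' by blast
    show "lk (r x) m \<in> V" for m using rV Suc(5) by blast
    show "unit_in V (lk (r (u b)) b)" if "b \<in> B'" for b
      using unit_in_diff_nonun[OF Suc(6) ln'] that B' by (auto simp: r_def lookup_minus lookup_Const_mult)
    show "lk (r (u b)) b' \<in> nonunits V" if "b \<in> B'" "b' \<in> B'" "b < b'" for b b'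
      using is_ideal_diff[OF V nonunits_ideal Suc(7) ln'] that B' by (auto simp: r_def lookup_minus lookup_Const_mult)
  qed
  then obtain w where w: "w \<in> gen CV ((\<lambda>b. r (u b)) ` B')" "\<forall>b\<in>B'. lk (r x - w) b = 0" by blast
  have w0: "lk v b0 = 0" if "v \<in> gen CV ((\<lambda>b. r (u b)) ` B')" for v
    using that by induction (auto simp: lookup_add lookup_Const_mult r0)
  have "(\<lambda>b. r (u b)) ` B' \<subseteq> gen CV (u ` B)"
  proof clarify
    fix b assume b: "b \<in> B'"
    have "qt (u b) \<in> V" using ln[OF b] nonunits_in by blast
    then show "r (u b) \<in> gen CV (u ` B)" unfolding r_def using b0 b B'
      by (intro gen_diff[OF CV] gen_base[OF CV] gen_base_mult) auto
  qed
  then have "w \<in> gen CV (u ` B)" using gen_gen[OF CV] w(1) by blast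
  moreover have "qt x \<in> V" using lV Suc(5) by blast
  ultimately have "w + Const (qt x) * u b0 \<in> gen CV (u ` B)" using b0
    by (intro gen_add gen_base_mult) auto
  moreover have "x - (w + Const (qt x) * u b0) = r x - w" by (simp add: r_def algebra_simps)
  moreover have "lk (r x - w) b = 0" if "b \<in> B" for b
    using that w(2) w0[OF w(1)] r0[of x] B'(3) by (auto simp: lookup_minus)
  ultimately show ?case by metis
qed

text \<open>Homogenization makes the degrees of the leading forms visible: the pair of a leading
  monomial modulo the maximal ideal and a degree bound is encoded as a monomial with one
  more variable, so that in each degree the elimination above is a finite problem over \<open>V\<close>.\<close>

theorem saturated_ideal_finitely_generated:
  assumes I: "is_ideal (PV N) I"
    and sat: "\<And>e x. e \<in> V \<Longrightarrow> e \<noteq> 0 \<Longrightarrow> x \<in> PV N \<Longrightarrow> Const e * x \<in> I \<Longrightarrow> x \<in> I"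
  shows "\<exists>S\<subseteq>I. finite S \<and> I \<subseteq> gen (PV N) S"
proof -
  have IP: "I \<subseteq> PV N" using is_idealD(2)[OF I] .
  define td where "td m = (\<Sum>i<N. lk m i)" for m :: "nat \<Rightarrow>\<^sub>0 nat"
  have td_add: "td (m + m') = td m + td m'" for m m' by (simp add: td_def lookup_add sum.distrib)
  define dle where "dle d x \<longleftrightarrow> (\<forall>m\<in>ks x. td m \<le> d)" for d and x :: "'a mpoly"
  \<comment> \<open>The leading monomial of the reduction of \<open>x\<close> modulo the maximal
    ideal; it exists once some coefficient is a unit.\<close>
  define lmu where "lmu b x \<longleftrightarrow> unit_in V (lk x b) \<and> (\<forall>b'>b. \<not> unit_in V (lk x b'))" for b and x :: "'a mpoly"
  have ex_lmu: "\<exists>b. lmu b x" if "unit_in V (lk x m)" for x m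
  proof -
    let ?A = "{m \<in> ks x. unit_in V (lk x m)}"
    have fin: "finite ?A" "m \<in> ?A" using that by (auto simp: in_keys_iff unit_in_def)
    have mx: "Max ?A \<in> ?A" using fin by (intro Max_in) auto
    have "\<not> unit_in V (lk x b')" if "b' > Max ?A" for b'
    proof
      assume u: "unit_in V (lk x b')"
      then have "b' \<in> ks x" by (simp add: unit_in_def in_keys_iff)
      then have "b' \<le> Max ?A" using fin u by (intro Max_ge) auto
      then show False using that by simp
    qed
    then show ?thesis using mx unfolding lmu_def by blast
  qed
  \<comment> \<open>Variable \<open>N\<close> takes up the missing degree \<open>d - td b\<close>.
    Divisibility of codes then also says that the monomial multiple obtained respects the degree
    bound \<open>d\<close>.\<close>
  define code where "code b d = b + sg N (d - td b)" for b d
  define LM where "LM = {code b d | b d x. x \<in> I \<and> dle d x \<and> lmu b x}"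
  have kb: "ks b \<subseteq> {..<N}" "td b \<le> d" if "x \<in> I" "dle d x" "lmu b x" for b d x
  proof -
    have "b \<in> ks x" using that by (simp add: lmu_def in_keys_iff unit_in_def)
    moreover have "x \<in> PV N" using that(1) IP by blast
    ultimately show "ks b \<subseteq> {..<N}" "td b \<le> d" using that(2) unfolding poly_algebra_iff dle_def by blast+
  qed
  have "ks m \<subseteq> {..<Suc N}" if m: "m \<in> LM" for m
  proof -
    obtain b d x where b: "m = code b d" "x \<in> I" "dle d x" "lmu b x" using m unfolding LM_def by blast
    then show ?thesis using kb(1)[OF b(2-4)] keys_add[of b "sg N (d - td b)"]
      by (fastforce simp: code_def less_Suc_eq split: if_splits)
  qed
  from monomial_finite_basis[OF this] obtain T where T: "finite T" "T \<subseteq> LM"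
    "\<And>b. b \<in> LM \<Longrightarrow> \<exists>a\<in>T. \<forall>i. lk a i \<le> lk b i" by blast
  have "\<forall>t\<in>T. \<exists>x. \<exists>b d. t = code b d \<and> x \<in> I \<and> dle d x \<and> lmu b x"
    using T(2) unfolding LM_def by blast
  then obtain g where g: "\<And>t. t \<in> T \<Longrightarrow> \<exists>b d. t = code b d \<and> g t \<in> I \<and> dle d (g t) \<and> lmu b (g t)"
    by metis
  define S where "S = g ` T"
  have S: "S \<subseteq> I" "finite S" using g T unfolding S_def by auto
  have SP: "S \<subseteq> PV N" using S IP by blast
  \<comment> \<open>Every pair of a leading monomial \<open>b\<close> and a bound \<open>d\<close>
    that occurs in the ideal is realized by a monomial multiple of one of the finitely many chosen
    \<open>g t\<close>.\<close>
  have ub: "\<exists>u. u \<in> gen (PV N) S \<and> u \<in> I \<and> dle d u \<and> lmu b u" if x: "x \<in> I" "dle d x" "lmu b x" for b d x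
  proof -
    have "code b d \<in> LM" using x unfolding LM_def by blast
    then obtain t where t: "t \<in> T" "\<And>i. lk t i \<le> lk (code b d) i" using T(3) by blast
    obtain a e where a: "t = code a e" "g t \<in> I" "dle e (g t)" "lmu a (g t)" using g[OF t(1)] by blast
    note ka = kb[OF a(2-4)] and kb' = kb[OF x]
    have N0: "lk a N = 0" "lk b N = 0" using ka(1) kb'(1) by (auto simp: in_keys_iff)
    have ab: "lk a i \<le> lk b i" for i
    proof (cases "i = N")
      case True then show ?thesis using N0 by simp
    next
      case False
      then show ?thesis using t(2)[of i] unfolding a(1) by (simp add: code_def lookup_add lookup_single when_def)
    qed
    have de: "e - td a \<le> d - td b"
      using t(2)[of N] N0 unfolding a(1) by (simp add: code_def lookup_add)
    define \<gamma> where "\<gamma> = b - a"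
    have b: "b = \<gamma> + a" by (rule poly_mapping_eqI) (use ab in \<open>simp add: \<gamma>_def lookup_add lookup_minus\<close>)
    have k\<gamma>: "ks \<gamma> \<subseteq> {..<N}" using kb'(1) unfolding \<gamma>_def by (auto simp: in_keys_iff lookup_minus subset_iff)
    define u where "u = sg \<gamma> 1 * g t"
    have s: "sg \<gamma> 1 \<in> PV N" by (rule poly_algebra_single) (use k\<gamma> V in \<open>auto simp: subring_set_one\<close>)
    have look: "lk u (\<gamma> + \<beta>) = lk (g t) \<beta>" for \<beta>
      unfolding u_def using lookup_single_mult[of \<gamma> 1 "g t" \<beta>] by simp
    have keys: "\<exists>\<beta>\<in>ks (g t). m = \<gamma> + \<beta>" if "m \<in> ks u" for m
      using keys_single_mult[of \<gamma> 1 "g t"] that unfolding u_def by blast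
    have "u \<in> gen (PV N) S" unfolding u_def using s t(1) by (intro gen_base_mult) (auto simp: S_def)
    moreover have "u \<in> I" unfolding u_def using is_idealD(4)[OF I s a(2)] .
    moreover have "dle d u" unfolding dle_def
    proof
      fix m assume "m \<in> ks u"
      then obtain \<beta> where \<beta>: "\<beta> \<in> ks (g t)" "m = \<gamma> + \<beta>" using keys by blast
      have "td \<beta> \<le> e" using \<beta>(1) a(3) by (auto simp: dle_def)
      moreover have "td b = td \<gamma> + td a" unfolding b by (rule td_add)
      ultimately show "td m \<le> d" using de ka(2) kb'(2) unfolding \<beta>(2) td_add by linarith
    qed
    moreover have "lmu b u" unfolding lmu_def
    proof (intro conjI allI impI)
      show "unit_in V (lk u b)" unfolding b look using a(4) by (simp add: lmu_def)
      fix b' assume b': "b < b'"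
      show "\<not> unit_in V (lk u b')"
      proof
        assume unit_in: "unit_in V (lk u b')"
        then have "b' \<in> ks u" by (simp add: unit_in_def in_keys_iff)
        then obtain \<beta> where \<beta>: "b' = \<gamma> + \<beta>" using keys by blast
        have "a < \<beta>" using b' unfolding b \<beta> by simp
        then show False using unit_in a(4) unfolding \<beta> look lmu_def by blast
      qed
    qed
    ultimately show ?thesis by blast
  qed
  have "x \<in> gen (PV N) S" if x: "x \<in> I" for x
  proof -
    obtain d where d: "dle d x"
    proof
      show "dle (Max (insert 0 (td ` ks x))) x" unfolding dle_def by (auto intro!: Max_ge)
    qed
    define B where "B = {b. \<exists>x. x \<in> I \<and> dle d x \<and> lmu b x}"
    obtain u where u: "\<And>b. b \<in> B \<Longrightarrow> u b \<in> gen (PV N) S \<and> u b \<in> I \<and> dle d (u b) \<and> lmu b (u b)"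
    proof -
      have "\<forall>b\<in>B. \<exists>u. u \<in> gen (PV N) S \<and> u \<in> I \<and> dle d u \<and> lmu b u"
        using ub unfolding B_def by blast
      then show thesis using that by metis
    qed
    have "B \<subseteq> {b. ks b \<subseteq> {..<N} \<and> td b \<le> d}" using kb unfolding B_def by blast
    also have "\<dots> \<subseteq> (\<lambda>f. Abs_poly_mapping (\<lambda>i. if i < N then f i else 0)) ` ({..<N} \<rightarrow>\<^sub>E {..d})"
    proof
      fix b :: "nat \<Rightarrow>\<^sub>0 nat" assume b: "b \<in> {b. ks b \<subseteq> {..<N} \<and> td b \<le> d}"
      have "lk b i \<le> d" if "i < N" for i
        using b that member_le_sum[of i "{..<N}" "lk b"] unfolding td_def by auto
      moreover have "b = Abs_poly_mapping (\<lambda>i. if i < N then restrict (lk b) {..<N} i else 0)"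
      proof -
        have "(\<lambda>i. if i < N then restrict (lk b) {..<N} i else 0) = lk b"
          using b by (auto simp: in_keys_iff restrict_def intro!: ext)
        then show ?thesis by (simp add: lookup_inverse)
      qed
      ultimately show "b \<in> (\<lambda>f. Abs_poly_mapping (\<lambda>i. if i < N then f i else 0)) ` ({..<N} \<rightarrow>\<^sub>E {..d})"
        by (intro image_eqI[of _ _ "restrict (lk b) {..<N}"]) auto
    qed
    finally have "finite B" by (rule finite_subset) (intro finite_imageI finite_PiE; simp)
    have cV: "lk z m \<in> V" if "z \<in> I" for z m
      using that IP poly_algebra_lookup[of z V N m] V subring_set_zero by blast
    have "\<exists>w\<in>gen CV (u ` B). \<forall>b\<in>B. lk (x - w) b = 0"
    proof (rule elimination[OF \<open>finite B\<close>])
      show "lk (u b) b' \<in> nonunits V" if "b \<in> B" "b' \<in> B" "b < b'" for b b'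
        using u[OF that(1)] that cV by (auto simp: lmu_def nonunits_def)
    qed (use u x cV in \<open>auto simp: lmu_def\<close>)
    then obtain w where w: "w \<in> gen CV (u ` B)" "\<And>b. b \<in> B \<Longrightarrow> lk (x - w) b = 0" by blast
    have wg: "v \<in> gen (PV N) S \<and> dle d v \<and> v \<in> I" if "v \<in> gen CV (u ` B)" for v
      using that
    proof induction
      case gen_zero
      then show ?case using is_idealD(1)[OF I] by (auto simp: gen.gen_zero dle_def)
    next
      case (gen_step y r z)
      then obtain a b where a: "a \<in> V" "r = Const a" and b: "b \<in> B" "z = u b" by blast
      have rP: "r \<in> PV N" using a Const_in by blast
      have "ks (r * z) \<subseteq> ks z" by (auto simp: a in_keys_iff lookup_Const_mult)
      then have "dle d (r * z + y)" using u[OF b(1)] gen_step.IH keys_add[of "r * z" y] b(2)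
        unfolding dle_def by blast
      moreover have "r * z + y \<in> gen (PV N) S" using u[OF b(1)] gen_step.IH b(2) rP
        by (intro gen_add gen_mult[OF sPV]) auto
      moreover have "r * z + y \<in> I"
        using is_idealD(3)[OF I is_idealD(4)[OF I rP]] u[OF b(1)] gen_step.IH b(2) by blast
      ultimately show ?case by blast
    qed
    note wg = wg[OF w(1)]
    \<comment> \<open>A nonzero difference is \<open>c x'\<close> with \<open>x'\<close> primitive.
      Saturation puts \<open>x'\<close> in the ideal, under the same degree bound, so its leading
      monomial belongs to \<open>B\<close>, where the coefficients of \<open>x - w\<close>
      vanish.\<close>
    have "x - w = 0"
    proof (rule ccontr)
      assume n0: "x - w \<noteq> 0"
      have xw: "x - w \<in> I" using is_ideal_diff[OF sPV I x] wg by blast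
      obtain c x' where c: "c \<in> V" "c \<noteq> 0" "x' \<in> PV N" "x - w = Const c * x'" "\<exists>m. unit_in V (lk x' m)"
        using primitive_part[OF _ n0] xw IP by blast
      have "x' \<in> I" using sat[OF c(1-3)] xw c(4) by simp
      moreover have "dle d x'"
      proof -
        have "ks x' \<subseteq> ks (x - w)" unfolding c(4) using c(2) by (auto simp: in_keys_iff lookup_Const_mult)
        also have "\<dots> \<subseteq> ks x \<union> ks w" by (auto simp: in_keys_iff lookup_minus)
        finally show ?thesis using d wg unfolding dle_def by blast
      qed
      moreover obtain b where b: "lmu b x'" using ex_lmu c(5) by blast
      ultimately have "b \<in> B" unfolding B_def by blast
      then have "lk (Const c * x') b = 0" using w(2) c(4) by simp
      then show False using b c(2) by (simp add: lookup_Const_mult lmu_def unit_in_def)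
    qed
    then show ?thesis using wg by simp
  qed
  then show ?thesis using S by blast
qed

end

section \<open>Localized ideals of a triangular system\<close>

text \<open>\<open>V\<close> is not Noetherian, but each instance of the regularity statement involves only finitely many
  coefficients, so the flatness criterion can be applied over a Noetherian subring containing them.\<close>

lemma noetherian_approximation:
  fixes V :: "'a::field set"
  assumes V: "subring_set V" and C: "finite C" "C \<subseteq> V"
  obtains R where "noetherian R" "C \<subseteq> R" "R \<subseteq> V"
proof -
  obtain T k where T: "C = T ` {i::nat. i < k}" using finite_imp_nat_seg_image_inj_on[OF C(1)] by blast
  define Z where "Z = range (of_int :: int \<Rightarrow> 'a)"
  have nZ: "noetherian Z" unfolding Z_def by (rule noetherian_int)
  have sZ: "subring_set Z" using nZ by (rule noetherian_sring)
  have "(of_nat n :: 'a) \<in> V" for n by (induction n) (use V in \<open>auto intro: subring_set_intros\<close>)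
  then have "of_int z \<in> V" for z by (cases z rule: int_cases2) (use V in \<open>auto intro: subring_set_uminus\<close>)
  then have ZV: "Z \<subseteq> V" unfolding Z_def by auto
  \<comment> \<open>The subring generated by \<open>C\<close>, as an image of a polynomial ring over
    the image of the integers.\<close>
  let ?R = "eval_mpoly (\<lambda>x. x) T ` poly_algebra Z k"
  have "noetherian ?R" by (rule noetherian_image[OF noetherian_poly_algebra[OF nZ]]) (simp_all add: eval_mpoly_hom is_ring_hom_id)
  moreover have "C \<subseteq> ?R"
  proof
    fix x assume "x \<in> C"
    then obtain i where i: "i < k" "x = T i" using T by auto
    then show "x \<in> ?R" using Var_in[OF sZ i(1)] by (intro image_eqI[of _ _ "Var i"]) (auto simp: eval_mpoly_Var is_ring_hom_id)
  qed
  moreover have "?R \<subseteq> V"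
  proof clarify
    fix x assume "x \<in> poly_algebra Z k"
    then show "eval_mpoly (\<lambda>x. x) T x \<in> V"
      by (rule eval_mpoly_in[OF is_ring_hom_id _ sZ V]) (use ZV C(2) T in auto)
  qed
  ultimately show thesis using that by blast
qed

lemma noetherian_approximation_poly:
  fixes V :: "'a::field set"
  assumes V: "subring_set V" and F: "finite F" "F \<subseteq> poly_algebra V N" and C: "finite C" "C \<subseteq> V"
  obtains R where "noetherian R" "C \<subseteq> R" "R \<subseteq> V" "\<And>f n. f \<in> F \<Longrightarrow> f \<in> poly_algebra V n \<Longrightarrow> f \<in> poly_algebra R n"
proof -
  let ?C = "C \<union> (\<Union>f\<in>F. lk f ` ks f)"
  have "finite ?C" "?C \<subseteq> V" using F C by (auto simp: poly_algebra_iff subset_iff)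
  from noetherian_approximation[OF V this] obtain R where R: "noetherian R" "?C \<subseteq> R" "R \<subseteq> V" by blast
  show thesis
  proof (rule that[OF R(1) _ R(3)])
    fix f n assume "f \<in> F" "f \<in> poly_algebra V n"
    then show "f \<in> poly_algebra R n" using R(2) unfolding poly_algebra_iff by blast
  qed (use R in auto)
qed

locale local_pair = V: valring V + W: valring W for V W :: "'a::field set" +
  assumes VW: "V \<subseteq> W" and loc: "\<And>x. x \<in> V \<Longrightarrow> unit_in W x \<Longrightarrow> unit_in V x"
begin

lemma unit_in_VW: "unit_in V x \<Longrightarrow> unit_in W x" using VW by (auto simp: unit_in_def)

lemma nonunits_VW: "x \<in> nonunits V \<Longrightarrow> x \<in> nonunits W"
  using VW loc by (auto simp: nonunits_def)

abbreviation ev :: "(nat \<Rightarrow> 'a) \<Rightarrow> 'a mpoly \<Rightarrow> 'a" where "ev \<equiv> eval_mpoly (\<lambda>x. x)"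

lemmas ev_hom = eval_mpoly_add[OF is_ring_hom_id] eval_mpoly_mult[OF is_ring_hom_id] eval_mpoly_Const[OF is_ring_hom_id] eval_mpoly_Var[OF is_ring_hom_id]
  eval_mpoly_1[OF is_ring_hom_id] eval_mpoly_0 eval_mpoly_uminus[OF is_ring_hom_id] eval_mpoly_diff[OF is_ring_hom_id] eval_mpoly_power[OF is_ring_hom_id] eval_mpoly_sum[OF is_ring_hom_id]

end

text \<open>The relations vanish at the point \<open>y\<close> and are triangular modulo the maximal
  ideal. \<open>ker\<close> allows two denominators: a scalar \<open>e\<close>, which flatness
  removes, and a polynomial \<open>s\<close> that is a unit at \<open>y\<close>, which is absorbed
  by the final localization.\<close>

locale ci_data = local_pair V W for V W :: "'a::field set" +
  fixes N :: nat and y :: "nat \<Rightarrow> 'a" and \<rho> c :: "nat \<Rightarrow> 'a mpoly" and l :: "nat \<Rightarrow> nat"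
  assumes y: "\<And>i. i < N \<Longrightarrow> y i \<in> W"
    and \<rho>_in: "\<And>i. i < N \<Longrightarrow> \<rho> i \<in> poly_algebra V N"
    and c_in: "\<And>i. i < N \<Longrightarrow> c i \<in> poly_algebra V i"
    and c_un: "\<And>i. i < N \<Longrightarrow> unit_in W (ev y (c i))"
    and \<rho>_c: "\<And>i. i < N \<Longrightarrow> \<rho> i - c i * Var i ^ l i \<in> poly_algebra (nonunits V) N"
    and \<rho>_0: "\<And>i. i < N \<Longrightarrow> ev y (\<rho> i) = 0"
    and ker: "\<And>x. x \<in> poly_algebra V N \<Longrightarrow> ev y x = 0 \<Longrightarrow>
      \<exists>s\<in>poly_algebra V N. \<exists>e\<in>V. unit_in W (ev y s) \<and> e \<noteq> 0 \<and> Const e * (s * x) \<in> gen (poly_algebra V N) (\<rho> ` {..<N})"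
begin

abbreviation "P \<equiv> poly_algebra V N"

lemma sP: "subring_set P" using V.sPV .

lemma ev_in: "x \<in> P \<Longrightarrow> ev y x \<in> W"
  by (rule eval_mpoly_in[OF is_ring_hom_id _ V.V W.V]) (use VW y in auto)

text \<open>The contraction to \<open>P\<close> of the ideal of the first \<open>i\<close> relations
  in the local ring at \<open>y\<close>.\<close>

definition Id :: "nat \<Rightarrow> 'a mpoly set" where
  "Id i = {x \<in> P. \<exists>s\<in>P. unit_in W (ev y s) \<and> s * x \<in> gen P (\<rho> ` {..<i})}"

lemma rho_subset: "i \<le> N \<Longrightarrow> \<rho> ` {..<i} \<subseteq> P"
  using \<rho>_in by auto

lemma Id_ideal: assumes "i \<le> N" shows "is_ideal P (Id i)"
  unfolding is_ideal_def
proof (intro conjI ballI)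
  note gi = gen_is_ideal[OF sP rho_subset[OF assms]]
  show "0 \<in> Id i" unfolding Id_def using sP W.unit_in_1
    by (auto simp: ev_hom gen_zero intro!: subring_set_intros bexI[of _ 1])
  show "Id i \<subseteq> P" by (auto simp: Id_def)
  fix x assume "x \<in> Id i"
  then obtain s where s: "x \<in> P" "s \<in> P" "unit_in W (ev y s)" "s * x \<in> gen P (\<rho> ` {..<i})" unfolding Id_def by blast
  show "x + z \<in> Id i" if "z \<in> Id i" for z
  proof -
    obtain t where t: "z \<in> P" "t \<in> P" "unit_in W (ev y t)" "t * z \<in> gen P (\<rho> ` {..<i})"
      using \<open>z \<in> Id i\<close> unfolding Id_def by blast
    have "t * (s * x) + s * (t * z) \<in> gen P (\<rho> ` {..<i})"
      using s t gen_mult[OF sP] by (intro gen_add) auto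
    then have "(s * t) * (x + z) \<in> gen P (\<rho> ` {..<i})" by (simp add: algebra_simps)
    moreover have "unit_in W (ev y (s * t))" using s t W.unit_in_mult by (simp add: ev_hom)
    ultimately show ?thesis unfolding Id_def using s t sP subring_set_mult subring_set_add by blast
  qed
  show "r * x \<in> Id i" if "r \<in> P" for r
  proof -
    have "r * (s * x) \<in> gen P (\<rho> ` {..<i})" using s that gen_mult[OF sP] by blast
    then have "s * (r * x) \<in> gen P (\<rho> ` {..<i})" by (simp add: mult.left_commute)
    then show ?thesis unfolding Id_def using s that sP subring_set_mult by blast
  qed
qed

text \<open>A certificate for \<open>q \<in> Id i\<close> uses finitely many polynomials. Over a
  Noetherian \<open>R\<close> containing their coefficients, those of \<open>F\<close> and the
  scalar \<open>e\<close>, it becomes a certificate for membership in the criterion's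
  \<open>J\<close> with zero coefficient ideal.\<close>

lemma Id_approx:
  assumes i: "i \<le> N" and FF: "finite F" "F \<subseteq> P" and e: "e \<in> V" and q: "q \<in> P" "q \<in> Id i"
  shows "\<exists>R. \<exists>J. local_criterion R (R \<inter> nonunits V) N N (\<lambda>s. unit_in W (ev y s)) \<rho> c l \<and> R \<subseteq> V \<and> e \<in> R
    \<and> F \<subseteq> poly_algebra R N \<and> q \<in> local_criterion.J R N (\<lambda>s. unit_in W (ev y s)) \<rho> i {0}"
proof -
  obtain s where s: "s \<in> P" "unit_in W (ev y s)" "s * q \<in> gen P (\<rho> ` {..<i})" using q unfolding Id_def by blast
  obtain r where r: "\<And>j. j \<in> {..<i} \<Longrightarrow> r j \<in> P" "s * q = (\<Sum>j<i. r j * \<rho> j)"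
    using gen_imageE[OF s(3) _ sP] by auto
  have cP: "c j \<in> P" if "j < N" for j using c_in[OF that] poly_algebra_mono[of V V j N] that by auto
  let ?F = "F \<union> {s, q} \<union> r ` {..<i} \<union> \<rho> ` {..<N} \<union> c ` {..<N}"
  have "finite ?F" using FF by simp
  moreover have "?F \<subseteq> P" using FF s q r \<rho>_in cP by auto
  moreover have "finite {e}" "{e} \<subseteq> V" using e by auto
  ultimately obtain R where R: "noetherian R" "{e} \<subseteq> R" "R \<subseteq> V"
    "\<And>f n. f \<in> ?F \<Longrightarrow> f \<in> poly_algebra V n \<Longrightarrow> f \<in> poly_algebra R n"
    using noetherian_approximation_poly[OF V.V, of ?F N "{e}"] by metis
  have sR: "subring_set R" using R(1) by (rule noetherian_sring)
  have RP: "poly_algebra R N \<subseteq> P" using poly_algebra_mono[OF R(3)] by blast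
  have \<rho>R: "\<rho> j \<in> poly_algebra R N" if "j < N" for j by (rule R(4)) (use \<rho>_in that in auto)
  have cR: "c j \<in> poly_algebra R n" if "j < N" "c j \<in> poly_algebra V n" for j n by (rule R(4)) (use that in auto)
  have LC: "local_criterion R (R \<inter> nonunits V) N N (\<lambda>s. unit_in W (ev y s)) \<rho> c l"
  proof unfold_locales
    show "is_ideal R (R \<inter> nonunits V)"
      using V.nonunD R(3) sR by (auto simp: is_ideal_def intro: subring_set_intros)
    show "unit_in W (ev y (s - Const a * r))"
      if "s \<in> poly_algebra R N" "r \<in> poly_algebra R N" "unit_in W (ev y s)" "a \<in> R \<inter> nonunits V" for s r a
    proof -
      have "ev y r * a \<in> nonunits W" using that nonunits_VW ev_in RP by (intro W.nonunD(4)) auto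
      then show ?thesis using that W.unit_in_diff_nonun by (simp add: ev_hom mult.commute)
    qed
    show "\<rho> i - c i * Var i ^ l i \<in> poly_algebra (R \<inter> nonunits V) N" if "i < N" for i
    proof -
      have "\<rho> i - c i * Var i ^ l i \<in> poly_algebra R N"
        using \<rho>R[OF that] cR[OF that cP[OF that]] that sR poly_algebra_subring_set[OF sR]
        by (intro subring_set_diff subring_set_mult subring_set_power Var_in) auto
      then show ?thesis using \<rho>_c[OF that] by (auto simp: poly_algebra_iff)
    qed
  qed (use R(1) \<rho>R cR c_in c_un W.unit_in_1 W.unit_in_mult in \<open>auto simp: ev_hom\<close>)
  interpret L: local_criterion R "R \<inter> nonunits V" N N "\<lambda>s. unit_in W (ev y s)" \<rho> c l by (rule LC)
  have "q \<in> L.J i {0}"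
  proof (rule L.J_I[of _ s "s * q"])
    show "s * q \<in> gen L.P (\<rho> ` {..<i})" unfolding r(2)
      by (rule gen_sum, rule gen_base_mult) (use R(4) r(1) in auto)
  qed (use R(4) s q in \<open>auto simp: poly_algebra_iff\<close>)
  moreover have "F \<subseteq> poly_algebra R N" using FF(2) R(4) by blast
  ultimately show ?thesis using LC R by blast
qed

lemma Id_of_J:
  assumes "local_criterion R n0 N N (\<lambda>s. unit_in W (ev y s)) \<rho> c l" "R \<subseteq> V" "A \<subseteq> {0}"
    "x \<in> local_criterion.J R N (\<lambda>s. unit_in W (ev y s)) \<rho> i A"
  shows "x \<in> Id i"
proof -
  interpret L: local_criterion R n0 N N "\<lambda>s. unit_in W (ev y s)" \<rho> c l by (rule assms)
  obtain s w where s: "x \<in> L.P" "s \<in> L.P" "unit_in W (ev y s)" "w \<in> gen L.P (\<rho> ` {..<i})" "s * x - w \<in> poly_algebra A N"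
    using assms(4) unfolding L.J_def by blast
  have "s * x - w = 0"
  proof (rule poly_mapping_eqI)
    fix m
    show "lk (s * x - w) m = lk 0 m"
      using s(5) assms(3) by (cases "m \<in> ks (s * x - w)") (auto simp: poly_algebra_iff in_keys_iff)
  qed
  moreover have PP: "L.P \<subseteq> P" using poly_algebra_mono[OF assms(2)] by blast
  ultimately show ?thesis using s gen_mono_ring[OF PP] unfolding Id_def by auto
qed

text \<open>Flatness for the zero coefficient ideal: in a domain the annihilator of \<open>e\<close>
  is zero, so the quotient has no torsion over \<open>V\<close>.\<close>

lemma Id_saturated:
  assumes i: "i \<le> N" and e: "e \<in> V" "e \<noteq> 0" and x: "x \<in> P" "Const e * x \<in> Id i"
  shows "x \<in> Id i"
proof -
  have "Const e * x \<in> P" using x Id_def by blast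
  from Id_approx[OF i, of "{x}" e, OF _ _ e(1) this x(2)] x(1) obtain R
    where R: "local_criterion R (R \<inter> nonunits V) N N (\<lambda>s. unit_in W (ev y s)) \<rho> c l" "R \<subseteq> V" "e \<in> R"
      "x \<in> poly_algebra R N" "Const e * x \<in> local_criterion.J R N (\<lambda>s. unit_in W (ev y s)) \<rho> i {0}" by auto
  interpret L: local_criterion R "R \<inter> nonunits V" N N "\<lambda>s. unit_in W (ev y s)" \<rho> c l by (rule R)
  have "is_ideal R {0}" using subring_set_zero[OF L.sR] by (auto simp: is_ideal_def)
  then have "x \<in> L.J i (L.colon {0} e)" using L.flat_all[OF i] R unfolding L.flat_def by blast
  then show ?thesis using Id_of_J[OF R(1,2), of "L.colon {0} e" x i] e by (auto simp: L.colon_def)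
qed

lemma Id_regular:
  assumes i: "i < N" and x: "x \<in> P" "\<rho> i * x \<in> Id i"
  shows "x \<in> Id i"
proof -
  have "\<rho> i * x \<in> P" using x Id_def by blast
  from Id_approx[of i "{x}" 1, OF _ _ _ _ this x(2)] x(1) i subring_set_one[OF V.V] obtain R
    where R: "local_criterion R (R \<inter> nonunits V) N N (\<lambda>s. unit_in W (ev y s)) \<rho> c l" "R \<subseteq> V"
      "x \<in> poly_algebra R N" "\<rho> i * x \<in> local_criterion.J R N (\<lambda>s. unit_in W (ev y s)) \<rho> i {0}" by auto
  interpret L: local_criterion R "R \<inter> nonunits V" N N "\<lambda>s. unit_in W (ev y s)" \<rho> c l by (rule R)
  have id: "is_ideal R {0}" using subring_set_zero[OF L.sR] by (auto simp: is_ideal_def)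
  have "flat": "L.flat i" using L.flat_all[of i] i by simp
  then have "x \<in> L.J i {0}" using L.nzd_all[OF i "flat" id] R unfolding L.nzd_def by blast
  then show ?thesis using Id_of_J[OF R(1,2), of "{0}" x i] by auto
qed

lemma Id_kernel: "x \<in> P \<Longrightarrow> ev y x = 0 \<longleftrightarrow> x \<in> Id N"
proof
  assume x: "x \<in> P" "ev y x = 0"
  obtain s e where s: "s \<in> P" "e \<in> V" "unit_in W (ev y s)" "e \<noteq> 0" "Const e * (s * x) \<in> gen P (\<rho> ` {..<N})"
    using ker[OF x] by blast
  have sx: "s * x \<in> P" using s x sP subring_set_mult by blast
  have "Const e * (s * x) \<in> Id N" unfolding Id_def
    using s sx sP W.unit_in_1 subring_set_mult[OF sP Const_in[OF s(2)]] by (auto intro!: bexI[of _ 1] simp: ev_hom subring_set_one)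
  then have "s * x \<in> Id N" using Id_saturated[OF order_refl s(2,4) sx] by blast
  then obtain t where t: "t \<in> P" "unit_in W (ev y t)" "t * (s * x) \<in> gen P (\<rho> ` {..<N})" unfolding Id_def by blast
  then have "(t * s) * x \<in> gen P (\<rho> ` {..<N})" by (simp add: mult.assoc)
  moreover have "unit_in W (ev y (t * s))" using s t W.unit_in_mult by (simp add: ev_hom)
  ultimately show "x \<in> Id N" unfolding Id_def using x(1) s(1) t(1) sP subring_set_mult by blast
next
  assume x: "x \<in> P" "x \<in> Id N"
  then obtain s where s: "unit_in W (ev y s)" "s * x \<in> gen P (\<rho> ` {..<N})" unfolding Id_def by blast
  have "ev y w = 0" if "w \<in> gen P (\<rho> ` {..<N})" for w
    using that by induction (auto simp: ev_hom \<rho>_0)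
  then have "ev y (s * x) = 0" using s(2) by blast
  then show "ev y x = 0" using s(1) by (simp add: ev_hom unit_in_def)
qed

text \<open>Each \<open>Id i\<close> is saturated and therefore finitely generated. Multiplying the
  denominators of all generators, over all \<open>i \<le> N\<close>, gives one \<open>h\<close> that
  serves every stage.\<close>

lemma Id_denominator:
  obtains h where "h \<in> P" "unit_in W (ev y h)" "\<And>i x. i \<le> N \<Longrightarrow> x \<in> Id i \<Longrightarrow> h * x \<in> gen P (\<rho> ` {..<i})"
proof -
  have one: "\<exists>s. s \<in> P \<and> unit_in W (ev y s) \<and> (\<forall>x\<in>Id i. s * x \<in> gen P (\<rho> ` {..<i}))" if i: "i \<le> N" for i
  proof -
    obtain S where S: "S \<subseteq> Id i" "finite S" "Id i \<subseteq> gen P S"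
      using V.saturated_ideal_finitely_generated[OF Id_ideal[OF i]] Id_saturated[OF i] by blast
    have "\<forall>x\<in>S. \<exists>s. s \<in> P \<and> unit_in W (ev y s) \<and> s * x \<in> gen P (\<rho> ` {..<i})" using S(1) unfolding Id_def by blast
    then obtain s where s: "\<And>x. x \<in> S \<Longrightarrow> s x \<in> P \<and> unit_in W (ev y (s x)) \<and> s x * x \<in> gen P (\<rho> ` {..<i})" by metis
    define t where "t = prod s S"
    have tP: "t \<in> P" unfolding t_def using s sP by (intro subring_set_prod) auto
    have "unit_in W (ev y (prod s A))" if "A \<subseteq> S" for A
      using finite_subset[OF that S(2)] that
      by (induction A rule: finite_induct) (use s W.unit_in_1 W.unit_in_mult in \<open>auto simp: ev_hom\<close>)
    then have tu: "unit_in W (ev y t)" unfolding t_def by blast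
    have tS: "t * x \<in> gen P (\<rho> ` {..<i})" if "x \<in> S" for x
    proof -
      have "t = s x * prod s (S - {x})" unfolding t_def using S(2) that by (simp add: prod.remove)
      then have "t * x = prod s (S - {x}) * (s x * x)" by (simp add: ac_simps)
      moreover have "prod s (S - {x}) \<in> P" using s sP by (intro subring_set_prod) auto
      ultimately show ?thesis using gen_mult[OF sP] s[OF that] by metis
    qed
    have "t * x \<in> gen P (\<rho> ` {..<i})" if "x \<in> gen P S" for x
      using that
    proof induction
      case (gen_step y r x)
      have "t * (r * x + y) = r * (t * x) + t * y" by (simp add: algebra_simps)
      then show ?case using gen_step gen_mult[OF sP] tS gen_add by metis
    qed (simp add: gen_zero)
    then show ?thesis using tP tu S(3) by blast
  qed
  then obtain s where s: "\<And>i. i \<le> N \<Longrightarrow> s i \<in> P \<and> unit_in W (ev y (s i)) \<and> (\<forall>x\<in>Id i. s i * x \<in> gen P (\<rho> ` {..<i}))"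
    by metis
  define h where "h = prod s {..N}"
  have "h \<in> P" unfolding h_def using s sP by (intro subring_set_prod) auto
  moreover have "unit_in W (ev y (prod s A))" if "A \<subseteq> {..N}" for A
    using finite_subset[OF that] that
    by (induction A rule: infinite_finite_induct) (use s W.unit_in_1 W.unit_in_mult in \<open>auto simp: ev_hom\<close>)
  then have "unit_in W (ev y h)" unfolding h_def by blast
  moreover have "h * x \<in> gen P (\<rho> ` {..<i})" if "i \<le> N" "x \<in> Id i" for i x
  proof -
    have "h = s i * prod s ({..N} - {i})" unfolding h_def using that(1) by (simp add: prod.remove)
    then have "h * x = prod s ({..N} - {i}) * (s i * x)" by (simp add: ac_simps)
    moreover have "prod s ({..N} - {i}) \<in> P" using s sP by (intro subring_set_prod) auto
    ultimately show ?thesis using gen_mult[OF sP] s[OF that(1)] that(2) by metis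
  qed
  ultimately show thesis using that by blast
qed

end

section \<open>Complete intersections from triangular systems\<close>

lemma ambient_simps [simp]:
  "carrier (ambient :: 'b::field ring) = UNIV" "x \<otimes>\<^bsub>ambient\<^esub> y = (x * y :: 'b)"
  "\<one>\<^bsub>ambient\<^esub> = (1 :: 'b)" "\<zero>\<^bsub>ambient\<^esub> = (0 :: 'b)" "x \<oplus>\<^bsub>ambient\<^esub> y = (x + y :: 'b)"
  by (simp_all add: ring_of_type_algebra_def)

lemma ring_ambient: "ring (ambient :: 'b::field ring)"
  by (rule ring_from_type_algebra)

lemma ambient_a_inv [simp]: "\<ominus>\<^bsub>ambient\<^esub> x = (- x :: 'b::field)"
proof -
  interpret ring "ambient :: 'b ring" by (rule ring_ambient)
  show ?thesis by (rule minus_equality) auto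
qed

lemma subring_ambient_iff: "subring S (ambient :: 'b::field ring) \<longleftrightarrow> subring_set S"
proof
  assume S: "subring S ambient"
  show "subring_set S" unfolding subring_set_def
  proof (intro conjI ballI)
    show "1 \<in> S" using subringE(3)[OF S] by simp
    fix x y assume xy: "x \<in> S" "y \<in> S"
    have "- y \<in> S" using subringE(5)[OF S xy(2)] by simp
    then show "x - y \<in> S" using subringE(7)[OF S xy(1), of "- y"] by simp
    show "x * y \<in> S" using subringE(6)[OF S xy] by simp
  qed
next
  assume S: "subring_set S"
  show "subring S ambient"
    by (rule ring.subringI[OF ring_ambient]) (use S in \<open>auto intro: subring_set_intros\<close>)
qed

lemma ring_subalg: "subring_set S \<Longrightarrow> ring (subalg S)"
  by (rule ring.subring_is_ring[OF ring_ambient]) (simp add: subring_ambient_iff)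

lemma a_inv_subalg:
  assumes "subring_set S" "x \<in> S" shows "\<ominus>\<^bsub>subalg S\<^esub> x = (- x :: 'b::field)"
proof -
  interpret ring "subalg S" by (rule ring_subalg[OF assms(1)])
  show ?thesis by (rule minus_equality) (use assms in \<open>auto intro: subring_set_uminus\<close>)
qed

lemma genideal_subalg:
  assumes S: "subring_set S" and T: "T \<subseteq> S"
  shows "Idl\<^bsub>subalg S\<^esub> T = gen S (T :: 'b::field set)"
proof
  interpret ring "subalg S" by (rule ring_subalg[OF S])
  have gm: "a * x \<in> gen S T" if "a \<in> gen S T" "x \<in> S" for a x
    using gen_mult[OF S that(2,1)] by (simp add: mult.commute)
  have "ideal (gen S T) (subalg S)"
  proof (rule idealI[OF ring_subalg[OF S]])
    show "subgroup (gen S T) (add_monoid (subalg S))"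
    proof (rule add.subgroupI)
      show "gen S T \<subseteq> carrier (subalg S)" using gen_subset[OF S T] by simp
      show "gen S T \<noteq> {}" using gen_zero by blast
      show "\<ominus>\<^bsub>subalg S\<^esub> a \<in> gen S T" if "a \<in> gen S T" for a
        using that gen_subset[OF S T] gen_uminus[OF S] a_inv_subalg[OF S] by auto
      show "a \<oplus>\<^bsub>subalg S\<^esub> b \<in> gen S T" if "a \<in> gen S T" "b \<in> gen S T" for a b
        using that gen_add by auto
    qed
  qed (use gm gen_mult[OF S] in auto)
  moreover have "T \<subseteq> gen S T" using gen_base[OF S] by blast
  ultimately show "Idl\<^bsub>subalg S\<^esub> T \<subseteq> gen S T" unfolding genideal_def by blast
  show "gen S T \<subseteq> Idl\<^bsub>subalg S\<^esub> T"
    unfolding genideal_def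
  proof (rule Inter_greatest, clarify)
    fix I x assume I: "ideal I (subalg S)" "T \<subseteq> I" and x: "x \<in> gen S T"
    interpret I: ideal I "subalg S" by (rule I)
    from x show "x \<in> I"
    proof induction
      case gen_zero
      then show ?case using I.zero_closed by simp
    next
      case (gen_step y r x)
      then have "r * x \<in> I" using I.I_l_closed[of x r] I(2) by auto
      then show ?case using I.a_closed[of "r * x" y] gen_step by simp
    qed
  qed
qed

context ci_data
begin

text \<open>The subalgebra is the image of the localization at \<open>h\<close> under evaluation at
  \<open>y\<close>; it stays in \<open>W\<close> because \<open>h\<close> is a unit there.\<close>

theorem complete_intersection:
  obtains A where "A \<subseteq> W" "complete_intersection_subalgebra V A" "ev y ` P \<subseteq> A"
proof -
  obtain h where h: "h \<in> P" "unit_in W (ev y h)" "\<And>i x. i \<le> N \<Longrightarrow> x \<in> Id i \<Longrightarrow> h * x \<in> gen P (\<rho> ` {..<i})"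
    using Id_denominator by blast
  have h0: "h \<noteq> 0" using h(2) by (auto simp: ev_hom unit_in_def)
  then have hk: "h ^ k \<noteq> 0" for k by simp
  have hkP: "h ^ k \<in> P" for k using h(1) sP subring_set_power by blast
  have uk: "unit_in W (ev y (h ^ k))" for k using h(2) W.unit_in_power by (simp add: ev_hom)
  define G where "G = poly_localization V N h"
  have Gi: "Fract p (h ^ k) \<in> G" if "p \<in> P" for p k
    using that unfolding G_def poly_localization_def by blast
  have Ge: "\<exists>p k. p \<in> P \<and> a = Fract p (h ^ k)" if "a \<in> G" for a
    using that unfolding G_def poly_localization_def by blast
  have addF: "Fract p (h ^ k) + Fract q (h ^ j) = Fract (p * h ^ j + q * h ^ k) (h ^ (k + j))" for p q k j
    using hk by (simp add: power_add)
  have diffF: "Fract p (h ^ k) - Fract q (h ^ j) = Fract (p * h ^ j - q * h ^ k) (h ^ (k + j))" for p q k j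
    using hk by (simp add: power_add)
  have multF: "Fract p (h ^ k) * Fract q (h ^ j) = Fract (p * q) (h ^ (k + j))" for p q k j
    by (simp add: power_add)
  have oneF: "1 = Fract 1 (h ^ 0)" by (simp add: One_fract_def)
  have sG: "subring_set G"
    unfolding subring_set_def
  proof (intro conjI ballI)
    show "1 \<in> G" unfolding oneF by (rule Gi) (use sP subring_set_one in blast)
    fix a b assume "a \<in> G" "b \<in> G"
    then obtain p k q j where "p \<in> P" "a = Fract p (h ^ k)" "q \<in> P" "b = Fract q (h ^ j)" using Ge by blast
    moreover from this have "p * h ^ j - q * h ^ k \<in> P" "p * q \<in> P"
      by (intro subring_set_diff[OF sP] subring_set_mult[OF sP] hkP; simp)+
    ultimately show "a - b \<in> G" "a * b \<in> G" using Gi by (simp_all only: diffF multF)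
  qed
  \<comment> \<open>Evaluation of a fraction, by unique description; the value is independent of the
    representation since \<open>h\<close> does not vanish at \<open>y\<close>.\<close>
  define \<phi> where "\<phi> a = (THE v. \<exists>p k. p \<in> P \<and> a = Fract p (h ^ k) \<and> v = ev y p / ev y h ^ k)" for a
  have evh: "ev y h \<noteq> 0" using h(2) by (simp add: unit_in_def)
  have \<phi>: "\<phi> (Fract p (h ^ k)) = ev y p / ev y h ^ k" if "p \<in> P" for p k
    unfolding \<phi>_def
  proof (rule the_equality)
    fix v assume "\<exists>p' k'. p' \<in> P \<and> Fract p (h ^ k) = Fract p' (h ^ k') \<and> v = ev y p' / ev y h ^ k'"
    then obtain p' k' where p': "Fract p (h ^ k) = Fract p' (h ^ k')" "v = ev y p' / ev y h ^ k'" by blast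
    then have "p * h ^ k' = p' * h ^ k" using hk by (simp add: eq_fract)
    then have "ev y (p * h ^ k') = ev y (p' * h ^ k)" by simp
    then show "v = ev y p / ev y h ^ k" using evh by (simp add: p' ev_hom field_simps)
  qed (use that in blast)
  define R' where "R' i = Fract (\<rho> i) (h ^ 0)" for i
  have R'G: "R' i \<in> G" if "i < N" for i unfolding R'_def using Gi \<rho>_in that by blast
  have R'sub: "R' ` {..<i} \<subseteq> G" if "i \<le> N" for i using R'G that by auto
  \<comment> \<open>Inverting \<open>h\<close> alone already gives what the full local ring at
    \<open>y\<close> gives: \<open>h\<close> clears the denominators of \<open>Id i\<close>, and
    conversely its powers are admissible denominators there.\<close>
  have gen_iff: "Fract p (h ^ k) \<in> gen G (R' ` {..<i}) \<longleftrightarrow> p \<in> Id i" if i: "i \<le> N" and p: "p \<in> P" for p k i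
  proof
    have repr: "\<exists>w j. w \<in> gen P (\<rho> ` {..<i}) \<and> a = Fract w (h ^ j)" if "a \<in> gen G (R' ` {..<i})" for a
      using that
    proof induction
      case gen_zero
      then show ?case using gen.gen_zero by (intro exI[of _ 0]) (auto simp: Zero_fract_def)
    next
      case (gen_step b r x)
      then obtain w j m where w: "w \<in> gen P (\<rho> ` {..<i})" "b = Fract w (h ^ j)" and m: "m < i" "x = R' m" by blast
      obtain q k where q: "q \<in> P" "r = Fract q (h ^ k)" using Ge gen_step by blast
      have "r * x + b = Fract (q * \<rho> m * h ^ j + w * h ^ k) (h ^ (k + j))"
        unfolding w(2) q(2) m(2) R'_def multF by (simp only: add_0_right addF)
      moreover have "(h ^ j * q) * \<rho> m + h ^ k * w \<in> gen P (\<rho> ` {..<i})"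
        using hkP q(1) w(1) m(1) sP by (intro gen_add gen_base_mult gen_mult[OF sP] subring_set_mult) auto
      ultimately show ?case by (intro exI[of _ "q * \<rho> m * h ^ j + w * h ^ k"] exI[of _ "k + j"]) (simp add: ac_simps)
    qed
    assume "Fract p (h ^ k) \<in> gen G (R' ` {..<i})"
    then obtain w j where w: "w \<in> gen P (\<rho> ` {..<i})" "Fract p (h ^ k) = Fract w (h ^ j)" using repr by blast
    then have "h ^ j * p = h ^ k * w" using hk by (simp add: eq_fract mult.commute)
    then have "h ^ j * p \<in> gen P (\<rho> ` {..<i})" using gen_mult[OF sP hkP w(1)] by simp
    then show "p \<in> Id i" unfolding Id_def using p uk hkP by blast
  next
    have emb: "Fract w (h ^ 0) \<in> gen G (R' ` {..<i})" if "w \<in> gen P (\<rho> ` {..<i})" for w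
      using that
    proof induction
      case gen_zero
      then show ?case using gen.gen_zero[of G "R' ` {..<i}"] by (simp add: Zero_fract_def)
    next
      case (gen_step b r x)
      then obtain m where m: "m < i" "x = \<rho> m" by blast
      have "Fract (r * x + b) (h ^ 0) = Fract r (h ^ 0) * R' m + Fract b (h ^ 0)"
        unfolding R'_def multF addF m(2) by simp
      moreover have "R' m \<in> R' ` {..<i}" using m(1) by simp
      ultimately show ?case using gen.gen_step[OF gen_step.IH Gi[OF gen_step(2), of 0], of "R' m"] by (simp only:)
    qed
    assume "p \<in> Id i"
    then have "h * p \<in> gen P (\<rho> ` {..<i})" using h(3) i by blast
    from gen_mult[OF sG Gi[of 1 "Suc k"] emb[OF this]]
    have "Fract 1 (h ^ Suc k) * Fract (h * p) (h ^ 0) \<in> gen G (R' ` {..<i})" using sP subring_set_one by blast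
    moreover have "Fract 1 (h ^ Suc k) * Fract (h * p) (h ^ 0) = Fract p (h ^ k)"
      unfolding multF using hk[of k] h0 by (simp add: eq_fract mult.commute)
    ultimately show "Fract p (h ^ k) \<in> gen G (R' ` {..<i})" by simp
  qed
  define ps where "ps = map R' [0..<N]"
  have set_take: "set (take i ps) = R' ` {..<i}" if "i \<le> N" for i
    using that by (simp add: ps_def take_map atLeast0LessThan)
  have set_ps: "set ps = R' ` {..<N}" using set_take[of N] by (simp add: ps_def)
  have Idl: "Idl\<^bsub>subalg G\<^esub> (R' ` {..<i}) = gen G (R' ` {..<i})" if "i \<le> N" for i
    using genideal_subalg[OF sG R'sub[OF that]] .
  have reg: "regular_sequence (subalg G) ps"
    unfolding regular_sequence_def
  proof (intro conjI allI impI ballI)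
    show "set ps \<subseteq> carrier (subalg G)" using R'sub set_ps by auto
    show "Idl\<^bsub>subalg G\<^esub> (set ps) \<noteq> carrier (subalg G)"
    proof
      assume "Idl\<^bsub>subalg G\<^esub> (set ps) = carrier (subalg G)"
      then have "1 \<in> gen G (R' ` {..<N})" using Idl[of N] set_ps subring_set_one[OF sG] by simp
      then have "1 \<in> Id N" unfolding oneF using gen_iff[of N 1 0] sP subring_set_one by blast
      then show False using Id_kernel[of 1] sP subring_set_one by (auto simp: ev_hom)
    qed
    fix i a assume i: "i < length ps" and a: "a \<in> carrier (subalg G)"
      and *: "ps ! i \<otimes>\<^bsub>subalg G\<^esub> a \<in> Idl\<^bsub>subalg G\<^esub> (set (take i ps))"
    have iN: "i < N" using i by (simp add: ps_def)
    have aG: "a \<in> G" using a by simp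
    obtain p k where p: "p \<in> P" "a = Fract p (h ^ k)" using Ge[OF aG] by blast
    have "Fract (\<rho> i * p) (h ^ k) \<in> gen G (R' ` {..<i})"
      using * iN set_take[of i] Idl[of i] multF[of "\<rho> i" 0 p k] by (simp add: ps_def p R'_def)
    then have "\<rho> i * p \<in> Id i" using gen_iff[of i "\<rho> i * p" k] iN p(1) \<rho>_in sP subring_set_mult by auto
    then have "p \<in> Id i" using Id_regular iN p(1) by blast
    then have "a \<in> gen G (R' ` {..<i})" using gen_iff[of i p k] iN p by simp
    then show "a \<in> Idl\<^bsub>subalg G\<^esub> (set (take i ps))" using iN set_take[of i] Idl[of i] by simp
  qed
  define A where "A = \<phi> ` G"
  have hom: "ring_hom_ring (subalg G) ambient \<phi>"
  proof (rule ring_hom_ringI[OF ring_subalg[OF sG] ring_ambient])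
    have one: "\<phi> 1 = 1" unfolding oneF using \<phi>[of 1 0] sP subring_set_one by (auto simp: ev_hom)
    then show "\<phi> \<one>\<^bsub>subalg G\<^esub> = \<one>\<^bsub>ambient\<^esub>" by simp
    fix a b assume "a \<in> carrier (subalg G)" "b \<in> carrier (subalg G)"
    then have "a \<in> G" "b \<in> G" by simp_all
    then obtain p k q j where pq: "p \<in> P" "a = Fract p (h ^ k)" "q \<in> P" "b = Fract q (h ^ j)"
      using Ge[of a] Ge[of b] by blast
    have "p * q \<in> P" "p * h ^ j + q * h ^ k \<in> P"
      using pq by (intro subring_set_add[OF sP] subring_set_mult[OF sP] hkP; simp)+
    then have 1: "\<phi> (a * b) = ev y (p * q) / ev y h ^ (k + j)"
        "\<phi> (a + b) = ev y (p * h ^ j + q * h ^ k) / ev y h ^ (k + j)"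
      unfolding pq(2,4) multF addF by (auto intro: \<phi>)
    have 2: "\<phi> a = ev y p / ev y h ^ k" "\<phi> b = ev y q / ev y h ^ j"
      using pq \<phi> by auto
    show "\<phi> (a \<otimes>\<^bsub>subalg G\<^esub> b) = \<phi> a \<otimes>\<^bsub>ambient\<^esub> \<phi> b" "\<phi> (a \<oplus>\<^bsub>subalg G\<^esub> b) = \<phi> a \<oplus>\<^bsub>ambient\<^esub> \<phi> b"
      using evh by (simp_all add: 1 2 ev_hom power_add field_simps)
  qed simp
  interpret hom: ring_hom_ring "subalg G" ambient \<phi> by (rule hom)
  have kernel: "a_kernel (subalg G) ambient \<phi> = Idl\<^bsub>subalg G\<^esub> (set ps)"
  proof -
    have "a \<in> gen G (R' ` {..<N}) \<longleftrightarrow> a \<in> G \<and> \<phi> a = 0" for a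
    proof (cases "a \<in> G")
      case True
      then obtain p k where p: "p \<in> P" "a = Fract p (h ^ k)" using Ge by blast
      have "\<phi> a = 0 \<longleftrightarrow> ev y p = 0" unfolding p(2) \<phi>[OF p(1)] using evh by simp
      also have "\<dots> \<longleftrightarrow> a \<in> gen G (R' ` {..<N})" using Id_kernel[OF p(1)] gen_iff[of N p k] p by simp
      finally show ?thesis using True by simp
    next
      case False
      then show ?thesis using gen_subset[OF sG R'sub[of N]] by auto
    qed
    then show ?thesis unfolding set_ps Idl[OF order_refl] a_kernel_def' by auto
  qed
  have constG: "const_fract c \<in> G" "\<phi> (const_fract c) = c" if "c \<in> V" for c
  proof -
    have cc: "const_fract c = Fract (Const c) (h ^ 0)" by (simp add: const_fract_def Const_def)
    show "const_fract c \<in> G" unfolding cc using Gi Const_in that by blast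
    show "\<phi> (const_fract c) = c" unfolding cc using \<phi>[OF Const_in[OF that], of 0] by (simp add: ev_hom)
  qed
  have iso: "(\<lambda>Y. the_elem (\<phi> ` Y)) \<in> ring_iso (subalg G Quot (Idl\<^bsub>subalg G\<^esub> (set ps))) (subalg A)"
    using hom.FactRing_iso_set_aux unfolding kernel A_def by simp
  have coset: "the_elem (\<phi> ` ((Idl\<^bsub>subalg G\<^esub> (set ps)) +>\<^bsub>subalg G\<^esub> const_fract c)) = c" if "c \<in> V" for c
    using hom.the_elem_simp[of "const_fract c"] constG[OF that] unfolding kernel by simp
  have sA: "subring_set A"
    using hom.img_is_subring[OF ring.carrier_is_subring[OF ring_subalg[OF sG]]]
    unfolding A_def subring_ambient_iff by simp
  have VA: "V \<subseteq> A" unfolding A_def using constG by (metis image_eqI subsetI)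
  have "A \<subseteq> W"
  proof
    fix v assume "v \<in> A"
    then obtain a where "a \<in> G" "v = \<phi> a" unfolding A_def by blast
    then obtain p k where p: "p \<in> P" "v = ev y p / ev y h ^ k" using Ge \<phi> by blast
    have "inverse (ev y h ^ k) \<in> W" using uk[of k] by (simp add: ev_hom unit_in_def)
    then show "v \<in> W" unfolding p(2) divide_inverse using ev_in[OF p(1)] W.V subring_set_mult by blast
  qed
  moreover have "complete_intersection_subalgebra V A"
    unfolding complete_intersection_subalgebra_def Let_def
    using sA VA h(1) h0 reg iso coset unfolding G_def
    by (auto simp: subring_ambient_iff intro!: exI[of _ N] exI[of _ h] exI[of _ ps] bexI[of _ "\<lambda>Y. the_elem (\<phi> ` Y)"])
  moreover have "ev y ` P \<subseteq> A"
  proof clarify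
    fix p assume "p \<in> P"
    then have "Fract p (h ^ 0) \<in> G" "\<phi> (Fract p (h ^ 0)) = ev y p" 
      using Gi[of p 0] \<phi>[of p 0] by simp_all
    then show "ev y p \<in> A" unfolding A_def by (metis image_eqI)
  qed
  ultimately show thesis using that by blast
qed

end

section \<open>Polynomials over an intermediate field and chains of approximations\<close>

definition polys_over :: "'a::field set \<Rightarrow> 'a poly set" where
  "polys_over F = {p. \<forall>i. coeff p i \<in> F}"

lemma polys_over_sring: "subring_set F \<Longrightarrow> subring_set (polys_over F)"
  unfolding subring_set_def[of "polys_over F"]
proof (intro conjI ballI)
  assume F: "subring_set F"
  show "1 \<in> polys_over F" using F by (auto simp: polys_over_def intro: subring_set_intros)
  fix p q assume "p \<in> polys_over F" "q \<in> polys_over F"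
  then show "p - q \<in> polys_over F" "p * q \<in> polys_over F" using F
    by (auto simp: polys_over_def coeff_mult intro!: subring_set_sum subring_set_intros)
qed

lemma polys_over_const: "0 \<in> F \<Longrightarrow> a \<in> F \<Longrightarrow> [:a:] \<in> polys_over F"
  by (auto simp: polys_over_def coeff_pCons split: nat.splits)

lemma polys_over_monom: "0 \<in> F \<Longrightarrow> a \<in> F \<Longrightarrow> monom a n \<in> polys_over F"
  by (auto simp: polys_over_def)

lemma polys_over_smult: "subring_set F \<Longrightarrow> a \<in> F \<Longrightarrow> p \<in> polys_over F \<Longrightarrow> smult a p \<in> polys_over F"
  by (auto simp: polys_over_def intro: subring_set_mult)

lemma polys_over_coeff: "p \<in> polys_over F \<Longrightarrow> coeff p i \<in> F"
  by (auto simp: polys_over_def)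

lemma polys_over_eval:
  assumes "subring_set S" "F \<subseteq> S" "z \<in> S" "p \<in> polys_over F"
  shows "poly p z \<in> S"
  unfolding poly_altdef
  by (intro subring_set_sum[OF assms(1)] subring_set_mult[OF assms(1)] subring_set_power[OF assms(1)] assms(3) subsetD[OF assms(2)]
      polys_over_coeff[OF assms(4)])

lemma polys_over_division:
  assumes F: "subring_set F" and t: "t \<in> polys_over F" "lead_coeff t = 1"
  shows "q \<in> polys_over F \<Longrightarrow> \<exists>h\<in>polys_over F. \<exists>r\<in>polys_over F. q = t * h + r \<and> (r = 0 \<or> degree r < degree t)"
proof (induction "degree q" arbitrary: q rule: less_induct)
  case less
  note subring_polys_over = polys_over_sring[OF F]
  show ?case
  proof (cases "q = 0 \<or> degree q < degree t")
    case True
    then show ?thesis using less(2) subring_polys_over subring_set_zero[OF subring_polys_over]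
      by (intro bexI[of _ 0] bexI[of _ q]) auto
  next
    case False
    define w where "w = monom (lead_coeff q) (degree q - degree t)"
    have w: "w \<in> polys_over F" unfolding w_def using less(2) F by (auto intro: polys_over_monom polys_over_coeff subring_set_zero)
    define q' where "q' = q - t * w"
    have q': "q' \<in> polys_over F" unfolding q'_def using less(2) w t subring_polys_over by (intro subring_set_diff subring_set_mult)
    have t0: "t \<noteq> 0" using t(2) by auto
    have w0: "w \<noteq> 0" using False by (auto simp: w_def)
    have dl: "degree w = degree q - degree t" "lead_coeff w = lead_coeff q"
      using False by (auto simp: w_def degree_monom_eq)
    have dw: "degree (t * w) = degree q" using False t0 w0 dl by (simp add: degree_mult_eq)
    have lw: "lead_coeff (t * w) = lead_coeff q" using t(2) dl(2) by (simp only: lead_coeff_mult) simp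
    have "degree q' \<le> degree q" unfolding q'_def by (rule degree_diff_le) (use dw in auto)
    moreover have "coeff q' (degree q) = 0" unfolding q'_def using lw by (simp add: dw)
    ultimately have "q' = 0 \<or> degree q' < degree q" by (metis le_neq_implies_less leading_coeff_0_iff)
    then have "\<exists>h\<in>polys_over F. \<exists>r\<in>polys_over F. q' = t * h + r \<and> (r = 0 \<or> degree r < degree t)"
    proof
      assume "q' = 0"
      then show ?thesis using subring_set_zero[OF subring_polys_over] by (intro bexI[of _ 0]) auto
    next
      assume "degree q' < degree q"
      then show ?thesis using less(1) q' by blast
    qed
    then obtain h r where h: "h \<in> polys_over F" "r \<in> polys_over F" "q' = t * h + r" "r = 0 \<or> degree r < degree t" by blast
    have "q = t * (w + h) + r" using h(3) by (simp add: q'_def algebra_simps)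
    then show ?thesis using h w subring_polys_over subring_set_add by blast
  qed
qed

text \<open>The digits of \<open>q\<close> in base \<open>t\<close>, by repeated division.
  \<open>d\<close> is any bound of the degree of \<open>q\<close>, and each division lowers it by at
  least one.\<close>

lemma polys_over_expansion:
  assumes F: "subring_set F" and t: "t \<in> polys_over F" "lead_coeff t = 1" "degree t \<ge> 1"
  shows "q \<in> polys_over F \<Longrightarrow> degree q \<le> d \<Longrightarrow>
    \<exists>a. (\<forall>j. a j \<in> polys_over F \<and> degree (a j) < degree t) \<and> q = (\<Sum>j\<le>d. a j * t ^ j)"
proof (induction d arbitrary: q)
  case 0
  then show ?case using t(3) by (intro exI[of _ "\<lambda>_. q"]) auto
next
  case (Suc d)
  obtain h r where h: "h \<in> polys_over F" "r \<in> polys_over F" "q = t * h + r" "r = 0 \<or> degree r < degree t"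
    using polys_over_division[OF F t(1,2) Suc(2)] by blast
  have r: "degree r < degree t" using h(4) t(3) by auto
  have "degree h \<le> d"
  proof (cases "h = 0")
    case False
    have t0: "t \<noteq> 0" using t(2) by auto
    have "degree (t * h) = degree t + degree h" using False t0 by (simp add: degree_mult_eq)
    moreover have "degree q = degree (t * h)"
      unfolding h(3) by (rule degree_add_eq_left) (use r calculation in simp)
    ultimately show ?thesis using Suc(3) t(3) by simp
  qed simp
  then obtain a where a: "\<forall>j. a j \<in> polys_over F \<and> degree (a j) < degree t" "h = (\<Sum>j\<le>d. a j * t ^ j)"
    using Suc(1)[OF h(1)] by blast
  let ?a = "\<lambda>j. case j of 0 \<Rightarrow> r | Suc i \<Rightarrow> a i"
  have "q = (\<Sum>j\<le>Suc d. ?a j * t ^ j)"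
    unfolding sum.atMost_Suc_shift h(3) a(2) by (simp add: sum_distrib_left ac_simps)
  then show ?case using a(1) h(2) r by (intro exI[of _ ?a]) (auto split: nat.splits)
qed

lemma Const_power: "Const (a ^ n) = (Const a :: 'a::comm_ring_1 mpoly) ^ n"
  by (induction n) (simp_all add: Const_hom)

definition subfield_set :: "'a::field set \<Rightarrow> bool" where
  "subfield_set F \<longleftrightarrow> subring_set F \<and> (\<forall>x\<in>F. inverse x \<in> F)"

lemma subfield_set_sring: "subfield_set F \<Longrightarrow> subring_set F"
  and subfield_set_inverse: "subfield_set F \<Longrightarrow> x \<in> F \<Longrightarrow> inverse x \<in> F"
  by (auto simp: subfield_set_def)

lemma subfield_set_divide: "subfield_set F \<Longrightarrow> x \<in> F \<Longrightarrow> y \<in> F \<Longrightarrow> x / y \<in> F"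
  by (simp add: divide_inverse subfield_set_inverse subfield_set_sring subring_set_mult)

lemma fraction_field_I: "a \<in> V \<Longrightarrow> b \<in> V \<Longrightarrow> b \<noteq> 0 \<Longrightarrow> a / b \<in> fraction_field V"
  unfolding fraction_field_def by blast

lemma fraction_field_sfield: assumes "subring_set V" shows "subfield_set (fraction_field V)"
  unfolding subfield_set_def subring_set_def
proof (intro conjI ballI)
  show "1 \<in> fraction_field V" using fraction_field_I[of 1 V 1] subring_set_one[OF assms] by simp
  fix x assume "x \<in> fraction_field V"
  then obtain a b where a: "a \<in> V" "b \<in> V" "b \<noteq> 0" "x = a / b" unfolding fraction_field_def by blast
  show "inverse x \<in> fraction_field V"
    using fraction_field_I[of b V a] fraction_field_I[of 0 V b] a subring_set_zero[OF assms] by (cases "a = 0") auto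
  fix y assume "y \<in> fraction_field V"
  then obtain c d where c: "c \<in> V" "d \<in> V" "d \<noteq> 0" "y = c / d" unfolding fraction_field_def by blast
  have "x - y = (a * d - c * b) / (b * d)" "x * y = (a * c) / (b * d)" using a c by (auto simp: field_simps)
  moreover have "a * d - c * b \<in> V" "a * c \<in> V" "b * d \<in> V" using a c assms by (auto intro: subring_set_intros)
  ultimately show "x - y \<in> fraction_field V" "x * y \<in> fraction_field V"
    using fraction_field_I[of _ V "b * d"] a(3) c(3) by auto
qed

lemma fraction_field_superset: "subring_set V \<Longrightarrow> V \<subseteq> fraction_field V"
  using fraction_field_I[of _ V 1] subring_set_one[of V] by auto

text \<open>Surjectivity of the maps on value groups and residue fields, expressed by
  representatives in \<open>K\<close> and in \<open>V\<close>.\<close>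

locale immediate = local_pair V W for V W :: "'a::field set" +
  assumes value_rep: "\<And>x. x \<in> fraction_field W \<Longrightarrow> x \<noteq> 0 \<Longrightarrow> \<exists>b\<in>fraction_field V. b \<noteq> 0 \<and> unit_in W (x / b)"
    and residue_rep: "\<And>u. u \<in> W \<Longrightarrow> \<exists>c\<in>V. u - c \<in> nonunits W"
begin

abbreviation "K \<equiv> fraction_field V"
abbreviation "K' \<equiv> fraction_field W"

lemma K: "subfield_set K" and K': "subfield_set K'"
  using fraction_field_sfield V.V W.V by auto

lemma VK: "V \<subseteq> K" and WK': "W \<subseteq> K'"
  using fraction_field_superset V.V W.V by auto

lemma K_val: "x \<in> K \<Longrightarrow> x \<noteq> 0 \<Longrightarrow> x \<in> V \<or> inverse x \<in> V"
  unfolding fraction_field_def using V.val by force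

lemma K_cases: "x \<in> K \<Longrightarrow> x \<noteq> 0 \<Longrightarrow> x \<in> V \<or> inverse x \<in> nonunits V"
  using K_val[of x] by (auto simp: nonunits_def unit_in_def)

lemma K'_val: "x \<in> K' \<Longrightarrow> x \<noteq> 0 \<Longrightarrow> x \<in> W \<or> inverse x \<in> nonunits W"
proof -
  assume "x \<in> K'" "x \<noteq> 0"
  then have "x \<in> W \<or> inverse x \<in> W" unfolding fraction_field_def using W.val by force
  then show ?thesis by (auto simp: nonunits_def unit_in_def)
qed

text \<open>An element of \<open>K\<close> outside \<open>V\<close> has an inverse that is a
  non-unit of \<open>V\<close>, hence of \<open>W\<close> by locality; so it cannot lie in
  \<open>W\<close>.\<close>

lemma K_W: "x \<in> K \<Longrightarrow> x \<in> W \<Longrightarrow> x \<in> V"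
proof (cases "x = 0")
  case False
  assume x: "x \<in> K" "x \<in> W"
  show ?thesis
  proof (rule ccontr)
    assume "x \<notin> V"
    then have "inverse x \<in> nonunits V" using K_cases x False by blast
    then have "inverse x \<in> nonunits W" using nonunits_VW by blast
    then show False using x False by (auto simp: nonunits_def unit_in_def)
  qed
qed (use V.V subring_set_zero in auto)

lemma K_num_den:
  assumes "x \<in> K" "x \<noteq> 0"
  obtains a b where "a \<in> V" "b \<in> V" "a \<noteq> 0" "b \<noteq> 0" "x = a / b"
  using assms unfolding fraction_field_def by auto

lemma KK': "K \<subseteq> K'"
  unfolding fraction_field_def using VW by blast

end

section \<open>Systems of polynomials over an intermediate field F, for a next element z\<close>

locale poly_system = immediate V W for V W :: "'a::field set" +
  fixes F :: "'a set" and z :: 'a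
  assumes F: "subfield_set F" and KF: "K \<subseteq> F" and FK': "F \<subseteq> K'" and z: "z \<in> K'"
begin

abbreviation pe :: "(nat \<Rightarrow> 'a poly) \<Rightarrow> 'a mpoly \<Rightarrow> 'a poly" where "pe \<equiv> eval_mpoly (\<lambda>a. [:a:])"

lemmas pe_hom = eval_mpoly_add[OF is_ring_hom_pconst] eval_mpoly_mult[OF is_ring_hom_pconst] eval_mpoly_Const[OF is_ring_hom_pconst] eval_mpoly_Var[OF is_ring_hom_pconst]
  eval_mpoly_1[OF is_ring_hom_pconst] eval_mpoly_0 eval_mpoly_uminus[OF is_ring_hom_pconst] eval_mpoly_diff[OF is_ring_hom_pconst] eval_mpoly_power[OF is_ring_hom_pconst] eval_mpoly_sum[OF is_ring_hom_pconst]

lemma VF: "V \<subseteq> F" using VK KF by blast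

lemma subring_F: "subring_set F" using F subfield_set_sring by blast
lemma subring_polys_over: "subring_set (polys_over F)" using subring_F polys_over_sring by blast

lemma polys_over_constant: "a \<in> F \<Longrightarrow> [:a:] \<in> polys_over F" using polys_over_const subring_F subring_set_zero by blast

lemma poly_pe: "poly (pe T x) z = ev (\<lambda>i. poly (T i) z) x"
proof -
  have "is_ring_hom (\<lambda>p. poly p z)" by (simp add: is_ring_hom_def)
  from eval_mpoly_comp[OF is_ring_hom_pconst this] show ?thesis by simp
qed

lemma pe_cong: "x \<in> poly_algebra V n \<Longrightarrow> (\<And>i. i < n \<Longrightarrow> T i = T' i) \<Longrightarrow> pe T x = pe T' x"
  by (rule eval_mpoly_cong)

lemma polys_over_eval_K': "g \<in> polys_over F \<Longrightarrow> poly g z \<in> K'"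
  using polys_over_eval[of K' F z g] K' subfield_set_sring FK' z by blast

text \<open>The ideal of the first \<open>r\<close> relations after localizing at \<open>z\<close>
  and inverting the nonzero scalars of \<open>V\<close>. Scalars cancel here by construction; that
  they cancel without being inverted is \<open>Id_saturated\<close>.\<close>

definition local_kernel :: "nat \<Rightarrow> (nat \<Rightarrow> 'a poly) \<Rightarrow> nat \<Rightarrow> (nat \<Rightarrow> 'a mpoly) \<Rightarrow> 'a mpoly set" where
  "local_kernel N T r \<rho> = {x \<in> poly_algebra V N. \<exists>s\<in>poly_algebra V N. \<exists>e\<in>V. unit_in W (poly (pe T s) z) \<and> e \<noteq> 0 \<and>
     Const e * (s * x) \<in> gen (poly_algebra V N) (\<rho> ` {..<r})}"

lemma local_kernel_I: "x \<in> poly_algebra V N \<Longrightarrow> s \<in> poly_algebra V N \<Longrightarrow> e \<in> V \<Longrightarrow> unit_in W (poly (pe T s) z) \<Longrightarrow> e \<noteq> 0 \<Longrightarrow>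
     Const e * (s * x) \<in> gen (poly_algebra V N) (\<rho> ` {..<r}) \<Longrightarrow> x \<in> local_kernel N T r \<rho>"
  unfolding local_kernel_def by blast

lemma local_kernel_ideal: "is_ideal (poly_algebra V N) (local_kernel N T r \<rho>)"
  unfolding is_ideal_def
proof (intro conjI ballI)
  let ?P = "poly_algebra V N"
  note sP = V.sPV[of N]
  show "0 \<in> local_kernel N T r \<rho>"
    by (rule local_kernel_I[of _ _ 1 1]) (use sP V.V W.unit_in_1 in \<open>auto simp: pe_hom gen_zero intro: subring_set_intros\<close>)
  show "local_kernel N T r \<rho> \<subseteq> ?P" by (auto simp: local_kernel_def)
  fix x assume "x \<in> local_kernel N T r \<rho>"
  then obtain s e where s: "x \<in> ?P" "s \<in> ?P" "e \<in> V" "unit_in W (poly (pe T s) z)" "e \<noteq> 0"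
    "Const e * (s * x) \<in> gen ?P (\<rho> ` {..<r})" unfolding local_kernel_def by blast
  show "x + y \<in> local_kernel N T r \<rho>" if "y \<in> local_kernel N T r \<rho>" for y
  proof -
    obtain t d where t: "y \<in> ?P" "t \<in> ?P" "d \<in> V" "unit_in W (poly (pe T t) z)" "d \<noteq> 0"
      "Const d * (t * y) \<in> gen ?P (\<rho> ` {..<r})" using \<open>y \<in> local_kernel N T r \<rho>\<close> unfolding local_kernel_def by blast
    have "(Const d * t) * (Const e * (s * x)) + (Const e * s) * (Const d * (t * y)) \<in> gen ?P (\<rho> ` {..<r})"
      by (rule gen_add[OF gen_mult[OF sP _ s(6)] gen_mult[OF sP _ t(6)]])
        (use s t Const_in sP in \<open>auto intro: subring_set_mult\<close>)
    then have "Const (e * d) * ((s * t) * (x + y)) \<in> gen ?P (\<rho> ` {..<r})"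
      by (simp add: Const_hom algebra_simps)
    moreover have "unit_in W (poly (pe T (s * t)) z)" using s t W.unit_in_mult by (simp add: pe_hom)
    ultimately show ?thesis
      by (intro local_kernel_I[of _ _ "s * t" "e * d"]) (use s t sP V.V in \<open>auto intro: subring_set_intros\<close>)
  qed
  show "q * x \<in> local_kernel N T r \<rho>" if "q \<in> ?P" for q
  proof -
    have "q * (Const e * (s * x)) \<in> gen ?P (\<rho> ` {..<r})" using s that gen_mult[OF sP] by blast
    then have "Const e * (s * (q * x)) \<in> gen ?P (\<rho> ` {..<r})" by (simp add: algebra_simps)
    then show ?thesis by (intro local_kernel_I[of _ _ s e]) (use s that sP in \<open>auto intro: subring_set_intros\<close>)
  qed
qed

lemmas local_kernelD = is_idealD[OF local_kernel_ideal]

lemma local_kernel_cancel: "x \<in> poly_algebra V N \<Longrightarrow> a \<in> V \<Longrightarrow> a \<noteq> 0 \<Longrightarrow> Const a * x \<in> local_kernel N T r \<rho> \<Longrightarrow> x \<in> local_kernel N T r \<rho>"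
proof -
  assume x: "x \<in> poly_algebra V N" "a \<in> V" "a \<noteq> 0" "Const a * x \<in> local_kernel N T r \<rho>"
  then obtain s e where s: "s \<in> poly_algebra V N" "e \<in> V" "unit_in W (poly (pe T s) z)" "e \<noteq> 0"
    "Const e * (s * (Const a * x)) \<in> gen (poly_algebra V N) (\<rho> ` {..<r})" unfolding local_kernel_def by blast
  then have "Const (e * a) * (s * x) \<in> gen (poly_algebra V N) (\<rho> ` {..<r})"
    by (simp add: Const_hom algebra_simps)
  then show ?thesis using s x V.V by (auto intro!: local_kernel_I[of _ _ s "e * a"] intro: subring_set_mult)
qed

lemma local_kernel_mono:
  assumes "N \<le> N'" "r \<le> r'" "\<And>i. i < N \<Longrightarrow> T i = T' i" "\<And>i. i < r \<Longrightarrow> \<rho> i = \<rho>' i" "x \<in> local_kernel N T r \<rho>"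
  shows "x \<in> local_kernel N' T' r' \<rho>'"
proof -
  obtain s e where s: "x \<in> poly_algebra V N" "s \<in> poly_algebra V N" "e \<in> V" "unit_in W (poly (pe T s) z)" "e \<noteq> 0"
    "Const e * (s * x) \<in> gen (poly_algebra V N) (\<rho> ` {..<r})" using assms(5) unfolding local_kernel_def by blast
  have NN: "poly_algebra V N \<subseteq> poly_algebra V N'" using poly_algebra_mono assms(1) by blast
  have "\<rho> ` {..<r} \<subseteq> \<rho>' ` {..<r'}" using assms(2,4) by auto
  then have "gen (poly_algebra V N) (\<rho> ` {..<r}) \<subseteq> gen (poly_algebra V N') (\<rho>' ` {..<r'})"
    using gen_mono[of "\<rho> ` {..<r}" "\<rho>' ` {..<r'}"] gen_mono_ring[OF NN, of "\<rho> ` {..<r}"] gen_mono_ring[OF NN] by blast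
  moreover have "pe T s = pe T' s" using pe_cong[OF s(2)] assms(3) by blast
  ultimately show ?thesis using s NN by (intro local_kernel_I[of _ _ s e]) auto
qed

lemma local_kernel_rho: "i < r \<Longrightarrow> \<rho> i \<in> poly_algebra V N \<Longrightarrow> \<rho> i \<in> local_kernel N T r \<rho>"
  by (rule local_kernel_I[of _ _ 1 1])
    (use V.sPV[of N] V.V W.unit_in_1 in \<open>auto simp: pe_hom Const_hom intro!: gen_base subring_set_intros\<close>)

text \<open>With \<open>r = N\<close> the \<open>T i\<close> represent only the field \<open>F\<close>; with \<open>r < N\<close> there are variables not bound by a
  relation and, up to denominators in \<open>V\<close>, every polynomial over \<open>F\<close> is a polynomial in the \<open>T i\<close>.\<close>

definition system :: "nat \<Rightarrow> nat \<Rightarrow> nat \<Rightarrow> (nat \<Rightarrow> 'a poly) \<Rightarrow> (nat \<Rightarrow> 'a mpoly) \<Rightarrow> (nat \<Rightarrow> 'a mpoly) \<Rightarrow> (nat \<Rightarrow> nat) \<Rightarrow> bool" where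
  "system m N r T \<rho> c l \<longleftrightarrow>
     r \<le> N \<and> (\<forall>i<N. T i \<in> polys_over F \<and> degree (T i) < m \<and> poly (T i) z \<in> W) \<and>
     (\<forall>i<r. \<rho> i \<in> poly_algebra V N \<and> c i \<in> poly_algebra V i \<and> unit_in W (poly (pe T (c i)) z) \<and>
        \<rho> i - c i * Var i ^ l i \<in> poly_algebra (nonunits V) N \<and> pe T (\<rho> i) = 0) \<and>
     (\<forall>x\<in>poly_algebra V N. pe T x = 0 \<longrightarrow> x \<in> local_kernel N T r \<rho>) \<and>
     (\<forall>g\<in>polys_over F. (r = N \<longrightarrow> degree g = 0) \<longrightarrow> (\<exists>e\<in>V. e \<noteq> 0 \<and> smult e g \<in> pe T ` poly_algebra V N))"

lemma system_I:
  assumes "r \<le> N"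
    and "\<And>i. i < N \<Longrightarrow> T i \<in> polys_over F \<and> degree (T i) < m \<and> poly (T i) z \<in> W"
    and "\<And>i. i < r \<Longrightarrow> \<rho> i \<in> poly_algebra V N \<and> c i \<in> poly_algebra V i \<and> unit_in W (poly (pe T (c i)) z) \<and>
        \<rho> i - c i * Var i ^ l i \<in> poly_algebra (nonunits V) N \<and> pe T (\<rho> i) = 0"
    and "\<And>x. x \<in> poly_algebra V N \<Longrightarrow> pe T x = 0 \<Longrightarrow> x \<in> local_kernel N T r \<rho>"
    and "\<And>g. g \<in> polys_over F \<Longrightarrow> (r = N \<Longrightarrow> degree g = 0) \<Longrightarrow> \<exists>e\<in>V. e \<noteq> 0 \<and> smult e g \<in> pe T ` poly_algebra V N"
  shows "system m N r T \<rho> c l"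
  unfolding system_def using assms by simp

lemma systemD:
  assumes "system m N r T \<rho> c l"
  shows "r \<le> N" "\<And>i. i < N \<Longrightarrow> T i \<in> polys_over F" "\<And>i. i < N \<Longrightarrow> degree (T i) < m" "\<And>i. i < N \<Longrightarrow> poly (T i) z \<in> W"
    "\<And>i. i < r \<Longrightarrow> \<rho> i \<in> poly_algebra V N" "\<And>i. i < r \<Longrightarrow> c i \<in> poly_algebra V i"
    "\<And>i. i < r \<Longrightarrow> unit_in W (poly (pe T (c i)) z)"
    "\<And>i. i < r \<Longrightarrow> \<rho> i - c i * Var i ^ l i \<in> poly_algebra (nonunits V) N"
    "\<And>i. i < r \<Longrightarrow> pe T (\<rho> i) = 0"
    "\<And>x. x \<in> poly_algebra V N \<Longrightarrow> pe T x = 0 \<Longrightarrow> x \<in> local_kernel N T r \<rho>"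
    "\<And>g. g \<in> polys_over F \<Longrightarrow> (r = N \<Longrightarrow> degree g = 0) \<Longrightarrow> \<exists>e\<in>V. e \<noteq> 0 \<and> smult e g \<in> pe T ` poly_algebra V N"
  using assms unfolding system_def by auto

text \<open>The leading relation \<open>q = e\<^sub>0 p(T)\<close> prepared to become the next relation of a system.\<close>

definition lead_rel :: "nat \<Rightarrow> nat \<Rightarrow> (nat \<Rightarrow> 'a poly) \<Rightarrow> 'a poly \<Rightarrow> 'a \<Rightarrow> 'a mpoly \<Rightarrow> 'a mpoly \<Rightarrow> nat \<Rightarrow> bool" where
  "lead_rel N r T q e0 p cp lp \<longleftrightarrow> e0 \<in> K \<and> e0 \<noteq> 0 \<and> p \<in> poly_algebra V N \<and> cp \<in> poly_algebra V r \<and>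
     unit_in W (poly (pe T cp) z) \<and> p - cp * Var r ^ lp \<in> poly_algebra (nonunits V) N \<and> q = smult e0 (pe T p)"

lemma poly_algebra_nonun_mono: "N \<le> N' \<Longrightarrow> x \<in> poly_algebra (nonunits V) N \<Longrightarrow> x \<in> poly_algebra (nonunits V) N'"
  using poly_algebra_mono[of "nonunits V" "nonunits V" N N'] by blast

text \<open>The old \<open>T i\<close> are constants and \<open>t\<close> is transcendental over
  \<open>F\<close>, so the new variable satisfies no relation and the kernel is tested on
  coefficients. As \<open>t\<close> has degree one, \<open>X\<close> is obtained from
  \<open>t\<close> and constants, and all of \<open>F[X]\<close> is reached up to
  denominators.\<close>

lemma add_free_variable:
  assumes S: "system 1 N N T \<rho> c l" and t: "t \<in> polys_over F" "degree t = 1" "poly t z \<in> W"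
  shows "system 2 (Suc N) N (T(N := t)) \<rho> c l"
proof -
  note D = systemD[OF S]
  let ?T = "T(N := t)"
  let ?P = "poly_algebra V N" and ?P' = "poly_algebra V (Suc N)"
  have PP: "?P \<subseteq> ?P'" using poly_algebra_mono[of V V N "Suc N"] by auto
  have peT: "pe ?T x = pe T x" if "x \<in> ?P" for x using pe_cong[OF that, of ?T T] by simp
  have "x \<in> local_kernel (Suc N) ?T N \<rho>" if x: "x \<in> ?P'" "pe ?T x = 0" for x
  proof -
    obtain d f where f: "\<And>j. f j \<in> ?P" "x = (\<Sum>j\<le>d. f j * Var N ^ j)" using poly_algebra_Suc[OF x(1) V.V] by blast
    define v where "v j = ev (\<lambda>i. coeff (T i) 0) (f j)" for j
    have pv: "pe T (f j) = [:v j:]" for j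
    proof -
      have "T i = [:coeff (T i) 0:]" if "i < N" for i
        using D(3)[OF that] by (auto elim!: degree_eq_zeroE)
      then have "pe T (f j) = pe (\<lambda>i. [:coeff (T i) 0:]) (f j)" by (rule pe_cong[OF f(1)])
      then show ?thesis unfolding v_def eval_mpoly_comp[OF is_ring_hom_id is_ring_hom_pconst] .
    qed
    have mt: "pcompose (monom a j) t = [:a:] * t ^ j" for a j
      by (induction j) (simp_all add: monom_0 monom_Suc pcompose_pCons)
    have "pe ?T x = (\<Sum>j\<le>d. [:v j:] * t ^ j)" unfolding f(2) using f(1) by (simp add: pe_hom peT pv)
    also have "\<dots> = pcompose (\<Sum>j\<le>d. monom (v j) j) t"
      unfolding pcompose_sum mt ..
    finally have "pcompose (\<Sum>j\<le>d. monom (v j) j) t = 0" using x(2) by simp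
    then have 0: "(\<Sum>j\<le>d. monom (v j) j) = 0" by (rule pcompose_eq_0) (use t(2) in simp)
    have "v j = 0" if "j \<le> d" for j
    proof -
      have "coeff (\<Sum>j\<le>d. monom (v j) j) j = v j" using that by (simp add: coeff_sum if_distrib cong: if_cong)
      then show ?thesis using 0 by simp
    qed
    then have "f j \<in> local_kernel (Suc N) ?T N \<rho>" if "j \<le> d" for j
      using D(10)[OF f(1)] pv that local_kernel_mono[of N "Suc N" N N T ?T \<rho> \<rho>] by simp
    then have "Var N ^ j * f j \<in> local_kernel (Suc N) ?T N \<rho>" if "j \<le> d" for j
      using local_kernelD(4) that subring_set_power[OF V.sPV Var_in[OF V.V]] by (metis lessI)
    then show ?thesis unfolding f(2) by (intro is_ideal_sum[OF local_kernel_ideal]) (auto simp: mult.commute)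
  qed
  moreover have "\<exists>e\<in>V. e \<noteq> 0 \<and> smult e g \<in> pe ?T ` ?P'" if g: "g \<in> polys_over F" for g
  proof -
    define D' where "D' = {g \<in> polys_over F. \<exists>e\<in>V. e \<noteq> 0 \<and> smult e g \<in> pe ?T ` ?P'}"
    have Dc: "[:a:] \<in> D'" if "a \<in> F" for a
      using D(11)[OF polys_over_constant[OF that]] peT PP polys_over_constant[OF that] unfolding D'_def by force
    have Dadd: "p + q \<in> D'" "p * q \<in> D'" if "p \<in> D'" "q \<in> D'" for p q
    proof -
      obtain e u where e: "e \<in> V" "e \<noteq> 0" "u \<in> ?P'" "smult e p = pe ?T u" using \<open>p \<in> D'\<close> unfolding D'_def by blast
      obtain d v where d: "d \<in> V" "d \<noteq> 0" "v \<in> ?P'" "smult d q = pe ?T v" using \<open>q \<in> D'\<close> unfolding D'_def by blast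
      have "Const d * u + Const e * v \<in> ?P'" "u * v \<in> ?P'"
        using e d Const_in V.sPV by (auto intro!: subring_set_intros)
      moreover have "smult (e * d) (p + q) = pe ?T (Const d * u + Const e * v)"
        unfolding pe_hom e(4)[symmetric] d(4)[symmetric] by (simp add: smult_add_right mult.commute)
      moreover have "smult (e * d) (p * q) = pe ?T (u * v)"
        unfolding pe_hom e(4)[symmetric] d(4)[symmetric] by (simp add: mult.commute)
      moreover have "e * d \<in> V" "e * d \<noteq> 0" using e d V.V subring_set_mult by auto
      moreover have "p + q \<in> polys_over F" "p * q \<in> polys_over F" using that subring_polys_over unfolding D'_def by (auto intro: subring_set_intros)
      ultimately show "p + q \<in> D'" "p * q \<in> D'" unfolding D'_def by blast+
    qed
    have tD: "t \<in> D'" unfolding D'_def using t V.V subring_set_one Var_in[OF V.V, of N "Suc N"]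
      by (auto intro!: bexI[of _ 1] image_eqI[of _ _ "Var N"] simp: pe_hom)
    obtain \<alpha> \<beta> where ab: "t = [:\<alpha>, \<beta>:]" "\<beta> \<noteq> 0" using t(2) degree1_coeffs by metis
    have \<alpha>\<beta>: "\<alpha> \<in> F" "\<beta> \<in> F" using polys_over_coeff[OF t(1), of 0] polys_over_coeff[OF t(1), of 1] by (auto simp: ab)
    have X: "[:0, 1:] = [:1 / \<beta>:] * (t + [:- \<alpha>:])" using ab by simp
    have "1 / \<beta> \<in> F" "- \<alpha> \<in> F" using \<alpha>\<beta> subfield_set_divide[OF F] subring_set_intros(1,4)[OF subring_F] by auto
    then have XD: "[:0, 1:] \<in> D'" unfolding X using Dc Dadd tD by blast
    have "p \<in> polys_over F \<longrightarrow> p \<in> D'" for p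
    proof (induction p rule: pCons_induct)
      case 0
      then show ?case using Dc[of 0] subring_F subring_set_zero by auto
    next
      case (pCons a p)
      show ?case
      proof
        assume "pCons a p \<in> polys_over F"
        then have "coeff (pCons a p) i \<in> F" for i by (rule polys_over_coeff)
        from this[of 0] this[of "Suc _"] have "a \<in> F" "p \<in> polys_over F" by (auto simp: polys_over_def)
        moreover have "pCons a p = [:a:] + [:0, 1:] * p" by simp
        ultimately show "pCons a p \<in> D'" using pCons Dc Dadd XD by metis
      qed
    qed
    then show ?thesis using g unfolding D'_def by blast
  qed
  moreover have "\<rho> i \<in> ?P' \<and> c i \<in> poly_algebra V i \<and> unit_in W (poly (pe ?T (c i)) z) \<and>
        \<rho> i - c i * Var i ^ l i \<in> poly_algebra (nonunits V) (Suc N) \<and> pe ?T (\<rho> i) = 0" if i: "i < N" for i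
  proof -
    have ci: "c i \<in> ?P" using D(6)[OF i] poly_algebra_mono[of V V i N] i by auto
    show "\<rho> i \<in> ?P' \<and> c i \<in> poly_algebra V i \<and> unit_in W (poly (pe ?T (c i)) z) \<and>
        \<rho> i - c i * Var i ^ l i \<in> poly_algebra (nonunits V) (Suc N) \<and> pe ?T (\<rho> i) = 0"
      using D(5-9)[OF i] peT[OF ci] peT[OF D(5)[OF i]] PP poly_algebra_nonun_mono[of N "Suc N"] by auto
  qed
  moreover have "?T i \<in> polys_over F \<and> degree (?T i) < 2 \<and> poly (?T i) z \<in> W" if "i < Suc N" for i
    using D(2-4)[of i] t that by (cases "i = N") auto
  ultimately show ?thesis by (intro system_I) auto
qed

lemma power_diff_ideal:
  assumes "subring_set P" "is_ideal P I" "a \<in> P" "b \<in> P" "a - b \<in> I"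
  shows "a ^ j - b ^ (j::nat) \<in> I"
proof (induction j)
  case 0
  then show ?case using is_idealD(1)[OF assms(2)] by simp
next
  case (Suc j)
  have "a ^ Suc j - b ^ Suc j = a * (a ^ j - b ^ j) + b ^ j * (a - b)" by (simp add: algebra_simps)
  then show ?case using Suc assms is_idealD(3,4)[OF assms(2)] subring_set_power by metis
qed

text \<open>The relation \<open>p = e' X_N\<close> introduces \<open>t = p(T) / e'\<close>. Since
  \<open>e'\<close> is a non-unit, subtracting \<open>e' X_N\<close> leaves the leading term of
  \<open>p\<close> untouched modulo the maximal ideal. The variable that was free becomes bound, and
  \<open>X_N\<close> is the free one.\<close>

lemma add_bound_variable:
  assumes S: "system m N r T \<rho> c l" and r: "Suc r = N" and q: "lead_rel N r T q e0 p cp lp"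
    and e': "e' \<in> nonunits V" "e' \<noteq> 0" and t: "t \<in> polys_over F" "poly t z \<in> W" "degree t < m'" "m \<le> m'"
    and te: "smult e' t = pe T p"
  shows "system m' (Suc N) N (T(N := t)) (\<rho>(r := p - Const e' * Var N)) (c(r := cp)) (l(r := lp))"
proof -
  note D = systemD[OF S]
  let ?T = "T(N := t)" and ?\<rho> = "\<rho>(r := p - Const e' * Var N)"
  let ?P = "poly_algebra V N" and ?P' = "poly_algebra V (Suc N)"
  have PP: "?P \<subseteq> ?P'" using poly_algebra_mono[of V V N "Suc N"] by auto
  have peT: "pe ?T x = pe T x" if "x \<in> ?P" for x using pe_cong[OF that, of ?T T] by simp
  have p: "p \<in> ?P" "cp \<in> poly_algebra V r" "unit_in W (poly (pe T cp) z)" "p - cp * Var r ^ lp \<in> poly_algebra (nonunits V) N"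
    using q unfolding lead_rel_def by auto
  have eV: "e' \<in> V" using e' V.nonunits_in by blast
  note sP' = V.sPV[of "Suc N"]
  have XP: "Var N \<in> ?P'" using Var_in[OF V.V] by blast
  have eP: "Const e' \<in> ?P'" using Const_in eV by blast
  have new: "p - Const e' * Var N \<in> ?P'" using p(1) PP XP eP sP' by (intro subring_set_intros) auto
  let ?L = "local_kernel (Suc N) ?T N ?\<rho>"
  have newL: "p - Const e' * Var N \<in> ?L"
    using local_kernel_rho[of r N ?\<rho> "Suc N" ?T] new r by simp
  have "x \<in> ?L" if x: "x \<in> ?P'" "pe ?T x = 0" for x
  proof -
    obtain d f where f: "\<And>j. f j \<in> ?P" "x = (\<Sum>j\<le>d. f j * Var N ^ j)" using poly_algebra_Suc[OF x(1) V.V] by blast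
    \<comment> \<open>This is \<open>e'^d x\<close> with \<open>e' X_N\<close> replaced by
      \<open>p\<close>; every term has enough factors \<open>e'\<close> because \<open>d\<close>
      bounds the degree in \<open>X_N\<close>. The result no longer involves \<open>X_N\<close>, so
      the old system applies.\<close>
    define x' where "x' = (\<Sum>j\<le>d. f j * Const e' ^ (d - j) * p ^ j)"
    have x'P: "x' \<in> ?P" unfolding x'_def using f(1) p(1) eV Const_in V.sPV
      by (intro subring_set_sum subring_set_mult subring_set_power) auto
    have ex: "Const e' ^ d * x = (\<Sum>j\<le>d. f j * Const e' ^ (d - j) * (Const e' * Var N) ^ j)"
      unfolding f(2) sum_distrib_left
    proof (rule sum.cong[OF refl])
      fix j assume "j \<in> {..d}"
      then have "Const e' ^ d = Const e' ^ (d - j) * Const e' ^ j" by (simp flip: power_add)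
      then show "Const e' ^ d * (f j * Var N ^ j) = f j * Const e' ^ (d - j) * (Const e' * Var N) ^ j"
        by (simp add: power_mult_distrib ac_simps)
    qed
    have diff: "x' - Const e' ^ d * x \<in> ?L"
      unfolding ex x'_def sum_subtractf[symmetric] right_diff_distrib[symmetric]
    proof (rule is_ideal_sum[OF local_kernel_ideal], rule local_kernelD(4))
      fix j
      show "f j * Const e' ^ (d - j) \<in> ?P'" using f(1) PP eP sP' by (intro subring_set_mult subring_set_power) auto
      show "p ^ j - (Const e' * Var N) ^ j \<in> ?L"
        by (rule power_diff_ideal[OF sP' local_kernel_ideal]) (use p(1) PP XP eP sP' newL in \<open>auto intro: subring_set_mult\<close>)
    qed
    have "pe T p = pe ?T (Const e' * Var N)" by (simp add: pe_hom te[symmetric])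
    then have "pe T x' = pe ?T (Const e' ^ d * x)"
      unfolding ex x'_def using f(1) by (simp add: pe_hom peT te[symmetric])
    then have "pe T x' = 0" using x(2) by (simp add: pe_hom)
    then have "x' \<in> local_kernel N T r \<rho>" using D(10) x'P by blast
    then have "x' \<in> ?L" by (rule local_kernel_mono[rotated -1]) (use r in auto)
    then have "x' - (x' - Const e' ^ d * x) \<in> ?L" using diff is_ideal_diff[OF sP' local_kernel_ideal] by blast
    then have "Const (e' ^ d) * x \<in> ?L"
      by (simp add: Const_power)
    then show ?thesis using local_kernel_cancel[OF x(1)] eV e'(2) V.V subring_set_power by (metis power_not_zero)
  qed
  moreover have "\<exists>e\<in>V. e \<noteq> 0 \<and> smult e g \<in> pe ?T ` ?P'" if g: "g \<in> polys_over F" for g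
    using D(11)[OF g] r peT PP by force
  moreover have "?\<rho> i \<in> ?P' \<and> (c(r := cp)) i \<in> poly_algebra V i \<and> unit_in W (poly (pe ?T ((c(r := cp)) i)) z) \<and>
        ?\<rho> i - (c(r := cp)) i * Var i ^ (l(r := lp)) i \<in> poly_algebra (nonunits V) (Suc N) \<and> pe ?T (?\<rho> i) = 0"
    if i: "i < N" for i
  proof (cases "i = r")
    case True
    have cpP: "cp \<in> ?P" using p(2) poly_algebra_mono[of V V r N] r by auto
    note nI = poly_algebra_ideal[OF V.V V.nonunits_ideal, of "Suc N"]
    have "Var N * Const e' \<in> poly_algebra (nonunits V) (Suc N)"
      by (rule is_idealD(4)[OF nI XP]) (use e' Const_in in blast)
    then have "(p - cp * Var r ^ lp) - Var N * Const e' \<in> poly_algebra (nonunits V) (Suc N)"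
      using is_ideal_diff[OF sP' nI] poly_algebra_nonun_mono[of N "Suc N", OF _ p(4)] by simp
    then have "(p - Const e' * Var N) - cp * Var r ^ lp \<in> poly_algebra (nonunits V) (Suc N)"
      by (simp add: algebra_simps)
    then show ?thesis using True new p peT[OF cpP] peT[OF p(1)] te by (simp add: pe_hom)
  next
    case False
    then have ir: "i < r" using i r by simp
    have ci: "c i \<in> ?P" using D(6)[OF ir] poly_algebra_mono[of V V i N] i by auto
    show ?thesis using False D(5-9)[OF ir] peT[OF ci] peT[OF D(5)[OF ir]] PP poly_algebra_nonun_mono[of N "Suc N"] by auto
  qed
  moreover have "?T i \<in> polys_over F \<and> degree (?T i) < m' \<and> poly (?T i) z \<in> W" if "i < Suc N" for i
    using D(2-4)[of i] t that by (cases "i = N") auto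
  ultimately show ?thesis by (intro system_I) auto
qed

text \<open>If \<open>x(T)\<close> vanishes at \<open>z\<close>, it is a multiple
  \<open>f h\<close>. One variable is still free, so \<open>h\<close> is a polynomial in the
  \<open>T i\<close> up to a denominator; hence \<open>x\<close> is, up to denominators, a multiple
  of \<open>p\<close> modulo the kernel of the system.\<close>

lemma close_system:
  assumes S: "system m N r T \<rho> c l" and r: "Suc r = N" and q: "lead_rel N r T f e0 p cp lp"
    and fz: "poly f z = 0" and div: "\<And>g. g \<in> polys_over F \<Longrightarrow> poly g z = 0 \<Longrightarrow> \<exists>h\<in>polys_over F. g = f * h"
  shows "ci_data V W N (\<lambda>i. poly (T i) z) (\<rho>(r := p)) (c(r := cp)) (l(r := lp))"
proof -
  note D = systemD[OF S]
  let ?P = "poly_algebra V N" and ?\<rho> = "\<rho>(r := p)"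
  have p: "e0 \<in> K" "e0 \<noteq> 0" "p \<in> ?P" "cp \<in> poly_algebra V r" "unit_in W (poly (pe T cp) z)"
    "p - cp * Var r ^ lp \<in> poly_algebra (nonunits V) N" "f = smult e0 (pe T p)"
    using q unfolding lead_rel_def by auto
  have "poly (pe T p) z = 0" using fz p(2,7) by simp
  note all = this
  let ?L = "local_kernel N T N ?\<rho>"
  have pL: "p \<in> ?L" using local_kernel_rho[of r N ?\<rho> N T] p(3) r by simp
  have ker: "x \<in> ?L" if x: "x \<in> ?P" "poly (pe T x) z = 0" for x
  proof -
    have "pe T x \<in> polys_over F"
      by (rule eval_mpoly_in[OF is_ring_hom_pconst x(1) V.V subring_polys_over]) (use D(2) polys_over_constant VF in auto)
    then obtain h where h: "h \<in> polys_over F" "pe T x = f * h" using div x(2) by blast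
    have "r \<noteq> N" using r by simp
    then obtain e where e: "e \<in> V" "e \<noteq> 0" "smult e h \<in> pe T ` ?P" using D(11)[OF h(1)] by blast
    then obtain g where g: "g \<in> ?P" "smult e h = pe T g" by blast
    obtain a b where ab: "a \<in> V" "b \<in> V" "a \<noteq> 0" "b \<noteq> 0" "e0 = a / b" using K_num_den[OF p(1,2)] by blast
    have "pe T (Const (e * b) * x) = smult b (f * smult e h)"
      by (simp add: pe_hom h(2) mult.commute)
    also have "\<dots> = pe T (Const a * g * p)"
      unfolding g(2) p(7) ab(5) pe_hom using ab(4) by (simp add: mult.commute)
    finally have "pe T (Const (e * b) * x - Const a * g * p) = 0" by (simp add: pe_hom)
    moreover have cP: "Const (e * b) * x \<in> ?P" "Const a * g \<in> ?P"
      using subring_set_mult[OF V.sPV Const_in[OF subring_set_mult[OF V.V e(1) ab(2)]] x(1)]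
        subring_set_mult[OF V.sPV Const_in[OF ab(1)] g(1)] by auto
    moreover have "Const (e * b) * x - Const a * g * p \<in> ?P"
      using cP p(3) V.sPV by (intro subring_set_diff subring_set_mult[of _ "Const a * g"])
    ultimately have "Const (e * b) * x - Const a * g * p \<in> local_kernel N T r \<rho>" using D(10) by blast
    then have "Const (e * b) * x - Const a * g * p \<in> ?L" by (rule local_kernel_mono[rotated -1]) (use r in auto)
    then have "(Const (e * b) * x - Const a * g * p) + Const a * g * p \<in> ?L"
      by (rule local_kernelD(3)) (rule local_kernelD(4)[OF cP(2) pL])
    then have "Const (e * b) * x \<in> ?L" by simp
    then show ?thesis using local_kernel_cancel[OF x(1)] e ab V.V subring_set_mult by (metis mult_eq_0_iff)
  qed
  have each: "?\<rho> i \<in> ?P \<and> (c(r := cp)) i \<in> poly_algebra V i \<and> unit_in W (poly (pe T ((c(r := cp)) i)) z) \<and>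
        ?\<rho> i - (c(r := cp)) i * Var i ^ (l(r := lp)) i \<in> poly_algebra (nonunits V) N \<and> poly (pe T (?\<rho> i)) z = 0"
    if i: "i < N" for i
    using i r p D(5-9)[of i] all by (cases "i = r") auto
  show ?thesis
  proof unfold_locales
    fix x assume "x \<in> ?P" "ev (\<lambda>i. poly (T i) z) x = 0"
    then have "x \<in> ?L" using ker poly_pe by metis
    then show "\<exists>s\<in>?P. \<exists>e\<in>V. unit_in W (ev (\<lambda>i. poly (T i) z) s) \<and> e \<noteq> 0 \<and> Const e * (s * x) \<in> gen ?P (?\<rho> ` {..<N})"
      unfolding local_kernel_def poly_pe by blast
  qed (use each D(4) in \<open>auto simp only: poly_pe\<close>)
qed

end

section \<open>Choosing a scale at which no two terms have equal value\<close>

context valring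
begin

lemma nonunits_mult: "x \<in> nonunits V \<Longrightarrow> y \<in> V \<Longrightarrow> x * y \<in> nonunits V"
  using nonunD(4)[of y x] by (simp add: mult.commute)

lemma nonunits_power: "x \<in> nonunits V \<Longrightarrow> k > 0 \<Longrightarrow> x ^ k \<in> nonunits V"
proof (induction k)
  case (Suc k)
  then show ?case using nonunits_mult[of x "x ^ k"] nonunits_in subring_set_power[OF V] by simp
qed simp

lemma nonunits_not_un: "x \<in> nonunits V \<Longrightarrow> \<not> unit_in V x"
  by (simp add: nonunits_def)

text \<open>Each \<open>k\<close> with a tie selects a pair \<open>i < j\<close>. Two different
  \<open>k\<close> cannot select the same pair, for the quotient of the two unit ratios would be the
  \<open>(j - i)\<close>-th power of a non-unit. There are at most \<open>(m + 1) * (m + 1)\<close>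
  pairs, fewer than \<open>M\<close>.\<close>

lemma no_ties:
  assumes A: "A \<subseteq> {..m::nat}" and M: "M > (m + 1) * (m + 1)"
    and \<alpha>: "\<And>j. j \<in> A \<Longrightarrow> \<alpha> j \<noteq> 0" and \<tau>: "\<And>k::nat. \<tau> k \<noteq> 0"
    and dec: "\<And>j k. j < k \<Longrightarrow> \<tau> k / \<tau> j \<in> nonunits V"
  shows "\<exists>k<M. \<forall>i\<in>A. \<forall>j\<in>A. i \<noteq> j \<longrightarrow> \<not> unit_in V (\<alpha> i * \<tau> k ^ i / (\<alpha> j * \<tau> k ^ j))"
proof (rule ccontr)
  assume c: "\<not> ?thesis"
  have "\<exists>p. fst p \<in> A \<and> snd p \<in> A \<and> fst p < snd p \<and> unit_in V (\<alpha> (fst p) * \<tau> k ^ fst p / (\<alpha> (snd p) * \<tau> k ^ snd p))"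
    if k: "k < M" for k
  proof -
    obtain i j where ij: "i \<in> A" "j \<in> A" "i \<noteq> j" "unit_in V (\<alpha> i * \<tau> k ^ i / (\<alpha> j * \<tau> k ^ j))" using c k by blast
    show ?thesis
    proof (cases "i < j")
      case True
      then show ?thesis using ij by (intro exI[of _ "(i, j)"]) auto
    next
      case False
      have "inverse (\<alpha> i * \<tau> k ^ i / (\<alpha> j * \<tau> k ^ j)) = \<alpha> j * \<tau> k ^ j / (\<alpha> i * \<tau> k ^ i)" by simp
      then show ?thesis using False ij unit_in_inverse[OF ij(4)] by (intro exI[of _ "(j, i)"]) auto
    qed
  qed
  then obtain p where p: "\<And>k. k < M \<Longrightarrow> fst (p k) \<in> A \<and> snd (p k) \<in> A \<and> fst (p k) < snd (p k) \<and>
    unit_in V (\<alpha> (fst (p k)) * \<tau> k ^ fst (p k) / (\<alpha> (snd (p k)) * \<tau> k ^ snd (p k)))" by metis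
  have neq: "p k \<noteq> p k'" if kk: "k < k'" "k' < M" for k k'
  proof
    assume eq: "p k = p k'"
    define i j where "i = fst (p k)" and "j = snd (p k)"
    define d where "d = j - i"
    have k: "i \<in> A" "j \<in> A" "i < j" "unit_in V (\<alpha> i * \<tau> k ^ i / (\<alpha> j * \<tau> k ^ j))"
      using p[of k] kk unfolding i_def j_def by auto
    have k': "unit_in V (\<alpha> i * \<tau> k' ^ i / (\<alpha> j * \<tau> k' ^ j))"
      using p[of k'] kk unfolding i_def j_def eq by auto
    have jd: "j = i + d" "d > 0" using k(3) by (auto simp: d_def)
    have "(\<alpha> i * \<tau> k ^ i / (\<alpha> j * \<tau> k ^ j)) / (\<alpha> i * \<tau> k' ^ i / (\<alpha> j * \<tau> k' ^ j)) = (\<tau> k' / \<tau> k) ^ d"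
      using \<alpha>[OF k(1)] \<alpha>[OF k(2)] \<tau>[of k] \<tau>[of k'] unfolding jd(1)
      by (simp add: power_add power_divide field_simps)
    then have "unit_in V ((\<tau> k' / \<tau> k) ^ d)" using unit_in_divide[OF k(4) k'] by simp
    moreover have "(\<tau> k' / \<tau> k) ^ d \<in> nonunits V" using nonunits_power[OF dec[OF kk(1)] jd(2)] .
    ultimately show False using nonunits_not_un by blast
  qed
  have "inj_on p {..<M}"
    unfolding inj_on_def using neq by (metis lessThan_iff linorder_neqE_nat)
  moreover have "p ` {..<M} \<subseteq> {..m} \<times> {..m}" 
  proof
    fix q assume "q \<in> p ` {..<M}"
    then obtain k where "k < M" "q = p k" by blast
    then have "fst q \<in> A" "snd q \<in> A" using p by auto
    then show "q \<in> {..m} \<times> {..m}" using A by (auto simp: mem_Times_iff)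
  qed
  ultimately have "card {..<M} \<le> card ({..m} \<times> {..m})" by (intro card_inj_on_le) auto
  then show False using M by (simp add: card_cartesian_product)
qed

end

context immediate
begin

lemma K_sring: "subring_set K" and K'_sring: "subring_set K'"
  using K K' subfield_set_sring by auto

lemma K_nonun: "x \<in> K \<Longrightarrow> x \<in> nonunits W \<Longrightarrow> x \<in> nonunits V"
  using K_W[of x] W.nonunits_in[of x] unit_in_VW[of x] by (auto simp: nonunits_def)

lemma K_min:
  assumes "finite A" "A \<noteq> {}" "\<And>j. j \<in> A \<Longrightarrow> \<beta> j \<in> K \<and> \<beta> j \<noteq> 0"
  shows "\<exists>j0\<in>A. \<forall>j\<in>A. \<beta> j / \<beta> j0 \<in> V"
  using assms
proof (induction A rule: finite_ne_induct)
  case (singleton x)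
  then show ?case using V.V subring_set_one by auto
next
  case (insert x A)
  then obtain j0 where j0: "j0 \<in> A" "\<forall>j\<in>A. \<beta> j / \<beta> j0 \<in> V" by auto
  have b: "\<beta> x \<in> K" "\<beta> x \<noteq> 0" "\<beta> j0 \<in> K" "\<beta> j0 \<noteq> 0" using insert.prems j0(1) by auto
  show ?case
  proof (cases "\<beta> x / \<beta> j0 \<in> V")
    case True
    then show ?thesis using j0 by blast
  next
    case False
    have "\<beta> x / \<beta> j0 \<in> K" "\<beta> x / \<beta> j0 \<noteq> 0" using b subfield_set_divide[OF K] by auto
    then have x0: "\<beta> j0 / \<beta> x \<in> V" using K_val[of "\<beta> x / \<beta> j0"] False by auto
    have "\<beta> j / \<beta> x \<in> V" if "j \<in> A" for j
    proof -
      have "(\<beta> j / \<beta> j0) * (\<beta> j0 / \<beta> x) \<in> V" using j0(2) that x0 V.V subring_set_mult by blast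
      then show ?thesis using b by simp
    qed
    then show ?thesis using b V.V subring_set_one by (intro bexI[of _ x]) auto
  qed
qed

text \<open>Triangular data with every variable bound, whose algebra has fraction field
  \<open>F\<close> when \<open>F\<close> is a field.\<close>

definition closed_system :: "'a set \<Rightarrow> nat \<Rightarrow> (nat \<Rightarrow> 'a) \<Rightarrow> (nat \<Rightarrow> 'a mpoly) \<Rightarrow> (nat \<Rightarrow> 'a mpoly) \<Rightarrow> (nat \<Rightarrow> nat) \<Rightarrow> bool" where
  "closed_system F N y \<rho> c l \<longleftrightarrow> ci_data V W N y \<rho> c l \<and> (\<forall>i<N. y i \<in> F) \<and>
     (\<forall>a\<in>F. \<exists>e\<in>V. e \<noteq> 0 \<and> e * a \<in> ev y ` poly_algebra V N)"

text \<open>Membership up to a scalar \<open>b\<close> that carries the whole value of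
  \<open>a\<close>. If \<open>a\<close> is in \<open>W\<close>, then \<open>b\<close> is in
  \<open>V\<close> and \<open>a\<close> itself is in the algebra generated by the
  \<open>y i\<close>.\<close>

definition unit_multiple_at :: "nat \<Rightarrow> (nat \<Rightarrow> 'a) \<Rightarrow> 'a \<Rightarrow> bool" where
  "unit_multiple_at N y a \<longleftrightarrow> (\<exists>b\<in>K. b \<noteq> 0 \<and> (\<exists>u\<in>poly_algebra V N. unit_in W (ev y u) \<and> a = b * ev y u))"

definition exhaustible :: "'a set \<Rightarrow> bool" where
  "exhaustible F \<longleftrightarrow> (\<forall>E. finite E \<longrightarrow> E \<subseteq> F - {0} \<longrightarrow> (\<exists>N y \<rho> c l. closed_system F N y \<rho> c l \<and> (\<forall>a\<in>E. unit_multiple_at N y a)))"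

text \<open>The start of the tower: no variables and no relations, each element of \<open>K\<close>
  being its own scalar.\<close>

lemma exhaustible_K: "exhaustible K"
  unfolding exhaustible_def
proof (intro allI impI)
  fix E :: "'a set" assume E: "finite E" "E \<subseteq> K - {0}"
  define y :: "nat \<Rightarrow> 'a" where "y = (\<lambda>_. 0)"
  have k0: "x = Const (lk x 0)" if "x \<in> poly_algebra V 0" for x
  proof (rule poly_mapping_eqI)
    fix k
    show "lk x k = lk (Const (lk x 0)) k"
    proof (cases "k = 0")
      case False
      then have "k \<notin> ks x" using that by (auto simp: poly_algebra_iff)
      then show ?thesis using False by (simp add: Const_def lookup_single in_keys_iff)
    qed (simp add: Const_def)
  qed
  have "ci_data V W 0 y (\<lambda>_. 0) (\<lambda>_. 0) (\<lambda>_. 0)"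
  proof unfold_locales
    fix x assume x: "x \<in> poly_algebra V 0" "ev y x = 0"
    have "ev y x = lk x 0" by (subst k0[OF x(1)]) (simp add: ev_hom)
    then have "x = 0" using k0[OF x(1)] x(2) by (simp add: Const_def)
    then show "\<exists>s\<in>poly_algebra V 0. \<exists>e\<in>V. unit_in W (ev y s) \<and> e \<noteq> 0 \<and>
       Const e * (s * x) \<in> gen (poly_algebra V 0) ((\<lambda>_. 0) ` {..<0})"
      using V.sPV[of 0] V.V W.unit_in_1 by (auto intro!: bexI[of _ 1] gen_zero subring_set_one simp: ev_hom)
  qed auto
  moreover have "\<exists>e\<in>V. e \<noteq> 0 \<and> e * a \<in> ev y ` poly_algebra V 0" if "a \<in> K" for a
  proof -
    obtain x e where "x \<in> V" "e \<in> V" "e \<noteq> 0" "a = x / e" using \<open>a \<in> K\<close> unfolding fraction_field_def by blast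
    then show ?thesis using Const_in[of x V 0] by (intro bexI[of _ e]) (auto intro!: image_eqI[of _ _ "Const x"] simp: ev_hom)
  qed
  moreover have "unit_multiple_at 0 y a" if "a \<in> E" for a
    unfolding unit_multiple_at_def using that E V.sPV[of 0] W.unit_in_1
    by (intro bexI[of _ a]) (auto intro!: bexI[of _ 1] subring_set_one simp: ev_hom)
  ultimately show "\<exists>N y \<rho> c l. closed_system K N y \<rho> c l \<and> (\<forall>a\<in>E. unit_multiple_at N y a)" unfolding closed_system_def by blast
qed

end

context poly_system
begin

text \<open>\<open>D\<close> recognizes the value of \<open>p\<close> at \<open>z\<close>: up to an element of \<open>K\<close>, \<open>p\<close> is an element of \<open>D\<close> that
  is a unit at \<open>z\<close>.\<close>

definition unit_multiple :: "'a poly set \<Rightarrow> 'a poly \<Rightarrow> bool" where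
  "unit_multiple D p \<longleftrightarrow> (\<exists>b\<in>K. b \<noteq> 0 \<and> (\<exists>u\<in>D. unit_in W (poly u z) \<and> p = smult b u))"

text \<open>What the arguments about values need of the algebra generated by the \<open>T i\<close>.
  It is stated for arbitrary \<open>D\<close> because \<open>chain_exists_step\<close> quantifies
  over all such algebras before a system is chosen.\<close>

definition admissible :: "'a poly set \<Rightarrow> bool" where
  "admissible D \<longleftrightarrow> subring_set D \<and> D \<subseteq> polys_over F \<and> (\<forall>a\<in>V. [:a:] \<in> D) \<and> (\<forall>u\<in>D. poly u z \<in> W)"

lemma unit_multiple_mono: "D \<subseteq> D' \<Longrightarrow> unit_multiple D p \<Longrightarrow> unit_multiple D' p"
  unfolding unit_multiple_def by blast

lemma admissible_pe:
  assumes "\<And>i. i < N \<Longrightarrow> T i \<in> polys_over F \<and> poly (T i) z \<in> W"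
  shows "admissible (pe T ` poly_algebra V N)"
  unfolding admissible_def
proof (intro conjI ballI)
  let ?P = "poly_algebra V N"
  show "subring_set (pe T ` ?P)" unfolding subring_set_def
  proof (intro conjI ballI)
    show "1 \<in> pe T ` ?P" using subring_set_one[OF V.sPV] by (intro image_eqI[of _ _ 1]) (auto simp: pe_hom)
    fix u v assume "u \<in> pe T ` ?P" "v \<in> pe T ` ?P"
    then obtain a b where ab: "a \<in> ?P" "b \<in> ?P" "u = pe T a" "v = pe T b" by blast
    then have "u - v = pe T (a - b)" "u * v = pe T (a * b)" "a - b \<in> ?P" "a * b \<in> ?P"
      using subring_set_diff[OF V.sPV] subring_set_mult[OF V.sPV] by (auto simp: pe_hom)
    then show "u - v \<in> pe T ` ?P" "u * v \<in> pe T ` ?P" by blast+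
  qed
  show "pe T ` ?P \<subseteq> polys_over F"
  proof clarify
    fix x assume "x \<in> ?P"
    then show "pe T x \<in> polys_over F" by (rule eval_mpoly_in[OF is_ring_hom_pconst _ V.V subring_polys_over]) (use assms polys_over_constant VF in auto)
  qed
  show "[:a:] \<in> pe T ` ?P" if "a \<in> V" for a
    using Const_in[OF that] by (intro image_eqI[of _ _ "Const a"]) (auto simp: pe_hom)
  show "poly u z \<in> W" if "u \<in> pe T ` ?P" for u
  proof -
    obtain x where x: "x \<in> ?P" "u = pe T x" using \<open>u \<in> _\<close> by blast
    have "ev (\<lambda>i. poly (T i) z) x \<in> W" by (rule eval_mpoly_in[OF is_ring_hom_id x(1) V.V W.V]) (use assms VW in auto)
    then show ?thesis unfolding x(2) poly_pe .
  qed
qed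

lemma admissible_sys: "system m N r T \<rho> c l \<Longrightarrow> admissible (pe T ` poly_algebra V N)"
  by (rule admissible_pe) (auto dest: systemD)

text \<open>The start of a chain: the closed system for \<open>F\<close>, read as constant
  polynomials.\<close>

lemma closed_system_sys:
  assumes "closed_system F N y \<rho> c l"
  shows "system 1 N N (\<lambda>i. [:y i:]) \<rho> c l"
proof -
  let ?T = "\<lambda>i. [:y i:]"
  interpret C: ci_data V W N y \<rho> c l using assms unfolding closed_system_def by blast
  have y: "\<And>i. i < N \<Longrightarrow> y i \<in> F" and g: "\<And>a. a \<in> F \<Longrightarrow> \<exists>e\<in>V. e \<noteq> 0 \<and> e * a \<in> ev y ` poly_algebra V N"
    using assms unfolding closed_system_def by auto
  have pe: "pe ?T x = [:ev y x:]" for x using eval_mpoly_comp[OF is_ring_hom_id is_ring_hom_pconst, of y x] by simp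
  show ?thesis
  proof (rule system_I)
    show "x \<in> local_kernel N ?T N \<rho>" if "x \<in> poly_algebra V N" "pe ?T x = 0" for x
      using C.ker[OF that(1)] that unfolding local_kernel_def by (simp add: pe)
    show "\<exists>e\<in>V. e \<noteq> 0 \<and> smult e p \<in> pe ?T ` poly_algebra V N" if p: "p \<in> polys_over F" "N = N \<Longrightarrow> degree p = 0" for p
    proof -
      obtain a where a: "p = [:a:]" using p(2) degree_eq_zeroE by blast
      then have "a \<in> F" using polys_over_coeff[OF p(1), of 0] by simp
      then show ?thesis using g[of a] by (force simp: a pe)
    qed
  qed (use y C.y C.\<rho>_in C.c_in C.c_un C.\<rho>_c C.\<rho>_0 polys_over_constant in \<open>auto simp: pe\<close>)
qed

text \<open>\<open>q\<close> is given in advance because the last polynomial of the chain is chosen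
  so that one term of the expansion of \<open>q\<close> dominates. For \<open>m = 1\<close> the
  \<open>T i\<close> are constants and no variable is free, so there is no place for a leading
  relation.\<close>

definition chain_exists :: "nat \<Rightarrow> bool" where
  "chain_exists m \<longleftrightarrow> (\<forall>E q. finite E \<longrightarrow> E \<subseteq> {g \<in> polys_over F. g \<noteq> 0 \<and> degree g < m} \<longrightarrow> q \<in> polys_over F \<longrightarrow> degree q = m \<longrightarrow>
    (\<exists>N r T \<rho> c l. system m N r T \<rho> c l \<and> (\<forall>g\<in>E. unit_multiple (pe T ` poly_algebra V N) g) \<and>
      (if m = 1 then r = N else Suc r = N \<and> (\<exists>e0 p cp lp. lead_rel N r T q e0 p cp lp))))"

lemma chain_exists_1:
  assumes exhaustible: "exhaustible F" shows "chain_exists 1"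
  unfolding chain_exists_def
proof (intro allI impI)
  fix E q assume E: "finite E" "E \<subseteq> {g \<in> polys_over F. g \<noteq> 0 \<and> degree g < 1}"
  let ?E = "(\<lambda>g. coeff g 0) ` E"
  have c: "g = [:coeff g 0:]" if "g \<in> E" for g
    using that E(2) by (auto elim!: degree_eq_zeroE)
  have fE: "finite ?E" using E by simp
  have sE: "?E \<subseteq> F - {0}"
  proof clarify
    fix g assume g: "g \<in> E"
    then have "g \<noteq> 0" "degree g = 0" "g \<in> polys_over F" using E(2) by auto
    then have "coeff g 0 \<noteq> 0" using leading_coeff_neq_0[of g] by simp
    then show "coeff g 0 \<in> F - {0}" using polys_over_coeff[OF \<open>g \<in> polys_over F\<close>] by simp
  qed
  obtain N y \<rho> c' l where C: "closed_system F N y \<rho> c' l" "\<forall>a\<in>?E. unit_multiple_at N y a"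
    using exhaustible[unfolded exhaustible_def, rule_format, OF fE sE] by blast
  let ?T = "\<lambda>i. [:y i:]"
  have pe: "pe ?T x = [:ev y x:]" for x using eval_mpoly_comp[OF is_ring_hom_id is_ring_hom_pconst, of y x] by simp
  have "unit_multiple (pe ?T ` poly_algebra V N) g" if g: "g \<in> E" for g
  proof -
    have "unit_multiple_at N y (coeff g 0)" using C(2) g by blast
    then obtain b u where b: "b \<in> K" "b \<noteq> 0" "u \<in> poly_algebra V N" "unit_in W (ev y u)" "coeff g 0 = b * ev y u"
      unfolding unit_multiple_at_def by blast
    have "smult b (pe ?T u) = [:coeff g 0:]" by (simp add: pe b(5))
    then have "g = smult b (pe ?T u)" using c[OF g] by simp
    then show ?thesis using b unfolding unit_multiple_def by (intro bexI[of _ b] conjI bexI[of _ "pe ?T u"]) (auto simp: pe)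
  qed
  then show "\<exists>N r T \<rho> c l. system 1 N r T \<rho> c l \<and> (\<forall>g\<in>E. unit_multiple (pe T ` poly_algebra V N) g) \<and>
      (if (1::nat) = 1 then r = N else Suc r = N \<and> (\<exists>e0 p cp lp. lead_rel N r T q e0 p cp lp))"
    using closed_system_sys[OF C(1)] by (intro exI[of _ N] exI[of _ ?T] exI) auto
qed

text \<open>By immediacy \<open>poly t z\<close> has the value of some \<open>b\<close> in
  \<open>K\<close>, and the quotient has the residue of some \<open>c\<close> in \<open>V\<close>.
  Subtracting the constant \<open>b * c\<close> raises the value; \<open>\<mu> \<ge> 1\<close> keeps
  the polynomial monic of the same degree.\<close>

lemma improve:
  assumes t: "t \<in> polys_over F" "lead_coeff t = 1" "degree t = \<mu>" "\<mu> \<ge> 1" "poly t z \<noteq> 0"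
  shows "\<exists>t'. t' \<in> polys_over F \<and> lead_coeff t' = 1 \<and> degree t' = \<mu> \<and> poly t' z / poly t z \<in> nonunits W"
proof -
  have tz: "poly t z \<in> K'" using polys_over_eval_K' t(1) .
  obtain b where b: "b \<in> K" "b \<noteq> 0" "unit_in W (poly t z / b)" using value_rep[OF tz t(5)] by blast
  obtain c where c: "c \<in> V" "poly t z / b - c \<in> nonunits W" using residue_rep[OF W.unit_in_in[OF b(3)]] by blast
  let ?t = "t + [:- (b * c):]"
  have bc: "b * c \<in> F" using b c KF VF subring_F subring_set_mult by blast
  have "?t \<in> polys_over F" using t(1) bc polys_over_constant subring_F subring_polys_over subring_set_add subring_set_uminus by blast
  moreover have d: "degree ?t = \<mu>" using t(3,4) by (subst degree_add_eq_left) auto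
  moreover have "lead_coeff ?t = 1" using t(2,3,4) by (simp add: d coeff_pCons split: nat.splits)
  moreover have "poly ?t z / poly t z = (poly t z / b - c) * inverse (poly t z / b)"
    using b(2) t(5) by (simp add: field_simps)
  moreover have "inverse (poly t z / b) \<in> W" using b(3) by (simp only: unit_in_def)
  ultimately show ?thesis using W.nonunits_mult[OF c(2)] by metis
qed

text \<open>Values are totally ordered: for a new \<open>g\<close> either the current
  \<open>t\<close> already has larger value, or \<open>g\<close> has at least the value of
  \<open>t\<close>, and then an improvement of \<open>g\<close> serves for all.\<close>

lemma below_all:
  assumes nz: "\<And>g. g \<in> polys_over F \<Longrightarrow> g \<noteq> 0 \<Longrightarrow> degree g = \<mu> \<Longrightarrow> poly g z \<noteq> 0" and \<mu>: "\<mu> \<ge> 1"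
    and G: "finite G" "\<And>g. g \<in> G \<Longrightarrow> g \<in> polys_over F \<and> lead_coeff g = 1 \<and> degree g = \<mu>"
  shows "\<exists>t. t \<in> polys_over F \<and> lead_coeff t = 1 \<and> degree t = \<mu> \<and> (\<forall>g\<in>G. poly t z / poly g z \<in> nonunits W)"
  using G
proof (induction G rule: finite_induct)
  case empty
  have "monom 1 \<mu> \<in> polys_over F" using polys_over_monom[of F 1 \<mu>] subring_F subring_set_one subring_set_zero by blast
  then show ?case by (intro exI[of _ "monom 1 \<mu>"]) (auto simp: degree_monom_eq)
next
  case (insert g G)
  then obtain t where t: "t \<in> polys_over F" "lead_coeff t = 1" "degree t = \<mu>" "\<And>g. g \<in> G \<Longrightarrow> poly t z / poly g z \<in> nonunits W" by blast
  have g: "g \<in> polys_over F" "lead_coeff g = 1" "degree g = \<mu>" using insert.prems by auto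
  have "t \<noteq> 0" "g \<noteq> 0" using t(2) g(2) by auto
  then have tz: "poly t z \<noteq> 0" and gz: "poly g z \<noteq> 0" using nz t g by auto
  show ?case
  proof (cases "poly t z / poly g z \<in> nonunits W")
    case True
    then show ?thesis using t by blast
  next
    case False
    obtain t' where t': "t' \<in> polys_over F" "lead_coeff t' = 1" "degree t' = \<mu>" "poly t' z / poly g z \<in> nonunits W"
      using improve[OF g \<mu> gz] by blast
    have "poly g z / poly t z \<in> K'" using polys_over_eval_K' t(1) g(1) subfield_set_divide[OF K'] by blast
    then have gt: "poly g z / poly t z \<in> W" using K'_val[of "poly g z / poly t z"] False tz gz by auto
    have "poly t' z / poly h z \<in> nonunits W" if "h \<in> G" for h
    proof -
      have "(poly t' z / poly g z) * ((poly g z / poly t z) * (poly t z / poly h z)) \<in> nonunits W"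
        using t'(4) gt W.nonunits_in[OF t(4)[OF that]] W.V by (intro W.nonunits_mult subring_set_mult)
      then show ?thesis using tz gz by simp
    qed
    then show ?thesis using t' by blast
  qed
qed

text \<open>Let \<open>?g\<close> be the monic multiple of \<open>g\<close>. At \<open>z\<close>
  both \<open>t\<close> and its scale \<open>e\<close> have larger value than \<open>?g\<close>, so
  \<open>?g - t = b' u\<close> has the value of \<open>?g\<close> and \<open>e / b'\<close> is a
  non-unit of \<open>V\<close>. Hence \<open>?g = b' (u + (e / b') \<tau>)\<close>, and the second
  factor is still a unit at \<open>z\<close>. This reduces degree \<open>\<mu>\<close> to lower
  degrees.\<close>

lemma unit_multiple_lift:
  assumes D: "admissible D" and g: "g \<in> polys_over F" "lead_coeff g \<noteq> 0"
    and lc: "unit_multiple D [:lead_coeff g:]"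
    and s: "unit_multiple D (smult (1 / lead_coeff g) g - t)"
    and t: "t = smult e \<tau>" "\<tau> \<in> D" "poly t z / (poly g z / lead_coeff g) \<in> nonunits W" "poly g z \<noteq> 0"
    and e: "e \<in> K" "e / (poly g z / lead_coeff g) \<in> nonunits W"
  shows "unit_multiple D g"
proof -
  let ?g = "smult (1 / lead_coeff g) g"
  define G where "G = poly g z / lead_coeff g"
  have G0: "G \<noteq> 0" using t(4) g(2) by (simp add: G_def)
  obtain b' u where b': "b' \<in> K" "b' \<noteq> 0" "u \<in> D" "unit_in W (poly u z)" "?g - t = smult b' u" using s unfolding unit_multiple_def by blast
  obtain b'' w where b'': "b'' \<in> K" "b'' \<noteq> 0" "w \<in> D" "unit_in W (poly w z)" "[:lead_coeff g:] = smult b'' w"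
    using lc unfolding unit_multiple_def by blast
  have "poly (?g - t) z = G - poly t z" by (simp add: G_def)
  then have sz: "b' * poly u z = G - poly t z" by (simp add: b'(5))
  have "unit_in W (1 - poly t z / G)" using W.unit_in_diff_nonun[OF W.unit_in_1 t(3)] unfolding G_def .
  moreover have "1 - poly t z / G = b' * poly u z / G" using G0 by (simp add: sz diff_divide_distrib)
  ultimately have ub: "unit_in W (b' * poly u z / G)" by simp
  have "e / b' = (e / G) * (poly u z * inverse (b' * poly u z / G))"
    using G0 b'(2) W.unit_in_nonzero[OF b'(4)] by simp
  moreover have "\<dots> \<in> nonunits W"
    by (rule W.nonunits_mult[OF e(2)[folded G_def] subring_set_mult[OF W.V W.unit_in_in[OF b'(4)] W.unit_in_in[OF W.unit_in_inverse[OF ub]]]])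
  ultimately have ebW: "e / b' \<in> nonunits W" by simp
  then have ebn: "e / b' \<in> nonunits V" using K_nonun subfield_set_divide[OF K e(1) b'(1)] by blast
  have sD: "subring_set D" using D unfolding admissible_def by blast
  define v where "v = u + [:e / b':] * \<tau>"
  have vD: "v \<in> D" unfolding v_def using D b'(3) t(2) V.nonunits_in[OF ebn] sD unfolding admissible_def
    by (intro subring_set_add subring_set_mult) auto
  have "poly \<tau> z \<in> W" using D t(2) unfolding admissible_def by blast
  then have vu: "unit_in W (poly v z)" unfolding v_def using W.unit_in_add_nonun[OF b'(4) W.nonunits_mult[OF ebW]] by simp
  have "?g = smult b' u + smult e \<tau>" using b'(5) t(1) by (simp add: algebra_simps)
  also have "\<dots> = smult b' v" using b'(2) by (simp add: v_def smult_add_right)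
  finally have g': "?g = smult b' v" .
  have "g = [:lead_coeff g:] * ?g" using g(2) by simp
  also have "\<dots> = smult (b'' * b') (w * v)" unfolding b''(5) g' by (simp add: mult.commute)
  finally have "g = smult (b'' * b') (w * v)" .
  moreover have "unit_in W (poly (w * v) z)" using W.unit_in_mult b''(4) vu by simp
  moreover have "b'' * b' \<in> K" "b'' * b' \<noteq> 0" using b' b'' subring_set_mult[OF K_sring] by auto
  ultimately show ?thesis unfolding unit_multiple_def using subring_set_mult[OF sD b''(3) vD] by blast
qed

text \<open>Among the polynomials \<open>t = \<tau>\<^sub>M\<close> obtained by successively improving the approximation, expanding \<open>q\<close>
  in powers of \<open>t\<close> and scaling \<open>t\<close> by the value of an intermediate \<open>\<tau>\<^sub>k\<close> that causes no tie makes a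
  single term of \<open>q\<close> dominate.\<close>

definition dominant :: "'a poly \<Rightarrow> nat \<Rightarrow> 'a poly set \<Rightarrow> 'a poly \<Rightarrow> 'a \<Rightarrow> (nat \<Rightarrow> 'a poly) \<Rightarrow> bool" where
  "dominant q \<mu> G t e a \<longleftrightarrow> t \<in> polys_over F \<and> lead_coeff t = 1 \<and> degree t = \<mu> \<and> e \<in> K \<and> e \<noteq> 0 \<and> poly t z / e \<in> nonunits W \<and>
    (\<forall>g\<in>G. poly t z / poly g z \<in> nonunits W \<and> e / poly g z \<in> nonunits W) \<and>
    (\<forall>j. a j \<in> polys_over F \<and> degree (a j) < \<mu>) \<and> q = (\<Sum>j\<le>degree q. a j * t ^ j) \<and>
    (\<forall>i j. i \<le> degree q \<longrightarrow> j \<le> degree q \<longrightarrow> i \<noteq> j \<longrightarrow> a i \<noteq> 0 \<longrightarrow> a j \<noteq> 0 \<longrightarrow>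
      \<not> unit_in W (poly (a i) z * e ^ i / (poly (a j) z * e ^ j)))"

lemma dominant_term:
  assumes \<mu>: "1 \<le> \<mu>" "\<mu> \<le> degree q" and q: "q \<in> polys_over F" "q \<noteq> 0"
    and nz: "\<And>g. g \<in> polys_over F \<Longrightarrow> g \<noteq> 0 \<Longrightarrow> degree g \<le> \<mu> \<Longrightarrow> poly g z \<noteq> 0"
    and G: "finite G" "\<And>g. g \<in> G \<Longrightarrow> g \<in> polys_over F \<and> lead_coeff g = 1 \<and> degree g = \<mu>"
  shows "\<exists>t e a. dominant q \<mu> G t e a"
proof -
  define ok where "ok t \<longleftrightarrow> t \<in> polys_over F \<and> lead_coeff t = 1 \<and> degree t = \<mu>" for t
  have okz: "poly t z \<noteq> 0" if "ok t" for t
    using that nz[of t] unfolding ok_def by (metis leading_coeff_0_iff order_refl zero_neq_one)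
  obtain t0 where t0: "ok t0" "\<And>g. g \<in> G \<Longrightarrow> poly t0 z / poly g z \<in> nonunits W"
    using below_all[of \<mu> G] nz \<mu>(1) G unfolding ok_def by (metis order_refl)
  have "\<exists>t'. ok t \<longrightarrow> ok t' \<and> poly t' z / poly t z \<in> nonunits W" for t
    using improve[of t \<mu>] okz[of t] \<mu>(1) unfolding ok_def by blast
  then obtain im where im: "\<And>t. ok t \<Longrightarrow> ok (im t) \<and> poly (im t) z / poly t z \<in> nonunits W" by metis
  \<comment> \<open>Successive improvements of \<open>t0\<close>: at \<open>z\<close> each has
    larger value than all earlier ones, and than all members of \<open>G\<close>.\<close>
  define \<tau> where "\<tau> k = rec_nat t0 (\<lambda>_. im) k" for k :: nat
  have \<tau>ok: "ok (\<tau> k)" for k by (induction k) (use t0 im in \<open>auto simp: \<tau>_def\<close>)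
  have \<tau>S: "poly (\<tau> (Suc k)) z / poly (\<tau> k) z \<in> nonunits W" for k using im[OF \<tau>ok[of k]] by (simp add: \<tau>_def)
  have \<tau>0: "\<tau> 0 = t0" by (simp add: \<tau>_def)
  have \<tau>z: "poly (\<tau> k) z \<noteq> 0" for k using okz \<tau>ok by blast
  have dec: "poly (\<tau> k) z / poly (\<tau> j) z \<in> nonunits W" if "j < k" for j k
    using that
  proof (induction k)
    case (Suc k)
    show ?case
    proof (cases "j = k")
      case False
      then have "poly (\<tau> k) z / poly (\<tau> j) z \<in> nonunits W" using Suc by simp
      from W.nonunits_mult[OF \<tau>S[of k] W.nonunits_in[OF this]] show ?thesis using \<tau>z[of k] by simp
    qed (use \<tau>S in simp)
  qed simp
  have tauG: "poly (\<tau> k) z / poly g z \<in> nonunits W" if "g \<in> G" for g k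
  proof (cases "k = 0")
    case False
    then have "poly (\<tau> k) z / poly t0 z \<in> nonunits W" using dec[of 0 k] by (simp add: \<tau>0)
    from W.nonunits_mult[OF this W.nonunits_in[OF t0(2)[OF that]]] show ?thesis using okz[OF t0(1)] by simp
  qed (use t0 that \<tau>0 in simp)
  \<comment> \<open>One more than the number of index pairs, as \<open>no_ties\<close> demands.
    \<open>t\<close> comes after all candidates \<open>\<tau> k\<close> with \<open>k < M\<close>
    for the scale, so that \<open>poly t z / e\<close> will be a non-unit.\<close>
  define M where "M = Suc ((degree q + 1) * (degree q + 1))"
  define t where "t = \<tau> M"
  have t: "t \<in> polys_over F" "lead_coeff t = 1" "degree t = \<mu>" using \<tau>ok[of M] unfolding t_def ok_def by auto
  obtain a where a: "\<And>j. a j \<in> polys_over F \<and> degree (a j) < degree t" "q = (\<Sum>j\<le>degree q. a j * t ^ j)"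
    using polys_over_expansion[OF subring_F t(1,2) _ q(1) order_refl] t(3) \<mu>(1) by blast
  define A where "A = {j. j \<le> degree q \<and> a j \<noteq> 0}"
  have az: "poly (a j) z \<noteq> 0" if "j \<in> A" for j
    using that nz[of "a j"] a(1)[of j] t(3) unfolding A_def by simp
  obtain k where k: "k < M" "\<forall>i\<in>A. \<forall>j\<in>A. i \<noteq> j \<longrightarrow>
      \<not> unit_in W (poly (a i) z * poly (\<tau> k) z ^ i / (poly (a j) z * poly (\<tau> k) z ^ j))"
    using W.no_ties[of A "degree q" M "\<lambda>j. poly (a j) z" "\<lambda>k. poly (\<tau> k) z"] az \<tau>z dec
    unfolding M_def A_def by auto
  have tkK: "poly (\<tau> k) z \<in> K'" using polys_over_eval_K' \<tau>ok unfolding ok_def by blast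
  \<comment> \<open>The scale must lie in \<open>K\<close>, so the value of \<open>\<tau> k\<close>
    at \<open>z\<close> is represented there; the unit quotient \<open>x\<close> does not affect
    ties.\<close>
  obtain e where e: "e \<in> K" "e \<noteq> 0" "unit_in W (poly (\<tau> k) z / e)" using value_rep[OF tkK \<tau>z] by blast
  define x where "x = poly (\<tau> k) z / e"
  have xk: "poly (\<tau> k) z = x * e" using e(2) by (simp add: x_def)
  have x: "unit_in W x" using e(3) by (simp add: x_def)
  have "dominant q \<mu> G t e a"
    unfolding dominant_def
  proof (intro conjI allI impI ballI t e(1,2))
    have "poly t z / e = (poly t z / poly (\<tau> k) z) * x" using \<tau>z[of k] by (simp add: x_def)
    then show "poly t z / e \<in> nonunits W" using W.nonunits_mult[OF dec[OF k(1)] W.unit_in_in[OF x]] unfolding t_def by simp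
    show "poly t z / poly g z \<in> nonunits W" if "g \<in> G" for g using tauG[OF that] unfolding t_def .
    show "e / poly g z \<in> nonunits W" if "g \<in> G" for g
    proof -
      have "e / poly g z = (poly (\<tau> k) z / poly g z) * inverse x"
        using W.unit_in_nonzero[OF x] unfolding xk by simp
      then show ?thesis using W.nonunits_mult[OF tauG[OF that, of k] W.unit_in_in[OF W.unit_in_inverse[OF x]]] by (simp only:)
    qed
    show "a j \<in> polys_over F" "degree (a j) < \<mu>" for j using a(1)[of j] t(3) by auto
    show "q = (\<Sum>j\<le>degree q. a j * t ^ j)" by (rule a(2))
    fix i j assume ij: "i \<le> degree q" "j \<le> degree q" "i \<noteq> j" "a i \<noteq> 0" "a j \<noteq> 0"
    show "\<not> unit_in W (poly (a i) z * e ^ i / (poly (a j) z * e ^ j))"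
    proof
      assume u: "unit_in W (poly (a i) z * e ^ i / (poly (a j) z * e ^ j))"
      have "poly (a i) z * poly (\<tau> k) z ^ i / (poly (a j) z * poly (\<tau> k) z ^ j) =
        (poly (a i) z * e ^ i / (poly (a j) z * e ^ j)) * (x ^ i / x ^ j)"
        unfolding xk by (simp add: power_mult_distrib ac_simps)
      moreover have "unit_in W (x ^ i / x ^ j)" using x W.unit_in_power W.unit_in_divide by blast
      ultimately have "unit_in W (poly (a i) z * poly (\<tau> k) z ^ i / (poly (a j) z * poly (\<tau> k) z ^ j))"
        using W.unit_in_mult[OF u \<open>unit_in W (x ^ i / x ^ j)\<close>] by (simp only:)
      then show False using k(2) ij unfolding A_def by blast
    qed
  qed
  then show ?thesis by blast
qed

text \<open>With \<open>a j = b j * u j\<close>, where \<open>u j\<close> is a unit at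
  \<open>z\<close>, the term \<open>j\<close> has the scale \<open>\<beta> j = b j * e ^ j\<close>.
  Without ties the least value occurs at a single \<open>j0\<close>. Dividing by
  \<open>\<beta> j0\<close> turns the other scalars into non-units, and modulo the maximal ideal
  only \<open>u j0 * X_N ^ j0\<close> remains.\<close>

lemma lead_rel_expansion:
  assumes \<tau>: "\<tau> = pe T' (Var N)" "t = smult e \<tau>" "e \<in> K" "e \<noteq> 0"
    and TT: "\<And>i. i < N \<Longrightarrow> T' i = T i"
    and a: "\<And>j. j \<le> d \<Longrightarrow> a j \<noteq> 0 \<Longrightarrow> unit_multiple (pe T ` poly_algebra V N) (a j)"
    and q: "q = (\<Sum>j\<le>d. a j * t ^ j)" "q \<noteq> 0"
    and nt: "\<And>i j. i \<le> d \<Longrightarrow> j \<le> d \<Longrightarrow> i \<noteq> j \<Longrightarrow> a i \<noteq> 0 \<Longrightarrow> a j \<noteq> 0 \<Longrightarrow>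
      \<not> unit_in W (poly (a i) z * e ^ i / (poly (a j) z * e ^ j))"
  shows "\<exists>e0 p cp lp. lead_rel (Suc N) N T' q e0 p cp lp"
proof -
  let ?P = "poly_algebra V N" and ?P' = "poly_algebra V (Suc N)"
  have PP: "?P \<subseteq> ?P'" using poly_algebra_mono[of V V N "Suc N"] by auto
  define A where "A = {j. j \<le> d \<and> a j \<noteq> 0}"
  have fA: "finite A" unfolding A_def by simp
  have qA: "q = (\<Sum>j\<in>A. a j * t ^ j)" unfolding q(1) A_def
    by (rule sum.mono_neutral_right) auto
  have Ane: "A \<noteq> {}" using qA q(2) by auto
  have "\<forall>j\<in>A. \<exists>b u. b \<in> K \<and> b \<noteq> 0 \<and> u \<in> ?P \<and> unit_in W (poly (pe T u) z) \<and> a j = smult b (pe T u)"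
    using a unfolding A_def unit_multiple_def by blast
  then obtain b u where bu: "\<And>j. j \<in> A \<Longrightarrow> b j \<in> K \<and> b j \<noteq> 0 \<and> u j \<in> ?P \<and> unit_in W (poly (pe T (u j)) z) \<and> a j = smult (b j) (pe T (u j))"
    by metis
  define \<beta> where "\<beta> j = b j * e ^ j" for j
  have \<beta>: "\<beta> j \<in> K \<and> \<beta> j \<noteq> 0" if "j \<in> A" for j
    unfolding \<beta>_def using bu[OF that] \<tau>(3,4) K_sring by (auto intro: subring_set_mult subring_set_power)
  obtain j0 where j0: "j0 \<in> A" "\<And>j. j \<in> A \<Longrightarrow> \<beta> j / \<beta> j0 \<in> V" using K_min[OF fA Ane, of \<beta>] \<beta> by blast
  have ratio: "\<beta> j / \<beta> j0 \<in> nonunits V" if j: "j \<in> A" "j \<noteq> j0" for j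
  proof (rule ccontr)
    assume "\<beta> j / \<beta> j0 \<notin> nonunits V"
    then have "unit_in W (\<beta> j / \<beta> j0)" using j0(2)[OF j(1)] V.nonunits_or_un unit_in_VW by blast
    moreover have "unit_in W (poly (pe T (u j)) z / poly (pe T (u j0)) z)" using bu j(1) j0(1) W.unit_in_divide by blast
    moreover have "(\<beta> j / \<beta> j0) * (poly (pe T (u j)) z / poly (pe T (u j0)) z) =
      poly (a j) z * e ^ j / (poly (a j0) z * e ^ j0)"
      using bu[OF j(1)] bu[OF j0(1)] by (simp add: \<beta>_def ac_simps)
    ultimately have "unit_in W (poly (a j) z * e ^ j / (poly (a j0) z * e ^ j0))" using W.unit_in_mult by metis
    then show False using nt[of j j0] j j0(1) unfolding A_def by blast
  qed
  define p where "p = (\<Sum>j\<in>A. Const (\<beta> j / \<beta> j0) * u j * Var N ^ j)"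
  have XP: "Var N \<in> ?P'" using Var_in[OF V.V] by blast
  have tm: "Const x * u j * Var N ^ j \<in> poly_algebra B (Suc N)"
    if "j \<in> A" "x \<in> B" "is_ideal V B" for j x B
  proof -
    have "(u j * Var N ^ j) * Const x \<in> poly_algebra B (Suc N)"
      by (rule is_idealD(4)[OF poly_algebra_ideal[OF V.V that(3)] subring_set_mult[OF V.sPV _ subring_set_power[OF V.sPV XP]]])
        (use bu[OF that(1)] PP Const_in that in auto)
    then show ?thesis by (simp add: ac_simps)
  qed
  have iV: "is_ideal V V" using V.V by (auto simp: is_ideal_def intro: subring_set_intros)
  have pP: "p \<in> ?P'" unfolding p_def using tm[OF _ _ iV] j0(2) by (intro subring_set_sum[OF V.sPV]) auto
  have "p = Const (\<beta> j0 / \<beta> j0) * u j0 * Var N ^ j0 + (\<Sum>j\<in>A - {j0}. Const (\<beta> j / \<beta> j0) * u j * Var N ^ j)"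
    unfolding p_def using fA j0(1) by (rule sum.remove)
  then have "p - u j0 * Var N ^ j0 = (\<Sum>j\<in>A - {j0}. Const (\<beta> j / \<beta> j0) * u j * Var N ^ j)"
    using \<beta>[OF j0(1)] by (simp add: Const_hom)
  moreover have "\<dots> \<in> poly_algebra (nonunits V) (Suc N)"
    using tm[OF _ ratio V.nonunits_ideal] by (intro is_ideal_sum[OF poly_algebra_ideal[OF V.V V.nonunits_ideal]]) auto
  ultimately have dom: "p - u j0 * Var N ^ j0 \<in> poly_algebra (nonunits V) (Suc N)" by simp
  have peT: "pe T' x = pe T x" if "x \<in> ?P" for x using pe_cong[OF that TT] .
  have sm: "smult c (sum f B) = (\<Sum>j\<in>B. smult c (f j))" for c f and B :: "nat set"
    by (induction B rule: infinite_finite_induct) (auto simp: smult_add_right)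
  have "smult (\<beta> j0) (pe T' p) = (\<Sum>j\<in>A. smult (\<beta> j) (pe T (u j) * \<tau> ^ j))"
    unfolding p_def \<tau>(1) using bu \<beta>[OF j0(1)]
    by (simp add: pe_hom peT sm cong: sum.cong)
  also have "\<dots> = q" unfolding qA
    by (rule sum.cong) (use bu in \<open>auto simp: \<tau>(2) \<beta>_def smult_power ac_simps\<close>)
  finally have "q = smult (\<beta> j0) (pe T' p)" by simp
  moreover have "u j0 \<in> ?P" "unit_in W (poly (pe T' (u j0)) z)" using bu[OF j0(1)] peT by auto
  ultimately show ?thesis unfolding lead_rel_def using pP dom \<beta>[OF j0(1)] by blast
qed

end

section \<open>Existence of chains\<close>

context poly_system
begin

lemma system_mono: "system m N r T \<rho> c l \<Longrightarrow> m \<le> m' \<Longrightarrow> system m' N r T \<rho> c l"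
  unfolding system_def by (meson less_le_trans)

text \<open>\<open>\<mu>\<close> is the least degree such that the values of polynomials of degree at most \<open>\<mu>\<close> control those of all
  polynomials of degree below \<open>m\<close>. Minimality forces the scaling factor \<open>e / e0\<close> of the new relation to be a non-unit:
  otherwise the new \<open>\<tau>\<close> would already lie in the algebra generated by the previous \<open>T i\<close>.\<close>

theorem chain_exists_step:
  assumes m: "m \<ge> 2" and IH: "\<And>\<mu>. 1 \<le> \<mu> \<Longrightarrow> \<mu> < m \<Longrightarrow> chain_exists \<mu>"
    and nz: "\<And>g. g \<in> polys_over F \<Longrightarrow> g \<noteq> 0 \<Longrightarrow> degree g < m \<Longrightarrow> poly g z \<noteq> 0"
  shows "chain_exists m"
  unfolding chain_exists_def
proof (intro allI impI)
  define S where "S k = {g \<in> polys_over F. g \<noteq> 0 \<and> degree g < k}" for k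
  fix E q assume E: "finite E" "E \<subseteq> {g \<in> polys_over F. g \<noteq> 0 \<and> degree g < m}" and q: "q \<in> polys_over F" "degree q = m"
  define Z where "Z \<mu> \<longleftrightarrow> (\<forall>E. finite E \<longrightarrow> E \<subseteq> S m \<longrightarrow> (\<exists>E'. finite E' \<and> E' \<subseteq> S (Suc \<mu>) \<and>
      (\<forall>D. admissible D \<longrightarrow> (\<forall>a\<in>E'. unit_multiple D a) \<longrightarrow> (\<forall>a\<in>E. unit_multiple D a))))" for \<mu>
  have "Suc (m - 1) = m" using m by simp
  then have Zm: "Z (m - 1)" unfolding Z_def by auto
  define \<mu> where "\<mu> = (LEAST \<mu>. Z \<mu>)"
  have Z\<mu>: "Z \<mu>" unfolding \<mu>_def using Zm by (rule LeastI)
  have \<mu>m: "\<mu> < m" using Least_le[of Z, OF Zm] m unfolding \<mu>_def by simp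
  have nZ: "\<not> Z k" if "k < \<mu>" for k using not_less_Least that unfolding \<mu>_def by blast
  \<comment> \<open>The constants from \<open>F\<close> lying in \<open>W\<close> form an admissible
    algebra that recognizes every constant polynomial but not \<open>X\<close>, so degree zero never
    suffices.\<close>
  have nZ0: "\<not> Z 0"
  proof
    assume Z0: "Z 0"
    have "[:0, 1:] \<in> polys_over F" using subring_F by (auto simp: polys_over_def coeff_pCons subring_set_zero subring_set_one split: nat.splits)
    then have "{[:0, 1:]} \<subseteq> S m" using m by (simp add: S_def)
    with Z0 obtain E' where E': "finite E'" "E' \<subseteq> S (Suc 0)"
      "\<And>D. admissible D \<Longrightarrow> (\<forall>a\<in>E'. unit_multiple D a) \<Longrightarrow> unit_multiple D [:0, 1:]"
      unfolding Z_def by (metis finite.emptyI finite.insertI singletonI)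
    define D where "D = (\<lambda>a. [:a:]) ` (F \<inter> W)"
    have "subring_set D" unfolding subring_set_def
    proof (intro conjI ballI)
      show "1 \<in> D" unfolding D_def using subring_F W.V subring_set_one by (intro image_eqI[of _ _ 1]) (auto simp: pCons_one)
      fix u v assume "u \<in> D" "v \<in> D"
      then obtain a b where ab: "a \<in> F \<inter> W" "b \<in> F \<inter> W" "u = [:a:]" "v = [:b:]" unfolding D_def by blast
      then have "a - b \<in> F \<inter> W" "a * b \<in> F \<inter> W" using subring_F W.V by (auto intro: subring_set_diff subring_set_mult)
      moreover have "u - v = [:a - b:]" "u * v = [:a * b:]" using ab by auto
      ultimately show "u - v \<in> D" "u * v \<in> D" unfolding D_def by blast+
    qed
    then have "admissible D" unfolding admissible_def using polys_over_constant VF VW by (auto simp: D_def)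
    moreover have "unit_multiple D g" if g: "g \<in> E'" for g
    proof -
      have g': "g \<in> polys_over F" "g \<noteq> 0" "degree g = 0" using g E'(2) by (auto simp: S_def)
      then obtain a where a: "g = [:a:]" "a \<noteq> 0" by (metis degree_eq_zeroE pCons_0_0)
      then have aF: "a \<in> F" using polys_over_coeff[OF g'(1), of 0] by simp
      then obtain b where b: "b \<in> K" "b \<noteq> 0" "unit_in W (a / b)" using value_rep[of a] a(2) FK' by blast
      have "[:a / b:] \<in> D" unfolding D_def using W.unit_in_in[OF b(3)] subfield_set_divide[OF F aF] b(1) KF by blast
      then show ?thesis unfolding unit_multiple_def using b by (intro bexI[of _ b] conjI bexI[of _ "[:a / b:]"]) (auto simp: a)
    qed
    ultimately have "unit_multiple D [:0, 1:]" using E'(3) by blast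
    then show False unfolding unit_multiple_def D_def by auto
  qed
  have \<mu>1: "\<mu> \<ge> 1" using Z\<mu> nZ0 by (cases \<mu>) auto
  then have "\<not> Z (\<mu> - 1)" "Suc (\<mu> - 1) = \<mu>" using nZ[of "\<mu> - 1"] by auto
  \<comment> \<open>A witness that degree \<open>\<mu> - 1\<close> does not suffice: no finite set
    of polynomials of degree below \<open>\<mu>\<close> controls \<open>Eb\<close>. It is kept for
    the proof that the scaling factor is a non-unit.\<close>
  then obtain Eb where Eb: "finite Eb" "Eb \<subseteq> S m"
    "\<And>E'. finite E' \<Longrightarrow> E' \<subseteq> S \<mu> \<Longrightarrow> \<exists>D. admissible D \<and> (\<forall>a\<in>E'. unit_multiple D a) \<and> (\<exists>a\<in>Eb. \<not> unit_multiple D a)"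
    unfolding Z_def by metis
  have "finite (E \<union> Eb)" "E \<union> Eb \<subseteq> S m" using E Eb by (auto simp: S_def)
  then obtain E' where E': "finite E'" "E' \<subseteq> S (Suc \<mu>)"
    "\<And>D a. admissible D \<Longrightarrow> (\<And>a. a \<in> E' \<Longrightarrow> unit_multiple D a) \<Longrightarrow> a \<in> E \<union> Eb \<Longrightarrow> unit_multiple D a"
    using Z\<mu> unfolding Z_def by metis
  define Hi where "Hi = {g \<in> E'. degree g = \<mu>}"
  define mo where "mo g = smult (1 / lead_coeff g) g" for g :: "'a poly"
  have Hi: "g \<in> polys_over F" "g \<noteq> 0" "degree g = \<mu>" "lead_coeff g \<noteq> 0" "lead_coeff g \<in> F" if "g \<in> Hi" for g
    using that E'(2) polys_over_coeff by (auto simp: Hi_def S_def)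
  have mo: "mo g \<in> polys_over F" "lead_coeff (mo g) = 1" "degree (mo g) = \<mu>" "poly (mo g) z = poly g z / lead_coeff g"
    "poly g z \<noteq> 0" if "g \<in> Hi" for g
    using Hi[OF that] polys_over_smult[OF subring_F] subfield_set_divide[OF F subring_set_one[OF subring_F]] nz[of g] \<mu>m by (auto simp: mo_def)
  have q0: "q \<noteq> 0" using q(2) m by auto
  have \<mu>q: "\<mu> \<le> degree q" using q(2) \<mu>m by simp
  have nzle: "poly g z \<noteq> 0" if "g \<in> polys_over F" "g \<noteq> 0" "degree g \<le> \<mu>" for g using nz that \<mu>m by auto
  have finHi: "finite (mo ` Hi)" using E'(1) by (simp add: Hi_def)
  have moHi: "g \<in> polys_over F \<and> lead_coeff g = 1 \<and> degree g = \<mu>" if "g \<in> mo ` Hi" for g using that mo by auto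
  obtain t e a where dom: "dominant q \<mu> (mo ` Hi) t e a"
    using dominant_term[OF \<mu>1 \<mu>q q(1) q0 nzle finHi moHi] by blast
  have t: "t \<in> polys_over F" "lead_coeff t = 1" "degree t = \<mu>" "e \<in> K" "e \<noteq> 0" "poly t z / e \<in> nonunits W"
    "\<And>g. g \<in> mo ` Hi \<Longrightarrow> poly t z / poly g z \<in> nonunits W" "\<And>g. g \<in> mo ` Hi \<Longrightarrow> e / poly g z \<in> nonunits W"
    using dom unfolding dominant_def by blast+
  have a: "\<And>j. a j \<in> polys_over F" "\<And>j. degree (a j) < \<mu>" "q = (\<Sum>j\<le>degree q. a j * t ^ j)"
    "\<And>i j. i \<le> degree q \<Longrightarrow> j \<le> degree q \<Longrightarrow> i \<noteq> j \<Longrightarrow> a i \<noteq> 0 \<Longrightarrow> a j \<noteq> 0 \<Longrightarrow>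
      \<not> unit_in W (poly (a i) z * e ^ i / (poly (a j) z * e ^ j))"
    using dom unfolding dominant_def by blast+
  define lo where "lo = {g \<in> E'. degree g < \<mu>}"
  \<comment> \<open>What the chain in degree \<open>\<mu>\<close> has to recognize: the coefficients
    of \<open>q\<close> in base \<open>t\<close>, the members of \<open>E'\<close> of lower degree,
    and, for each member of degree \<open>\<mu>\<close>, the two inputs of
    \<open>unit_multiple_lift\<close>.\<close>
  define E'' where "E'' = (a ` {..m} - {0}) \<union> lo \<union> (\<lambda>g. mo g - t) ` Hi \<union> (\<lambda>g. [:lead_coeff g:]) ` Hi"
  have "t \<noteq> 0" using t(2) by auto
  then have tz: "poly t z \<noteq> 0" using nz[of t] t(1,3) \<mu>m by simp
  have mot: "mo g - t \<in> S \<mu>" if g: "g \<in> Hi" for g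
  proof -
    have "mo g \<noteq> t" using t(7)[of "mo g"] g tz W.nonunits_not_un W.unit_in_1 by auto
    moreover have "degree (mo g - t) < \<mu>"
    proof -
      have "degree (mo g - t) \<le> \<mu>" using mo(3)[OF g] t(3) by (intro degree_diff_le) auto
      moreover have "coeff (mo g - t) \<mu> = 0" using mo(2,3)[OF g] t(2,3) by simp
      ultimately show ?thesis using \<open>mo g \<noteq> t\<close>
        by (metis eq_iff_diff_eq_0 le_neq_implies_less leading_coeff_0_iff)
    qed
    ultimately show ?thesis using mo(1)[OF g] t(1) subring_polys_over by (auto simp: S_def intro: subring_set_diff)
  qed
  have E'': "finite E''" "E'' \<subseteq> {g \<in> polys_over F. g \<noteq> 0 \<and> degree g < \<mu>}"
  proof -
    show "finite E''" unfolding E''_def using E'(1) by (auto simp: lo_def Hi_def)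
    show "E'' \<subseteq> {g \<in> polys_over F. g \<noteq> 0 \<and> degree g < \<mu>}"
      unfolding E''_def using a(1,2) E'(2) mot Hi(4,5) polys_over_constant \<mu>1 by (auto simp: lo_def S_def)
  qed
  obtain N r T \<rho> c l where systemT: "system \<mu> N r T \<rho> c l" and h: "\<And>g. g \<in> E'' \<Longrightarrow> unit_multiple (pe T ` poly_algebra V N) g"
    and alt: "if \<mu> = 1 then r = N else Suc r = N \<and> (\<exists>e0 p cp lp. lead_rel N r T t e0 p cp lp)"
    using IH[OF \<mu>1 \<mu>m, unfolded chain_exists_def, rule_format, OF E'' t(1,3)] by blast
  define D where "D = pe T ` poly_algebra V N"
  define \<tau> where "\<tau> = smult (1 / e) t"
  have te: "t = smult e \<tau>" using t(5) by (simp add: \<tau>_def)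
  have \<tau>F: "\<tau> \<in> polys_over F" unfolding \<tau>_def
    using polys_over_smult[OF subring_F _ t(1)] subfield_set_divide[OF F subring_set_one[OF subring_F]] t(4) KF by blast
  have \<tau>z: "poly \<tau> z \<in> W" using W.nonunits_in[OF t(6)] by (simp add: \<tau>_def)
  \<comment> \<open>Used twice: for the algebra enlarged by \<open>\<tau>\<close>, to recognize
    \<open>E\<close>, and for \<open>D\<close> itself in the contradiction below, to recognize
    \<open>Eb\<close>.\<close>
  have lift: "unit_multiple D' x" if D': "admissible D'" "\<And>g. g \<in> E'' \<Longrightarrow> unit_multiple D' g" "\<tau> \<in> D'" and x: "x \<in> E \<union> Eb" for D' x
  proof (rule E'(3)[OF D'(1) _ x])
    fix g assume g: "g \<in> E'"
    show "unit_multiple D' g"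
    proof (cases "degree g < \<mu>")
      case True
      then show ?thesis using D'(2) g by (simp add: E''_def lo_def)
    next
      case False
      then have gH: "g \<in> Hi" using g E'(2) by (auto simp: Hi_def S_def)
      show ?thesis
      proof (rule unit_multiple_lift[OF D'(1) Hi(1)[OF gH] Hi(4)[OF gH] _ _ te D'(3) _ mo(5)[OF gH] t(4)])
        show "unit_multiple D' [:lead_coeff g:]" "unit_multiple D' (smult (1 / lead_coeff g) g - t)"
          using D'(2) gH unfolding E''_def mo_def by blast+
        show "poly t z / (poly g z / lead_coeff g) \<in> nonunits W" "e / (poly g z / lead_coeff g) \<in> nonunits W"
          using t(7,8)[of "mo g"] gH mo(4)[OF gH] by auto
      qed
    qed
  qed
  define T' where "T' = T(N := \<tau>)"
  have "\<exists>\<rho>' c' l'. system m (Suc N) N T' \<rho>' c' l'"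
  proof (cases "\<mu> = 1")
    case True
    then have "r = N" using alt by simp
    moreover have "degree \<tau> = 1" unfolding \<tau>_def using t(3,5) True by simp
    ultimately have "system 2 (Suc N) N T' \<rho> c l"
      unfolding T'_def using add_free_variable[OF _ \<tau>F _ \<tau>z] systemT True by simp
    then show ?thesis using system_mono m by blast
  next
    case False
    then obtain e0 p cp lp where r: "Suc r = N" and L: "lead_rel N r T t e0 p cp lp" using alt by auto
    have e0: "e0 \<in> K" "e0 \<noteq> 0" "p \<in> poly_algebra V N" "t = smult e0 (pe T p)" using L unfolding lead_rel_def by auto
    \<comment> \<open>Otherwise \<open>\<tau>\<close> is in \<open>D\<close> and \<open>D\<close>
      recognizes all of \<open>Eb\<close>. By the choice of \<open>Eb\<close> some admissible
      \<open>D2\<close> recognizes the nonzero \<open>T i\<close> but not all of \<open>Eb\<close>.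
      As the \<open>T i\<close> have values in \<open>W\<close>, recognizing them means containing
      them, so \<open>D \<subseteq> D2\<close>, a contradiction.\<close>
    have "e0 / e \<notin> V"
    proof
      assume eV: "e0 / e \<in> V"
      have aD: "admissible D" unfolding D_def using admissible_sys[OF systemT] .
      have "\<tau> = [:e0 / e:] * pe T p" unfolding \<tau>_def e0(4) by simp
      moreover have "[:e0 / e:] \<in> D" "subring_set D" using aD eV unfolding admissible_def by blast+
      moreover have "pe T p \<in> D" using e0(3) unfolding D_def by blast
      ultimately have \<tau>D: "\<tau> \<in> D" using subring_set_mult by metis
      have hb: "unit_multiple D x" if "x \<in> Eb" for x
        by (rule lift[OF aD]) (use h that \<tau>D in \<open>auto simp: D_def\<close>)
      have "finite (T ` {..<N} - {0})" "T ` {..<N} - {0} \<subseteq> S \<mu>" using systemD(2,3)[OF systemT] by (auto simp: S_def)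
      from Eb(3)[OF this] obtain D2 where D2: "admissible D2" "\<forall>x\<in>T ` {..<N} - {0}. unit_multiple D2 x" "\<exists>x\<in>Eb. \<not> unit_multiple D2 x"
        by (elim exE conjE)
      have "T i \<in> D2" if i: "i < N" for i
      proof (cases "T i = 0")
        case True
        then show ?thesis using D2(1) unfolding admissible_def by (auto intro: subring_set_zero)
      next
        case False
        then have "unit_multiple D2 (T i)" using D2(2) i by simp
        then obtain b u where b: "b \<in> K" "b \<noteq> 0" "u \<in> D2" "unit_in W (poly u z)" "T i = smult b u" unfolding unit_multiple_def by blast
        have "b = poly (T i) z * inverse (poly u z)" using b(4,5) by (simp add: unit_in_def)
        moreover have "poly (T i) z * inverse (poly u z) \<in> W"
          using systemD(4)[OF systemT i] b(4) W.V by (auto simp: unit_in_def intro: subring_set_mult)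
        ultimately have "b \<in> V" using K_W b(1) by simp
        moreover have "T i = [:b:] * u" using b(5) by simp
        moreover have "subring_set D2" "\<forall>a\<in>V. [:a:] \<in> D2" using D2(1) unfolding admissible_def by blast+
        ultimately show ?thesis using b(3) subring_set_mult by metis
      qed
      note TD2 = this
      have "D \<subseteq> D2" unfolding D_def
      proof clarify
        fix x assume "x \<in> poly_algebra V N"
        then show "pe T x \<in> D2"
          by (rule eval_mpoly_in[OF is_ring_hom_pconst _ V.V]) (use D2(1) TD2 in \<open>auto simp: admissible_def\<close>)
      qed
      then show False using D2(3) hb unit_multiple_mono by blast
    qed
    moreover have "e0 / e \<in> K" "e0 / e \<noteq> 0" using subfield_set_divide[OF K e0(1) t(4)] e0(2) t(5) by auto
    ultimately have "inverse (e0 / e) \<in> nonunits V" using K_cases by blast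
    then have e': "e / e0 \<in> nonunits V" "e / e0 \<noteq> 0" using e0(2) t(5) by auto
    have "degree \<tau> < m" unfolding \<tau>_def using t(3,5) \<mu>m by simp
    moreover have "smult (e / e0) \<tau> = pe T p" unfolding \<tau>_def e0(4) using e0(2) t(5) by simp
    ultimately show ?thesis unfolding T'_def
      using add_bound_variable[OF systemT r L e' \<tau>F \<tau>z, of m] \<mu>m by fastforce
  qed
  then obtain \<rho>' c' l' where systemT': "system m (Suc N) N T' \<rho>' c' l'" by blast
  define D' where "D' = pe T' ` poly_algebra V (Suc N)"
  have aD': "admissible D'" unfolding D'_def using admissible_sys[OF systemT'] .
  have T'T: "T' i = T i" if "i < N" for i using that by (simp add: T'_def)
  have DD': "D \<subseteq> D'" unfolding D_def D'_def
  proof clarify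
    fix x assume x: "x \<in> poly_algebra V N"
    then have "x \<in> poly_algebra V (Suc N)" using poly_algebra_mono[of V V N "Suc N"] by auto
    moreover have "pe T x = pe T' x" using pe_cong[OF x] T'T by metis
    ultimately show "pe T x \<in> pe T' ` poly_algebra V (Suc N)" by blast
  qed
  have \<tau>V: "\<tau> = pe T' (Var N)" by (simp add: pe_hom T'_def)
  then have "\<tau> \<in> D'" unfolding D'_def using Var_in[OF V.V, of N "Suc N"] by blast
  moreover have "unit_multiple D' g" if "g \<in> E''" for g using unit_multiple_mono[OF DD'] h[OF that] unfolding D_def by blast
  ultimately have "unit_multiple D' x" if "x \<in> E" for x using lift[OF aD'] that by blast
  moreover have "\<exists>e0 p cp lp. lead_rel (Suc N) N T' q e0 p cp lp"
  proof (rule lead_rel_expansion[OF \<tau>V te t(4,5) T'T _ a(3) q0 a(4)])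
    show "unit_multiple (pe T ` poly_algebra V N) (a j)" if "j \<le> degree q" "a j \<noteq> 0" for j
      using h[of "a j"] that q(2) by (auto simp: E''_def)
  qed
  ultimately show "\<exists>N r T \<rho> c l. system m N r T \<rho> c l \<and> (\<forall>g\<in>E. unit_multiple (pe T ` poly_algebra V N) g) \<and>
      (if m = 1 then r = N else Suc r = N \<and> (\<exists>e0 p cp lp. lead_rel N r T q e0 p cp lp))"
    using systemT' m unfolding D'_def by (intro exI[of _ "Suc N"] exI[of _ N] exI[of _ T'] exI[of _ \<rho>'] exI[of _ c'] exI[of _ l']) auto
qed

end

section \<open>Adjoining one algebraic element\<close>

context poly_system
begin

text \<open>Below the degree \<open>n\<close> of the minimal polynomial \<open>f\<close> nothing
  vanishes at \<open>z\<close>, so chains exist up to \<open>n\<close>, and the one prepared for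
  \<open>q = f\<close> is closed by \<open>f\<close>. Elements of the new field are values of
  polynomials of degree below \<open>n\<close>, so finitely many of them form a test set for that
  chain.\<close>

theorem exhaustible_adjoin:
  assumes exhaustible: "exhaustible F" and alg: "\<exists>g\<in>polys_over F. g \<noteq> 0 \<and> poly g z = 0"
  shows "subfield_set ((\<lambda>g. poly g z) ` polys_over F) \<and> exhaustible ((\<lambda>g. poly g z) ` polys_over F)"
proof -
  let ?F' = "(\<lambda>g. poly g z) ` polys_over F"
  define n where "n = (LEAST n. \<exists>g\<in>polys_over F. g \<noteq> 0 \<and> poly g z = 0 \<and> degree g = n)"
  have "\<exists>n. \<exists>g\<in>polys_over F. g \<noteq> 0 \<and> poly g z = 0 \<and> degree g = n" using alg by blast
  then have "\<exists>g\<in>polys_over F. g \<noteq> 0 \<and> poly g z = 0 \<and> degree g = n" unfolding n_def by (rule LeastI_ex)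
  then obtain g0 where g0: "g0 \<in> polys_over F" "g0 \<noteq> 0" "poly g0 z = 0" "degree g0 = n" by blast
  have nz: "poly g z \<noteq> 0" if "g \<in> polys_over F" "g \<noteq> 0" "degree g < n" for g
    using not_less_Least[of "degree g" "\<lambda>n. \<exists>g\<in>polys_over F. g \<noteq> 0 \<and> poly g z = 0 \<and> degree g = n"] that
    unfolding n_def by blast
  define f where "f = smult (1 / lead_coeff g0) g0"
  have lF: "1 / lead_coeff g0 \<in> F" using subfield_set_divide[OF F subring_set_one[OF subring_F] polys_over_coeff[OF g0(1)]] .
  have f: "f \<in> polys_over F" "lead_coeff f = 1" "degree f = n" "poly f z = 0" "f \<noteq> 0"
    using g0 polys_over_smult[OF subring_F lF] by (auto simp: f_def)
  have n1: "n \<ge> 1"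
  proof (rule ccontr)
    assume "\<not> 1 \<le> n"
    then have "degree f = 0" using f(3) by simp
    then obtain a where "f = [:a:]" by (rule degree_eq_zeroE)
    then show False using f(4,5) by simp
  qed
  have div: "\<exists>h\<in>polys_over F. g = f * h" if g: "g \<in> polys_over F" "poly g z = 0" for g
  proof -
    obtain h r where h: "h \<in> polys_over F" "r \<in> polys_over F" "g = f * h + r" "r = 0 \<or> degree r < degree f"
      using polys_over_division[OF subring_F f(1,2) g(1)] by blast
    have "poly r z = 0" using g(2) f(4) by (simp add: h(3))
    then have "r = 0" using nz h(2,4) f(3) by blast
    then show ?thesis using h by auto
  qed
  have low: "\<exists>g\<in>polys_over F. a = poly g z \<and> degree g < n" if a: "a \<in> ?F'" for a
  proof -
    obtain g where g: "g \<in> polys_over F" "a = poly g z" using a by blast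
    obtain h r where h: "h \<in> polys_over F" "r \<in> polys_over F" "g = f * h + r" "r = 0 \<or> degree r < degree f"
      using polys_over_division[OF subring_F f(1,2) g(1)] by blast
    have "a = poly r z" using g(2) f(4) by (simp add: h(3))
    moreover have "degree r < n" using h(4) f(3) n1 by auto
    ultimately show ?thesis using h(2) by blast
  qed
  have ring: "subring_set ?F'" unfolding subring_set_def
  proof (intro conjI ballI)
    show "1 \<in> ?F'" using subring_set_one[OF subring_polys_over] by (intro image_eqI[of _ _ 1]) auto
    fix x y assume "x \<in> ?F'" "y \<in> ?F'"
    then obtain g h where gh: "g \<in> polys_over F" "h \<in> polys_over F" "x = poly g z" "y = poly h z" by blast
    show "x - y \<in> ?F'" using gh subring_set_diff[OF subring_polys_over gh(1,2)] by (intro image_eqI[of _ _ "g - h"]) auto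
    show "x * y \<in> ?F'" using gh subring_set_mult[OF subring_polys_over gh(1,2)] by (intro image_eqI[of _ _ "g * h"]) auto
  qed
  have FF': "F \<subseteq> ?F'"
  proof
    fix a assume "a \<in> F"
    then show "a \<in> ?F'" using polys_over_constant by (intro image_eqI[of _ _ "[:a:]"]) auto
  qed
  \<comment> \<open>Divide \<open>f\<close> by \<open>g\<close>: the remainder \<open>r\<close> is
    nonzero by minimality of \<open>n\<close> and has smaller degree, and
    \<open>inverse (poly g z)\<close> is expressed through
    \<open>inverse (poly r z)\<close>.\<close>
  have inv: "inverse (poly g z) \<in> ?F'" if "g \<in> polys_over F" "g \<noteq> 0" "degree g < n" for g
    using that
  proof (induction "degree g" arbitrary: g rule: less_induct)
    case less
    show ?case
    proof (cases "degree g = 0")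
      case True
      then obtain a where a: "g = [:a:]" by (rule degree_eq_zeroE)
      then have "a \<in> F" using polys_over_coeff[OF less(2), of 0] by simp
      then show ?thesis using a FF' subfield_set_inverse[OF F] by auto
    next
      case False
      let ?c = "lead_coeff g"
      have c: "?c \<noteq> 0" "1 / ?c \<in> F" "?c \<in> F"
        using less(3) subfield_set_divide[OF F subring_set_one[OF subring_F] polys_over_coeff[OF less(2)]] polys_over_coeff[OF less(2)] by auto
      let ?g = "smult (1 / ?c) g"
      have g: "?g \<in> polys_over F" "lead_coeff ?g = 1" "degree ?g = degree g" using polys_over_smult[OF subring_F c(2) less(2)] c(1) by auto
      obtain h r where h: "h \<in> polys_over F" "r \<in> polys_over F" "f = ?g * h + r" "r = 0 \<or> degree r < degree ?g"
        using polys_over_division[OF subring_F g(1,2) f(1)] by blast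
      have gz: "poly g z \<noteq> 0" using nz less by blast
      have eq: "poly g z / ?c * poly h z + poly r z = 0" using f(4) by (simp add: h(3))
      have r0: "r \<noteq> 0"
      proof
        assume r: "r = 0"
        then have hz: "poly h z = 0" using eq gz c(1) by simp
        have "h \<noteq> 0" "?g \<noteq> 0" using h(3) r f(5) by auto
        then have "degree f = degree g + degree h" using h(3) r g(3) by (simp add: degree_mult_eq)
        then have "degree h < n" using False f(3) by simp
        then show False using nz[OF h(1) \<open>h \<noteq> 0\<close>] hz by blast
      qed
      then have dr: "degree r < degree g" using h(4) g(3) by simp
      have "inverse (poly r z) \<in> ?F'" using less(1)[OF dr h(2) r0] dr less(4) by simp
      moreover have "poly h z \<in> ?F'" using h(1) by blast
      moreover have "- (1 / ?c) \<in> ?F'" using c(2) FF' subring_set_uminus[OF subring_F] by blast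
      ultimately have "- (1 / ?c) * poly h z * inverse (poly r z) \<in> ?F'" using ring by (intro subring_set_mult)
      moreover have "- (1 / ?c) * poly h z * inverse (poly r z) = inverse (poly g z)"
      proof -
        have rz: "poly r z = - (poly g z / ?c * poly h z)" using eq by (simp add: eq_neg_iff_add_eq_0 add.commute)
        have "poly r z \<noteq> 0" using nz[OF h(2) r0] dr less(4) by simp
        then have "poly h z \<noteq> 0" unfolding rz by auto
        then show ?thesis unfolding rz using gz c(1) by (simp add: field_simps)
      qed
      ultimately show ?thesis by simp
    qed
  qed
  have field: "subfield_set ?F'" unfolding subfield_set_def
  proof (intro conjI ballI ring)
    fix a assume "a \<in> ?F'"
    then obtain g where g: "g \<in> polys_over F" "a = poly g z" "degree g < n" using low by blast
    show "inverse a \<in> ?F'"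
    proof (cases "g = 0")
      case True
      then show ?thesis using g(2) subring_set_zero[OF ring] by simp
    qed (use inv g in simp)
  qed
  have "exhaustible ?F'"
  \<comment> \<open>For \<open>n = 1\<close> the element \<open>z\<close> already lies in
    \<open>F\<close>, whereas \<open>chain_exists 1\<close> offers no leading relation to close
    with.\<close>
  proof (cases "n = 1")
    case True
    have "?F' \<subseteq> F"
    proof
      fix a assume "a \<in> ?F'"
      then obtain g where g: "g \<in> polys_over F" "a = poly g z" "degree g < n" using low by blast
      then obtain c where "g = [:c:]" using True by (metis degree_eq_zeroE less_one)
      then show "a \<in> F" using g polys_over_coeff[OF g(1), of 0] by simp
    qed
    then have "?F' = F" using FF' by blast
    then show ?thesis using exhaustible by simp
  next
    case False
    then have n2: "n \<ge> 2" using n1 by simp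
    have "1 \<le> m \<Longrightarrow> m \<le> n \<Longrightarrow> chain_exists m" for m
    proof (induction m rule: less_induct)
      case (less m)
      show ?case
      proof (cases "m = 1")
        case True
        then show ?thesis using chain_exists_1 exhaustible by simp
      next
        case False
        then have "m \<ge> 2" using less by simp
        then show ?thesis by (rule chain_exists_step) (use less nz in auto)
      qed
    qed
    then have Hn: "chain_exists n" using n1 by simp
    show ?thesis unfolding exhaustible_def
    proof (intro allI impI)
      fix E assume E: "finite E" "E \<subseteq> ?F' - {0}"
      have "\<exists>g. g \<in> polys_over F \<and> a = poly g z \<and> degree g < n" if "a \<in> E" for a
        using low[of a] E(2) that by blast
      then obtain G where G: "\<And>a. a \<in> E \<Longrightarrow> G a \<in> polys_over F \<and> a = poly (G a) z \<and> degree (G a) < n" by metis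
      define E2 where "E2 = G ` E"
      have GE: "finite E2" "E2 \<subseteq> {g \<in> polys_over F. g \<noteq> 0 \<and> degree g < n}"
      proof -
        have "G a \<noteq> 0" if "a \<in> E" for a 
        proof
          assume g0: "G a = 0"
          have "a = poly (G a) z" using G[OF that] by blast
          then have "a = 0" using g0 by (metis poly_0)
          then show False using E(2) that by blast
        qed
        moreover have "G a \<in> polys_over F" "degree (G a) < n" if "a \<in> E" for a using G[OF that] by blast+
        ultimately show "E2 \<subseteq> {g \<in> polys_over F. g \<noteq> 0 \<and> degree g < n}"
          unfolding E2_def by (intro image_subsetI CollectI conjI) simp_all
        show "finite E2" unfolding E2_def using E(1) by (rule finite_imageI)
      qed
      obtain N r T \<rho> c l where systemT: "system n N r T \<rho> c l" and h: "\<And>g. g \<in> E2 \<Longrightarrow> unit_multiple (pe T ` poly_algebra V N) g"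
        and alt: "if n = 1 then r = N else Suc r = N \<and> (\<exists>e0 p cp lp. lead_rel N r T f e0 p cp lp)"
        using Hn[unfolded chain_exists_def, rule_format, OF GE f(1,3)] by blast
      obtain e0 p cp lp where r: "Suc r = N" and L: "lead_rel N r T f e0 p cp lp" using alt False by auto
      let ?y = "\<lambda>i. poly (T i) z"
      have ci: "ci_data V W N ?y (\<rho>(r := p)) (c(r := cp)) (l(r := lp))"
        using close_system[OF systemT r L f(4) div] by blast
      have "closed_system ?F' N ?y (\<rho>(r := p)) (c(r := cp)) (l(r := lp))"
        unfolding closed_system_def
      proof (intro conjI ci allI impI ballI)
        show "?y i \<in> ?F'" if "i < N" for i using systemD(2)[OF systemT that] by blast
        fix a assume "a \<in> ?F'"
        then obtain g where g: "g \<in> polys_over F" "a = poly g z" by blast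
        have "r \<noteq> N" using r by simp
        then obtain e where e: "e \<in> V" "e \<noteq> 0" "smult e g \<in> pe T ` poly_algebra V N" using systemD(11)[OF systemT g(1)] by blast
        then obtain x where x: "x \<in> poly_algebra V N" "smult e g = pe T x" by blast
        have "e * a = poly (pe T x) z" unfolding x(2)[symmetric] g(2) by simp
        then have "e * a = ev ?y x" by (simp only: poly_pe)
        then show "\<exists>e\<in>V. e \<noteq> 0 \<and> e * a \<in> ev ?y ` poly_algebra V N" using e x(1) by blast
      qed
      moreover have "unit_multiple_at N ?y a" if a: "a \<in> E" for a
      proof -
        have "unit_multiple (pe T ` poly_algebra V N) (G a)" using h a unfolding E2_def by blast
        then obtain b u where b: "b \<in> K" "b \<noteq> 0" "u \<in> poly_algebra V N" "unit_in W (poly (pe T u) z)" "G a = smult b (pe T u)"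
          unfolding unit_multiple_def by blast
        have "a = poly (G a) z" using G[OF a] by blast
        then have "a = b * poly (pe T u) z" by (simp add: b(5))
        then show ?thesis unfolding unit_multiple_at_def using b(1-4) unfolding poly_pe by blast
      qed
      ultimately show "\<exists>N y \<rho> c l. closed_system ?F' N y \<rho> c l \<and> (\<forall>a\<in>E. unit_multiple_at N y a)" by blast
    qed
  qed
  then show ?thesis using field by blast
qed

end

text \<open>For directedness. The generators are the images of the variables and of
  \<open>1 / h\<close>; every element of the localization is a polynomial times a power of
  \<open>1 / h\<close>.\<close>

lemma complete_intersection_finitely_generated:
  fixes V A :: "'a::field set"
  assumes V: "subring_set V" and ci: "complete_intersection_subalgebra V A"
  shows "\<exists>E. finite E \<and> E \<subseteq> A \<and> (\<forall>C. subring_set C \<longrightarrow> V \<subseteq> C \<longrightarrow> E \<subseteq> C \<longrightarrow> A \<subseteq> C)"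
proof -
  obtain n h ps f where h: "h \<in> poly_algebra V n" "h \<noteq> 0"
    and reg: "regular_sequence (subalg (poly_localization V n h)) ps"
    and f: "f \<in> ring_iso (subalg (poly_localization V n h) Quot (Idl\<^bsub>subalg (poly_localization V n h)\<^esub> (set ps))) (subalg A)"
    and fc: "\<And>c. c \<in> V \<Longrightarrow> f (Idl\<^bsub>subalg (poly_localization V n h)\<^esub> (set ps) +>\<^bsub>subalg (poly_localization V n h)\<^esub> const_fract c) = c"
    using ci unfolding complete_intersection_subalgebra_def Let_def by blast
  define G where "G = poly_localization V n h"
  define I where "I = Idl\<^bsub>subalg G\<^esub> (set ps)"
  let ?P = "poly_algebra V n"
  have sP: "subring_set ?P" using poly_algebra_subring_set[OF V] .
  have hk: "h ^ k \<noteq> 0" for k using h(2) by simp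
  have hkP: "h ^ k \<in> ?P" for k using h(1) sP subring_set_power by blast
  have Gi: "Fract p (h ^ k) \<in> G" if "p \<in> ?P" for p k
    using that unfolding G_def poly_localization_def by blast
  have Gi0: "Fract p 1 \<in> G" if "p \<in> ?P" for p using Gi[OF that, of 0] by simp
  have Ge: "\<exists>p k. p \<in> ?P \<and> a = Fract p (h ^ k)" if "a \<in> G" for a
    using that unfolding G_def poly_localization_def by blast
  have sG: "subring_set G" unfolding subring_set_def
  proof (intro conjI ballI)
    show "1 \<in> G" using Gi0[of 1] subring_set_one[OF sP] by (simp add: One_fract_def)
    fix a b assume "a \<in> G" "b \<in> G"
    then obtain p k q j where pq: "p \<in> ?P" "a = Fract p (h ^ k)" "q \<in> ?P" "b = Fract q (h ^ j)" using Ge by blast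
    have "a - b = Fract (p * h ^ j - q * h ^ k) (h ^ (k + j))" "a * b = Fract (p * q) (h ^ (k + j))"
      unfolding pq(2,4) using hk by (simp_all add: power_add)
    moreover have "p * h ^ j - q * h ^ k \<in> ?P" "p * q \<in> ?P"
      using pq by (intro subring_set_diff[OF sP] subring_set_mult[OF sP] hkP; simp)+
    ultimately show "a - b \<in> G" "a * b \<in> G" using Gi by simp_all
  qed
  interpret R: ring "subalg G" by (rule ring_subalg[OF sG])
  have I: "ideal I (subalg G)" unfolding I_def
    by (rule R.genideal_ideal) (use reg in \<open>simp add: regular_sequence_def G_def\<close>)
  interpret I: ideal I "subalg G" by (rule I)
  have f': "f \<in> ring_iso (subalg G Quot I) (subalg A)" using f unfolding G_def I_def .
  define \<psi> where "\<psi> = f \<circ> (+>\<^bsub>subalg G\<^esub>) I"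
  have hom: "\<psi> \<in> ring_hom (subalg G) (subalg A)"
    unfolding \<psi>_def by (rule ring_hom_trans[OF I.rcos_ring_hom]) (use f' in \<open>simp add: ring_iso_def\<close>)
  have surj: "\<psi> ` G = A"
  proof -
    have "carrier (subalg G Quot I) = (+>\<^bsub>subalg G\<^esub>) I ` G"
      unfolding FactRing_def A_RCOSETS_def' by auto
    moreover have "f ` carrier (subalg G Quot I) = A" using f' by (simp add: ring_iso_def bij_betw_def)
    ultimately show ?thesis unfolding \<psi>_def by (simp add: image_comp)
  qed
  have \<psi>: "\<psi> (a * b) = \<psi> a * \<psi> b" "\<psi> (a + b) = \<psi> a + \<psi> b" if "a \<in> G" "b \<in> G" for a b
    using ring_hom_mult[OF hom, of a b] ring_hom_add[OF hom, of a b] that by auto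
  have \<psi>1: "\<psi> 1 = 1" using ring_hom_one[OF hom] by simp
  have \<psi>c: "\<psi> (Fract (Const c) 1) = c" if "c \<in> V" for c
    using fc[OF that] unfolding \<psi>_def G_def I_def by (simp add: const_fract_def Const_def)
  let ?hi = "Fract 1 (h ^ 1)"
  have hiG: "?hi \<in> G" using Gi subring_set_one[OF sP] by blast
  define E where "E = insert (\<psi> ?hi) ((\<lambda>i. \<psi> (Fract (Var i) 1)) ` {..<n})"
  have "E \<subseteq> A" unfolding E_def surj[symmetric] using hiG Gi0 Var_in[OF V] by auto
  moreover have "A \<subseteq> C" if C: "subring_set C" "V \<subseteq> C" "E \<subseteq> C" for C
  proof -
    have pow: "\<psi> (a ^ k) = \<psi> a ^ k \<and> a ^ k \<in> G" if "a \<in> G" for a k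
      using that by (induction k) (auto simp: \<psi> \<psi>1 subring_set_intros[OF sG])
    have mono: "\<psi> (Fract (sg m 1) 1) \<in> C" if m: "ks m \<subseteq> {..<n}" for m
    proof -
      have VarG: "Fract (Var i) 1 \<in> G" if "i < n" for i using Gi0 Var_in[OF V that] by blast
      have "(sg m 1 :: 'a mpoly) = mon Var m" for m :: "nat \<Rightarrow>\<^sub>0 nat"
      proof -
        have "(\<Prod>i\<in>B. Var i ^ lk m i :: 'a mpoly) = sg (\<Sum>i\<in>B. sg i (lk m i)) 1" if "finite B" for B
          using that by induction (auto simp: Var_power mult_single)
        from this[of "ks m"] show ?thesis unfolding mon_def by (simp flip: mpoly_eq_sum add: eq_commute)
      qed
      then have sm: "(sg m 1 :: 'a mpoly) = mon Var m" .
      have "Fract (prod (\<lambda>i. Var i ^ lk m i) B) 1 \<in> G \<and> \<psi> (Fract (prod (\<lambda>i. Var i ^ lk m i) B) 1) \<in> C"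
        if "finite B" "B \<subseteq> {..<n}" for B
        using that
      proof (induction B rule: finite_induct)
        case empty
        then show ?case using \<psi>1 subring_set_one[OF sG] subring_set_one[OF C(1)] by (simp add: One_fract_def)
      next
        case (insert i B)
        have p: "(Fract (Var i ^ k) 1 :: 'a mpoly fract) = Fract (Var i) 1 ^ k" for k :: nat
        proof (induction k)
          case (Suc k)
          have "(Fract (Var i ^ Suc k) 1 :: 'a mpoly fract) = Fract (Var i) 1 * Fract (Var i ^ k) 1" by simp
          then show ?case unfolding Suc by (simp only: power_Suc)
        qed (simp add: One_fract_def)
        have "(Fract (prod (\<lambda>i. Var i ^ lk m i) (insert i B)) 1 :: 'a mpoly fract) =
          Fract (Var i) 1 ^ lk m i * Fract (prod (\<lambda>i. Var i ^ lk m i) B) 1"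
          using insert(1,2) by (simp flip: p)
        moreover have "\<psi> (Fract (Var i) 1) \<in> C" using C(3) insert by (auto simp: E_def)
        ultimately show ?case using insert pow[OF VarG, of i "lk m i"] \<psi> C(1) sG
          by (auto intro: subring_set_intros)
      qed
      from this[of "ks m"] show ?thesis using m unfolding sm mon_def by simp
    qed
    have poly: "\<psi> (Fract p 1) \<in> C" if "p \<in> ?P" for p
      using that V
    proof (induction rule: poly_algebra_induct)
      case (single m a)
      have e: "sg m a = Const a * sg m 1" by (simp add: Const_def mult_single)
      have "Fract (Const a * sg m 1) 1 = Fract (Const a) 1 * Fract (sg m 1) 1" by simp
      moreover have "Const a \<in> ?P" "sg m 1 \<in> ?P"
        using Const_in[OF single(1)] poly_algebra_single[OF subring_set_one[OF V] single(2)] by auto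
      ultimately have "\<psi> (Fract (sg m a) 1) = a * \<psi> (Fract (sg m 1) 1)"
        unfolding e using \<psi>(1)[OF Gi0 Gi0] \<psi>c[OF single(1)] by simp
      then show ?case using mono[OF single(2)] subring_set_mult[OF C(1) subsetD[OF C(2) single(1)]] by simp
    next
      case (add x y)
      have "Fract (x + y) 1 = Fract x 1 + Fract y 1" by simp
      then show ?case using \<psi>(2)[OF Gi0 Gi0] add subring_set_add[OF C(1)] by simp
    qed
    show ?thesis
    proof
      fix v assume "v \<in> A"
      then obtain a where a: "a \<in> G" "v = \<psi> a" using surj by blast
      obtain p k where p: "p \<in> ?P" "a = Fract p (h ^ k)" using Ge[OF a(1)] by blast
      have "Fract 1 (h ^ k) = Fract 1 h ^ k"
      proof (induction k)
        case (Suc k)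
        have "Fract 1 (h ^ Suc k) = Fract 1 h * Fract 1 (h ^ k)" by simp
        then show ?case unfolding Suc by (simp only: power_Suc)
      qed (simp add: One_fract_def)
      moreover have "Fract p (h ^ k) = Fract p 1 * Fract 1 (h ^ k)" by simp
      ultimately have "a = Fract p 1 * ?hi ^ k" unfolding p(2) by simp
      then have "v = \<psi> (Fract p 1) * \<psi> ?hi ^ k" using a(2) \<psi>(1)[OF Gi0[OF p(1)]] pow[OF hiG, of k] by simp
      moreover have "\<psi> ?hi \<in> C" using C(3) by (simp add: E_def)
      ultimately show "v \<in> C" using poly[OF p(1)] subring_set_mult[OF C(1)] subring_set_power[OF C(1)] by simp
    qed
  qed
  ultimately show ?thesis by (intro exI[of _ E]) (auto simp: E_def)
qed

section \<open>The main theorem\<close>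

context immediate
begin

lemma exists_complete_intersection:
  assumes alg: "\<And>x. x \<in> K' \<Longrightarrow> \<exists>g\<in>polys_over K. g \<noteq> 0 \<and> poly g x = 0" and E: "finite E" "E \<subseteq> W"
  shows "\<exists>A. A \<subseteq> W \<and> complete_intersection_subalgebra V A \<and> E \<subseteq> A"
proof -
  have "\<exists>F. subfield_set F \<and> K \<subseteq> F \<and> F \<subseteq> K' \<and> exhaustible F \<and> E \<subseteq> F"
    using E
  proof (induction E rule: finite_induct)
    case empty
    then show ?case using K KK' exhaustible_K by blast
  next
    case (insert z E)
    then obtain F where FF: "subfield_set F" "K \<subseteq> F" "F \<subseteq> K'" "exhaustible F" "E \<subseteq> F" by blast
    have z: "z \<in> K'" using insert.prems WK' by blast
    interpret poly_system V W F z by unfold_locales (use FF z in auto)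
    let ?F' = "(\<lambda>g. poly g z) ` polys_over F"
    have "polys_over K \<subseteq> polys_over F" using FF(2) by (auto simp: polys_over_def)
    then have "\<exists>g\<in>polys_over F. g \<noteq> 0 \<and> poly g z = 0" using alg[OF z] by blast
    then have "subfield_set ?F'" "exhaustible ?F'" using exhaustible_adjoin FF(4) by blast+
    moreover have FF': "F \<subseteq> ?F'"
    proof
      fix a assume "a \<in> F"
      then show "a \<in> ?F'" using polys_over_constant by (intro image_eqI[of _ _ "[:a:]"]) auto
    qed
    moreover have "?F' \<subseteq> K'" using polys_over_eval_K' by blast
    moreover have "z \<in> ?F'"
    proof (rule image_eqI)
      show "[:0, 1:] \<in> polys_over F" using subring_F by (auto simp: polys_over_def coeff_pCons subring_set_zero subring_set_one split: nat.splits)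
    qed simp
    ultimately show ?case using FF by (intro exI[of _ ?F']) blast
  qed
  then obtain F where F: "subfield_set F" "K \<subseteq> F" "F \<subseteq> K'" "exhaustible F" "E \<subseteq> F" by blast
  \<comment> \<open>Zero is set aside because it is never a nonzero scalar times a unit.\<close>
  have fE: "finite (E - {0})" "E - {0} \<subseteq> F - {0}" using E F by auto
  obtain N y \<rho> c l where C: "closed_system F N y \<rho> c l" "\<forall>a\<in>E - {0}. unit_multiple_at N y a"
    using F(4)[unfolded exhaustible_def, rule_format, OF fE] by blast
  interpret ci_data V W N y \<rho> c l using C(1) unfolding closed_system_def by blast
  obtain A where A: "A \<subseteq> W" "complete_intersection_subalgebra V A" "ev y ` P \<subseteq> A" by (rule complete_intersection)
  have "a \<in> A" if a: "a \<in> E" for a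
  proof (cases "a = 0")
    case True
    then show ?thesis using A(3) subring_set_zero[OF sP] by (force simp: ev_hom)
  next
    case False
    then obtain b u where b: "b \<in> K" "b \<noteq> 0" "u \<in> P" "unit_in W (ev y u)" "a = b * ev y u"
      using C(2) a unfolding unit_multiple_at_def by blast
    \<comment> \<open>The scalar lies in \<open>W\<close> and in \<open>K\<close>, hence in
      \<open>V\<close>, so \<open>a\<close> is the value of a polynomial over
      \<open>V\<close>.\<close>
    have "b = a * inverse (ev y u)" using b(4,5) by (simp add: unit_in_def)
    moreover have "a * inverse (ev y u) \<in> W" using a E(2) b(4) W.V by (auto simp: unit_in_def intro: subring_set_mult)
    ultimately have "b \<in> V" using K_W b(1) by simp
    then have "Const b * u \<in> P" using b(3) sP Const_in subring_set_mult by blast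
    moreover have "a = ev y (Const b * u)" by (simp add: b(5) ev_hom)
    ultimately show ?thesis using A(3) by blast
  qed
  then show ?thesis using A by blast
qed

end

section \<open>Translating the record definitions into statements about elements\<close>

lemma Units_subalg: "subring_set S \<Longrightarrow> Units (subalg S) = {x. unit_in S x}"
proof -
  assume S: "subring_set S"
  have "inverse x = y" if "y * x = 1" for x y :: 'a using that by (metis inverse_unique mult.commute)
  then show ?thesis unfolding Units_def unit_in_def using S
    by (auto simp: intro!: bexI[of _ "inverse _"])
qed

lemma max_ideal_eq: "subring_set S \<Longrightarrow> max_ideal S = nonunits S"
  unfolding max_ideal_def nonunits_def by (auto simp: Units_subalg)

lemma valuation_ring_valring:
  assumes "valuation_ring V" shows "valring V"
proof
  show V: "subring_set V" using assms by (simp add: valuation_ring_def subring_ambient_iff)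
  fix a b assume ab: "a \<in> V" "b \<in> V" "a \<noteq> 0" "b \<noteq> 0"
  have "a / b \<in> fraction_field V" "a / b \<noteq> 0" using ab fraction_field_I by auto
  then have "a / b \<in> V \<or> inverse (a / b) \<in> V" using assms unfolding valuation_ring_def by blast
  then show "a / b \<in> V \<or> b / a \<in> V" by simp
qed

lemma value_group_carrier:
  assumes "subring_set S"
  shows "carrier (value_group S) = {Units (subalg S) #>\<^bsub>ambient\<^esub> x | x. x \<in> fraction_field S \<and> x \<noteq> (0::'a::field)}"
proof -
  have F: "subfield_set (fraction_field S)" using fraction_field_sfield[OF assms] .
  have U: "Units (subalg (fraction_field S)) = fraction_field S - {0}"
    using F by (auto simp: Units_subalg[OF subfield_set_sring[OF F]] unit_in_def subfield_set_inverse)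
  have "H #>\<^bsub>units_of (subalg (fraction_field S))\<^esub> x = H #>\<^bsub>ambient\<^esub> x" for H and x :: 'a
    by (simp add: r_coset_def units_of_def)
  then show ?thesis unfolding value_group_def FactGroup_def RCOSETS_def
    by (auto simp: U units_of_carrier)
qed

lemma residue_field_carrier:
  "carrier (residue_field S) = {max_ideal S +>\<^bsub>ambient\<^esub> x | x :: 'a::field. x \<in> S}"
proof -
  have "H +>\<^bsub>subalg S\<^esub> x = H +>\<^bsub>ambient\<^esub> x" for H and x :: 'a
    by (simp add: a_r_coset_def')
  then show ?thesis unfolding residue_field_def FactRing_def A_RCOSETS_def' by auto
qed

text \<open>Surjectivity of the two isomorphisms supplies the representatives: elements with equal
  cosets differ by a unit factor in the value group and by a non-unit summand in the residue
  field.\<close>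

lemma immediate_extension_immediate:
  assumes "immediate_extension V V'"
  shows "immediate V V'"
proof -
  have v: "valuation_ring V" "valuation_ring V'" "V \<subseteq> V'" "max_ideal V \<subseteq> max_ideal V'"
    and vg: "induces_value_group_iso V V'" and rf: "induces_residue_field_iso V V'"
    using assms unfolding immediate_extension_def local_extension_def by auto
  interpret V: valring V using valuation_ring_valring v by blast
  interpret W: valring V' using valuation_ring_valring v by blast
  show ?thesis
  proof unfold_locales
    show "V \<subseteq> V'" by fact
    show "unit_in V x" if "x \<in> V" "unit_in V' x" for x
      using that v(4) unfolding max_ideal_eq[OF V.V] max_ideal_eq[OF W.V] by (auto simp: nonunits_def)
    show "\<exists>b\<in>fraction_field V. b \<noteq> 0 \<and> unit_in V' (x / b)" if x: "x \<in> fraction_field V'" "x \<noteq> 0" for x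
    proof -
      obtain f where f: "f \<in> iso (value_group V) (value_group V')"
        "\<forall>x\<in>fraction_field V - {0}. f (Units (subalg V) #>\<^bsub>ambient\<^esub> x) = Units (subalg V') #>\<^bsub>ambient\<^esub> x"
        using vg unfolding induces_value_group_iso_def by blast
      have "Units (subalg V') #>\<^bsub>ambient\<^esub> x \<in> f ` carrier (value_group V)"
        using f(1) x unfolding iso_def bij_betw_def value_group_carrier[OF W.V] by blast
      then obtain b where b: "b \<in> fraction_field V" "b \<noteq> 0"
        "Units (subalg V') #>\<^bsub>ambient\<^esub> x = f (Units (subalg V) #>\<^bsub>ambient\<^esub> b)"
        unfolding value_group_carrier[OF V.V] by blast
      then have eq: "Units (subalg V') #>\<^bsub>ambient\<^esub> x = Units (subalg V') #>\<^bsub>ambient\<^esub> b" using f(2) by simp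
      have "x \<in> Units (subalg V') #>\<^bsub>ambient\<^esub> x"
        unfolding r_coset_def Units_subalg[OF W.V] using W.unit_in_1 by force
      then obtain u where "unit_in V' u" "x = u * b"
        unfolding eq unfolding r_coset_def Units_subalg[OF W.V] by auto
      then show ?thesis using b by (intro bexI[of _ b]) auto
    qed
    show "\<exists>c\<in>V. u - c \<in> nonunits V'" if u: "u \<in> V'" for u
    proof -
      obtain f where f: "f \<in> ring_iso (residue_field V) (residue_field V')"
        "\<forall>x\<in>V. f (max_ideal V +>\<^bsub>ambient\<^esub> x) = max_ideal V' +>\<^bsub>ambient\<^esub> x"
        using rf unfolding induces_residue_field_iso_def by blast
      have "max_ideal V' +>\<^bsub>ambient\<^esub> u \<in> f ` carrier (residue_field V)"
        using f(1) u unfolding ring_iso_def bij_betw_def residue_field_carrier by blast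
      then obtain c where c: "c \<in> V" "max_ideal V' +>\<^bsub>ambient\<^esub> u = f (max_ideal V +>\<^bsub>ambient\<^esub> c)"
        unfolding residue_field_carrier by blast
      then have eq: "max_ideal V' +>\<^bsub>ambient\<^esub> u = max_ideal V' +>\<^bsub>ambient\<^esub> c" using f(2) by simp
      have "u \<in> max_ideal V' +>\<^bsub>ambient\<^esub> u"
        unfolding a_r_coset_def' max_ideal_eq[OF W.V] using W.nonunD(1) by force
      then obtain h where "h \<in> nonunits V'" "u = h + c"
        unfolding eq unfolding a_r_coset_def' max_ideal_eq[OF W.V] by auto
      then show ?thesis using c(1) by (intro bexI[of _ c]) auto
    qed
  qed
qed

text \<open>HOL-Algebra stores a polynomial as its coefficient list with the leading coefficient
  first, so the reversed list gives the corresponding \<open>poly\<close>; the nonzero head makes it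
  nonzero.\<close>

lemma algebraic_root:
  assumes K: "subring_set K" and alg: "ring.algebraic ambient K (x :: 'a::field)"
  shows "\<exists>g\<in>polys_over K. g \<noteq> 0 \<and> poly g x = 0"
proof -
  interpret A: field "ambient :: 'a ring" by (rule field_from_type_algebra)
  have "(A.algebraic over K) x" using alg by (simp add: over_def)
  then obtain p where p: "p \<in> carrier (K[X]\<^bsub>ambient\<^esub>)" "p \<noteq> []" "A.eval p x = \<zero>\<^bsub>ambient\<^esub>"
    using A.algebraicE[of K x] K by (auto simp: subring_ambient_iff)
  have pow: "x [^]\<^bsub>ambient\<^esub> n = x ^ n" for n :: nat
    by (induction n) (simp_all add: mult.commute)
  have ev: "A.eval p x = poly (Poly (rev p)) x" for p
    by (induction p) (simp_all add: pow Poly_append poly_monom)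
  have pK: "set p \<subseteq> K" "hd p \<noteq> 0" using p(1,2) unfolding univ_poly_def polynomial_def by auto
  have "Poly (rev p) \<in> polys_over K"
    using pK(1) subring_set_zero[OF K] by (auto simp: polys_over_def nth_default_def rev_nth subset_iff)
  moreover have "Poly (rev p) \<noteq> 0"
  proof
    assume "Poly (rev p) = 0"
    then have "coeff (Poly (rev p)) (length p - 1) = 0" by simp
    then have "last (rev p) = 0" using p(2) by (simp add: nth_default_def last_conv_nth)
    then show False using pK(2) p(2) by (simp add: last_rev)
  qed
  ultimately show ?thesis using p(3) ev by auto
qed

theorem theorem1:
  fixes V V' :: "'a::field set"
  assumes "immediate_extension V V'"
    and "algebraic_extension (fraction_field V) (fraction_field V')"
  shows "filtered_union_of V' {A. A \<subseteq> V' \<and> complete_intersection_subalgebra V A}"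
proof -
  interpret immediate V V' using immediate_extension_immediate assms(1) .
  have alg: "\<exists>g\<in>polys_over K. g \<noteq> 0 \<and> poly g x = 0" if "x \<in> K'" for x
    using algebraic_root[OF K_sring] assms(2) that unfolding algebraic_extension_def by blast
  note ex = exists_complete_intersection[OF alg]
  let ?\<F> = "{A. A \<subseteq> V' \<and> complete_intersection_subalgebra V A}"
  show ?thesis
    unfolding filtered_union_of_def
  proof (intro conjI ballI)
    show "?\<F> \<noteq> {}" using ex[of "{}"] by auto
    show "\<Union>?\<F> = V'"
    proof
      show "V' \<subseteq> \<Union>?\<F>"
      proof
        fix x assume "x \<in> V'"
        then show "x \<in> \<Union>?\<F>" using ex[of "{x}"] by auto
      qed
    qed blast
    fix A B assume AB: "A \<in> ?\<F>" "B \<in> ?\<F>"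
    \<comment> \<open>An upper bound of \<open>A\<close> and \<open>B\<close> is any member of the
      family that contains finite generating sets of both.\<close>
    obtain E where E: "finite E" "E \<subseteq> A" "\<And>C. subring_set C \<Longrightarrow> V \<subseteq> C \<Longrightarrow> E \<subseteq> C \<Longrightarrow> A \<subseteq> C"
      using complete_intersection_finitely_generated[OF V.V, of A] AB(1) by blast
    obtain E' where E': "finite E'" "E' \<subseteq> B" "\<And>C. subring_set C \<Longrightarrow> V \<subseteq> C \<Longrightarrow> E' \<subseteq> C \<Longrightarrow> B \<subseteq> C"
      using complete_intersection_finitely_generated[OF V.V, of B] AB(2) by blast
    have "finite (E \<union> E')" "E \<union> E' \<subseteq> V'" using E E' AB by auto
    then obtain C where C: "C \<subseteq> V'" "complete_intersection_subalgebra V C" "E \<union> E' \<subseteq> C" using ex by blast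
    then have "subring_set C" "V \<subseteq> C" unfolding complete_intersection_subalgebra_def by (auto simp: subring_ambient_iff)
    then have "A \<subseteq> C" "B \<subseteq> C" using C(3) E(3)[of C] E'(3)[of C] by simp_all
    then show "\<exists>C\<in>?\<F>. A \<subseteq> C \<and> B \<subseteq> C" using C(1,2) by (intro bexI[of _ C]) simp_all
  qed
qed

end
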